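(* Let $(M,\pi)$ be a $d$-dimensional Poisson manifold, $\mathcal{D}$ a flat, torsion-free contravariant $\mathcal{F}^{reg}$-connection on $M$ with metacurvature $\mathcal{M}$, and $x\in M^{reg}$ a point where $\pi$ has rank $2r$. Let $\mathcal{H}$ be a smooth subbundle of $T^*M$ near $x$ with $T^*M=\operatorname{Ker}\pi_\sharp\oplus\mathcal{H}$ and $\mathcal{D}\mathcal{H}\subseteq\mathcal{H}$, let $(x_i,y_u)$ ($1\le i\le 2r$, $1\le u\le d-2r$) be a flat coordinate system around $x$, and let $\phi_i$, $A_i^u$, $\pi_{ij}$, $\pi^{ij}$ be as in the context. Then, near $x$: (a) For any $u=1,\ldots,d-2r$, $\mathcal{M}(dy_u,\cdot\,,\cdot\,)=0$. (b) For any $i,j,k=1,\ldots,2r$, $$\begin{aligned}\mathcal{M}(\phi_i,\phi_j,\phi_k)=&-\sum_{l<m}\frac{\partial^3\pi_{lm}}{\partial x_i\partial x_j\partial x_k}\,\phi_l\wedge\phi_m+\sum_{l,u}\frac{\partial^3A_l^u}{\partial x_i\partial x_j\partial x_k}\,\phi_l\wedge dy_u\\&+\sum_{u<v,\,l}\frac{\partial^2}{\partial x_i\partial x_j}\biggl(\pi^{kl}\Bigl(\frac{\partial A_l^u}{\partial y_v}-\frac{\partial A_l^v}{\partial y_u}+\sum_m A_m^u\frac{\partial A_l^v}{\partial x_m}-A_m^v\frac{\partial A_l^u}{\partial x_m}\Bigr)\biggr)dy_u\wedge dy_v,\end{aligned}$$ where the indices $l,m$ range over $1,\ldots,2r$,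 the indices $u,v$ over $1,\ldots,d-2r$, and $\sum_m$ applies to both terms following it.
   Context: All objects are smooth. For a Poisson manifold $(M,\pi)$, the anchor $\pi_\sharp:T^*M\to TM$ is defined by $\beta(\pi_\sharp(\alpha))=\pi(\alpha,\beta)$; $[\alpha,\beta]_\pi=L_{\pi_\sharp(\alpha)}\beta-L_{\pi_\sharp(\beta)}\alpha-d(\pi(\alpha,\beta))$ on 1-forms; $M^{reg}$ is the dense open set of points near which the rank of $\pi$ is constant; $\mathcal{S}$ is the symplectic foliation and $T\mathcal{S}=\operatorname{Im}\pi_\sharp$. A contravariant connection on $(M,\pi)$ is an $\mathbb{R}$-bilinear map $\mathcal{D}:\Omega^1(M)\times\Omega^1(M)\to\Omega^1(M)$ with $\mathcal{D}_{f\alpha}\beta=f\mathcal{D}_\alpha\beta$ and $\mathcal{D}_\alpha(f\beta)=f\mathcal{D}_\alpha\beta+\pi_\sharp(\alpha)(f)\beta$; it is local and extends to tensor fields as usual (with $\mathcal{D}_\alpha f=\pi_\sharp(\alpha)(f)$). It is torsion-free if $\mathcal{D}_\alpha\beta-\mathcal{D}_\beta\alpha=[\alpha,\beta]_\pi$, flat if $\mathcal{D}_\alpha\mathcal{D}_\beta\gamma-\mathcal{D}_\beta\mathcal{D}_\alpha\gamma-\mathcal{D}_{[\alpha,\beta]_\pi}\gamma=0$, an $\mathcal{F}$-connection if $\pi_\sharp(a)=0$ implies $\mathcal{D}_a=0$ for all $a\in T^*M$, and an $\mathcal{F}^{reg}$-connection if its restriction to $M^{reg}$ is an $\mathcal{F}$-connection.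 $\mathcal{D}\mathcal{H}\subseteq\mathcal{H}$ means $\mathcal{D}_\alpha\beta\in\Gamma(\mathcal{H})$ for every 1-form $\alpha$ and $\beta\in\Gamma(\mathcal{H})$; such complements $\mathcal{H}$ of $\operatorname{Ker}\pi_\sharp$ exist near every point of $M^{reg}$ when $\mathcal{D}$ is flat, torsion-free and $\mathcal{F}^{reg}$. For such $\mathcal{H}$, $\varpi^{\mathcal{H}}:T\mathcal{S}\to\mathcal{H}$ denotes the inverse of the isomorphism $\pi_\sharp|_{\mathcal{H}}:\mathcal{H}\to T\mathcal{S}$. Flat coordinate system: an $\mathcal{S}$-foliated coordinate system $(x_i,y_u)$ around $x$ (the $x_i$ are leafwise coordinates, the $y_u$ are transverse ones, so $T\mathcal{S}=\operatorname{span}\{\partial/\partial x_i\}$ and $\operatorname{Ker}\pi_\sharp=\operatorname{span}\{dy_u\}$) such that, for any smooth subbundle $\mathcal{H}$ of $T^*M$ near $x$ with $T^*M=\operatorname{Ker}\pi_\sharp\oplus\mathcal{H}$ and $\mathcal{D}\mathcal{H}\subseteq\mathcal{H}$, the 1-forms $\phi_i:=\varpi^{\mathcal{H}}(\partial/\partial x_i)$ and $dy_u$ form a coframe near $x$ consisting of parallel forms ($\mathcal{D}\phi_i=0$, $\mathcal{D}dy_u=0$). Such systems exist around every point of $M^{reg}$. The functions $A_i^u$ are the unique functions near $x$ such that $dx_i+\sum_{u}A_i^u\,dy_u\in\Gamma(\mathcal{H})$ for each $i$. Also $\pi_{ij}:=\pi(dx_i,dx_j)$ and $(\pi^{ij})$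 is the inverse matrix of $(\pi_{ij})_{1\le i,j\le 2r}$. Hawkins bracket: for a torsion-free $\mathcal{D}$ there is a unique $\mathbb{R}$-bilinear degree-0 bracket $\{\,,\}$ on $\Omega^*(M)$ with $\{\sigma,\tau\}=-(-1)^{\deg\sigma\deg\tau}\{\tau,\sigma\}$; $\{\sigma,\tau\wedge\rho\}=\{\sigma,\tau\}\wedge\rho+(-1)^{\deg\sigma\deg\tau}\tau\wedge\{\sigma,\rho\}$; $d\{\sigma,\tau\}=\{d\sigma,\tau\}+(-1)^{\deg\sigma}\{\sigma,d\tau\}$; $\{f,h\}=\pi(df,dh)$ and $\{f,\sigma\}=\mathcal{D}_{df}\sigma$ for functions $f,h$ and forms $\sigma$. Metacurvature: if $\mathcal{D}$ is flat and torsion-free, $\mathcal{M}$ is the tensor field taking three 1-forms (symmetrically) to a 2-form determined by $\mathcal{M}(df,\alpha,\beta)=\{f,\{\alpha,\beta\}\}-\{\{f,\alpha\},\beta\}-\{\alpha,\{f,\beta\}\}$ for functions $f$ and 1-forms $\alpha,\beta$ (its tensoriality and symmetry are known). *)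

theory Defs
  imports "HOL-Analysis.Analysis" "HOL-Library.Function_Algebras"
begin

text \<open>Pointwise vector space structure on functions, so that the library notions \<^const>\<open>span\<close>,
  \<^const>\<open>subspace\<close>, \<^const>\<open>independent\<close>, \<^const>\<open>dim\<close> apply to tangent vectors and to forms at a point.\<close>

instantiation "fun" :: (type, scaleR) scaleR
begin
definition scaleR_fun_def: "c *\<^sub>R f = (\<lambda>x. c *\<^sub>R f x)"
instance ..
end

instance "fun" :: (type, real_vector) real_vector
  by standard (auto simp: scaleR_fun_def fun_eq_iff algebra_simps)


section \<open>Smooth manifolds\<close>

primrec Ck_on :: "nat \<Rightarrow> 'e::euclidean_space set \<Rightarrow> ('e \<Rightarrow> 'f::real_normed_vector) \<Rightarrow> bool" where
  "Ck_on 0 S f = continuous_on S f"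
| "Ck_on (Suc k) S f =
     (\<exists>f'. (\<forall>x\<in>S. (f has_derivative f' x) (at x)) \<and> (\<forall>v. Ck_on k S (\<lambda>x. f' x v)))"

definition Cinf_on :: "'e::euclidean_space set \<Rightarrow> ('e \<Rightarrow> 'f::real_normed_vector) \<Rightarrow> bool" where
  "Cinf_on S f \<longleftrightarrow> (\<forall>k. Ck_on k S f)"

text \<open>The manifold is the whole (Hausdorff, second countable) type \<^typ>\<open>'a\<close>; its dimension is
  that of the Euclidean model space \<^typ>\<open>'e\<close>. A chart is a domain together with a map, of
  which only the values on the domain matter.\<close>

type_synonym ('a, 'e) chart = "'a set \<times> ('a \<Rightarrow> 'e)"
type_synonym ('a, 'e) atlas = "('a, 'e) chart set"

definition smooth_compatible ::
  "('a::topological_space, 'e::euclidean_space) chart \<Rightarrow> ('a, 'e) chart \<Rightarrow> bool" where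
  "smooth_compatible c c' \<longleftrightarrow>
     Cinf_on (snd c ` (fst c \<inter> fst c')) (snd c' \<circ> inv_into (fst c) (snd c)) \<and>
     Cinf_on (snd c' ` (fst c \<inter> fst c')) (snd c \<circ> inv_into (fst c') (snd c'))"

text \<open>Membership in the maximal atlas generated by \<open>A\<close>.\<close>

definition smooth_chart ::
  "('a::topological_space, 'e::euclidean_space) atlas \<Rightarrow> ('a, 'e) chart \<Rightarrow> bool" where
  "smooth_chart A c \<longleftrightarrow>
     open (fst c) \<and> open (snd c ` fst c) \<and>
     homeomorphism (fst c) (snd c ` fst c) (snd c) (inv_into (fst c) (snd c)) \<and>
     (\<forall>c'\<in>A. smooth_compatible c c')"

definition smooth_atlas :: "('a::topological_space, 'e::euclidean_space) atlas \<Rightarrow> bool" where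
  "smooth_atlas A \<longleftrightarrow> (\<forall>c\<in>A. smooth_chart A c) \<and> (\<Union>c\<in>A. fst c) = UNIV"

definition smooth_fun_on ::
  "('a::topological_space, 'e::euclidean_space) atlas \<Rightarrow> 'a set \<Rightarrow> ('a \<Rightarrow> real) \<Rightarrow> bool" where
  "smooth_fun_on A V f \<longleftrightarrow>
     (\<forall>c\<in>A. Cinf_on (snd c ` (fst c \<inter> V)) (f \<circ> inv_into (fst c) (snd c)))"

definition smooth_at ::
  "('a::topological_space, 'e::euclidean_space) atlas \<Rightarrow> 'a \<Rightarrow> ('a \<Rightarrow> real) \<Rightarrow> bool" where
  "smooth_at A p f \<longleftrightarrow> (\<exists>V. open V \<and> p \<in> V \<and> smooth_fun_on A V f)"


section \<open>Tangent vectors, vector fields and differential forms\<close>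

text \<open>A tangent vector at \<open>p\<close> is a derivation on the functions that are smooth near \<open>p\<close>
  (the Leibniz rule makes it depend on germs only); it is normalized to vanish on all other
  functions, so that distinct functions represent distinct vectors.\<close>

type_synonym 'a tvec = "('a \<Rightarrow> real) \<Rightarrow> real"

definition tangent_space ::
  "('a::topological_space, 'e::euclidean_space) atlas \<Rightarrow> 'a \<Rightarrow> 'a tvec set" where
  "tangent_space A p = {v.
     (\<forall>f g. smooth_at A p f \<longrightarrow> smooth_at A p g \<longrightarrow>
        v (\<lambda>q. f q + g q) = v f + v g \<and>
        v (\<lambda>q. f q * g q) = f p * v g + g p * v f) \<and>
     (\<forall>c f. smooth_at A p f \<longrightarrow> v (\<lambda>q. c * f q) = c * v f) \<and>
     (\<forall>f. \<not> smooth_at A p f \<longrightarrow> v f = 0)}"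

text \<open>The vector at \<open>q\<close> that has the constant components \<open>w\<close> in the chart \<open>c\<close>.\<close>

definition chart_vec ::
  "('a::topological_space, 'e::euclidean_space) atlas \<Rightarrow> ('a, 'e) chart \<Rightarrow> 'e \<Rightarrow> 'a \<Rightarrow> 'a tvec" where
  "chart_vec A c w q =
     (\<lambda>f. if q \<in> fst c \<and> smooth_at A q f
          then frechet_derivative (f \<circ> inv_into (fst c) (snd c)) (at (snd c q)) w else 0)"

definition smooth_vfield_on ::
  "('a::topological_space, 'e::euclidean_space) atlas \<Rightarrow> 'a set \<Rightarrow> ('a \<Rightarrow> 'a tvec) \<Rightarrow> bool" where
  "smooth_vfield_on A V X \<longleftrightarrow>
     (\<forall>q\<in>V. X q \<in> tangent_space A q) \<and>
     (\<forall>V' f. open V' \<longrightarrow> V' \<subseteq> V \<longrightarrow> smooth_fun_on A V' f \<longrightarrow> smooth_fun_on A V' (\<lambda>q. X q f))"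

text \<open>Forms at a point are functions on lists of tangent vectors; a form of degree \<open>k\<close> vanishes
  on every list that is not a list of \<open>k\<close> tangent vectors. Forms of all degrees, also
  inhomogeneous ones, thus live in the same type: the degree \<open>k\<close> part is the restriction to
  lists of length \<open>k\<close>. In particular a covector \<open>a\<close> is evaluated as \<open>a [v]\<close>.\<close>

type_synonym 'a alt = "'a tvec list \<Rightarrow> real"
type_synonym 'a form = "'a \<Rightarrow> 'a alt"

definition alt_space ::
  "('a::topological_space, 'e::euclidean_space) atlas \<Rightarrow> 'a \<Rightarrow> nat \<Rightarrow> 'a alt set" where
  "alt_space A p k = {a.
     (\<forall>vs. \<not> (length vs = k \<and> set vs \<subseteq> tangent_space A p) \<longrightarrow> a vs = 0) \<and>
     (\<forall>vs i v w c. length vs = k \<longrightarrow> set vs \<subseteq> tangent_space A p \<longrightarrow> i < k \<longrightarrow>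
        v \<in> tangent_space A p \<longrightarrow> w \<in> tangent_space A p \<longrightarrow>
        a (vs[i := c *\<^sub>R v + w]) = c * a (vs[i := v]) + a (vs[i := w])) \<and>
     (\<forall>vs i j. i < j \<longrightarrow> j < length vs \<longrightarrow> vs ! i = vs ! j \<longrightarrow> a vs = 0)}"

abbreviation cotangent_space ::
  "('a::topological_space, 'e::euclidean_space) atlas \<Rightarrow> 'a \<Rightarrow> 'a alt set" where
  "cotangent_space A p \<equiv> alt_space A p 1"

definition smooth_form_on ::
  "('a::topological_space, 'e::euclidean_space) atlas \<Rightarrow> 'a set \<Rightarrow> nat \<Rightarrow> 'a form \<Rightarrow> bool" where
  "smooth_form_on A V k \<omega> \<longleftrightarrow>
     (\<forall>q\<in>V. \<omega> q \<in> alt_space A q k) \<and>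
     (\<forall>V' Xs. open V' \<longrightarrow> V' \<subseteq> V \<longrightarrow> length Xs = k \<longrightarrow> (\<forall>X\<in>set Xs. smooth_vfield_on A V' X) \<longrightarrow>
        smooth_fun_on A V' (\<lambda>q. \<omega> q (map (\<lambda>X. X q) Xs)))"

definition Omega ::
  "('a::topological_space, 'e::euclidean_space) atlas \<Rightarrow> nat \<Rightarrow> 'a form set" where
  "Omega A k = {\<omega>. smooth_form_on A UNIV k \<omega>}"

text \<open>All forms, possibly inhomogeneous. This is the direct sum of the \<^term>\<open>Omega A k\<close>, since these
  are zero for \<open>k\<close> above the dimension.\<close>

definition Omega_all ::
  "('a::topological_space, 'e::euclidean_space) atlas \<Rightarrow> 'a form set" where
  "Omega_all A = {\<omega>. \<forall>k. (\<lambda>p vs. if length vs = k then \<omega> p vs else 0) \<in> Omega A k}"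

definition fun_form :: "('a \<Rightarrow> real) \<Rightarrow> 'a form" where
  "fun_form f = (\<lambda>p vs. if vs = [] then f p else 0)"

definition fmul :: "('a \<Rightarrow> real) \<Rightarrow> 'a form \<Rightarrow> 'a form" where
  "fmul f \<omega> = (\<lambda>p. f p *\<^sub>R \<omega> p)"

text \<open>Exterior product as a sum over shuffles: \<open>I\<close> is the set of positions of the vectors fed to
  the first factor and the exponent counts inversions. On covectors
  \<open>(a \<and> b)(v, w) = a(v) b(w) - a(w) b(v)\<close>.\<close>

definition alt_wedge :: "'a alt \<Rightarrow> 'a alt \<Rightarrow> 'a alt" where
  "alt_wedge a b = (\<lambda>vs. \<Sum>I\<in>Pow {..<length vs}.
     (- 1) ^ card {(i, j). i \<in> I \<and> j \<in> {..<length vs} - I \<and> j < i} *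
     a (nths vs I) * b (nths vs (- I)))"

definition wedge :: "'a form \<Rightarrow> 'a form \<Rightarrow> 'a form" where
  "wedge \<sigma> \<tau> = (\<lambda>p. alt_wedge (\<sigma> p) (\<tau> p))"

text \<open>Extension of a tangent vector at \<open>p\<close> to a vector field near \<open>p\<close> with constant components
  in a chart around \<open>p\<close>.\<close>

definition const_ext ::
  "('a::topological_space, 'e::euclidean_space) atlas \<Rightarrow> 'a \<Rightarrow> 'a tvec \<Rightarrow> 'a \<Rightarrow> 'a tvec" where
  "const_ext A p v =
     (let c = (SOME c. c \<in> A \<and> p \<in> fst c)
      in chart_vec A c (\<Sum>e\<in>Basis. v (\<lambda>z. snd c z \<bullet> e) *\<^sub>R e))"

text \<open>Exterior derivative at \<open>p\<close>, by the usual coordinate definition in a chart around \<open>p\<close> (as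
  usual, the result does not depend on the chart): the extended vector fields commute, so only
  the terms \<open>(-1)\<^sup>i v\<^sub>i(\<omega>(V\<^sub>0, \<dots>, V\<^sub>k))\<close> with \<open>V\<^sub>i\<close> omitted occur. It acts on
  forms of every degree.\<close>

definition ext_d ::
  "('a::topological_space, 'e::euclidean_space) atlas \<Rightarrow> 'a form \<Rightarrow> 'a form" where
  "ext_d A \<omega> = (\<lambda>p vs. if set vs \<subseteq> tangent_space A p
     then \<Sum>i<length vs. (- 1) ^ i *
       (vs ! i) (\<lambda>q. \<omega> q (map (\<lambda>v. const_ext A p v q) (take i vs @ drop (Suc i) vs)))
     else 0)"

abbreviation diff_fun ::
  "('a::topological_space, 'e::euclidean_space) atlas \<Rightarrow> ('a \<Rightarrow> real) \<Rightarrow> 'a form" where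
  "diff_fun A f \<equiv> ext_d A (fun_form f)"

definition interior_prod :: "('a \<Rightarrow> 'a tvec) \<Rightarrow> 'a form \<Rightarrow> 'a form" where
  "interior_prod X \<omega> = (\<lambda>p vs. \<omega> p (X p # vs))"

definition lie_deriv ::
  "('a::topological_space, 'e::euclidean_space) atlas \<Rightarrow> ('a \<Rightarrow> 'a tvec) \<Rightarrow> 'a form \<Rightarrow> 'a form" where
  "lie_deriv A X \<omega> = interior_prod X (ext_d A \<omega>) + ext_d A (interior_prod X \<omega>)"


section \<open>Poisson manifolds\<close>

type_synonym 'a bivector = "'a \<Rightarrow> 'a alt \<Rightarrow> 'a alt \<Rightarrow> real"

definition smooth_bivector ::
  "('a::topological_space, 'e::euclidean_space) atlas \<Rightarrow> 'a bivector \<Rightarrow> bool" where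
  "smooth_bivector A \<pi> \<longleftrightarrow>
     (\<forall>p. \<forall>a\<in>cotangent_space A p. \<forall>b\<in>cotangent_space A p. \<forall>a'\<in>cotangent_space A p. \<forall>c.
        \<pi> p (c *\<^sub>R a + a') b = c * \<pi> p a b + \<pi> p a' b \<and> \<pi> p a b = - \<pi> p b a) \<and>
     (\<forall>V \<alpha> \<beta>. open V \<longrightarrow> smooth_form_on A V 1 \<alpha> \<longrightarrow> smooth_form_on A V 1 \<beta> \<longrightarrow>
        smooth_fun_on A V (\<lambda>q. \<pi> q (\<alpha> q) (\<beta> q)))"

definition poisson_bracket ::
  "('a::topological_space, 'e::euclidean_space) atlas \<Rightarrow> 'a bivector \<Rightarrow>
   ('a \<Rightarrow> real) \<Rightarrow> ('a \<Rightarrow> real) \<Rightarrow> 'a \<Rightarrow> real" where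
  "poisson_bracket A \<pi> f g = (\<lambda>p. \<pi> p (diff_fun A f p) (diff_fun A g p))"

definition poisson ::
  "('a::topological_space, 'e::euclidean_space) atlas \<Rightarrow> 'a bivector \<Rightarrow> bool" where
  "poisson A \<pi> \<longleftrightarrow> smooth_bivector A \<pi> \<and>
     (\<forall>f g h. smooth_fun_on A UNIV f \<longrightarrow> smooth_fun_on A UNIV g \<longrightarrow> smooth_fun_on A UNIV h \<longrightarrow>
        (\<forall>p. poisson_bracket A \<pi> f (poisson_bracket A \<pi> g h) p +
             poisson_bracket A \<pi> g (poisson_bracket A \<pi> h f) p +
             poisson_bracket A \<pi> h (poisson_bracket A \<pi> f g) p = 0))"

definition anchor ::
  "('a::topological_space, 'e::euclidean_space) atlas \<Rightarrow> 'a bivector \<Rightarrow> 'a \<Rightarrow> 'a alt \<Rightarrow> 'a tvec" where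
  "anchor A \<pi> p a =
     (THE v. v \<in> tangent_space A p \<and> (\<forall>b\<in>cotangent_space A p. b [v] = \<pi> p a b))"

definition anchor_field ::
  "('a::topological_space, 'e::euclidean_space) atlas \<Rightarrow> 'a bivector \<Rightarrow> 'a form \<Rightarrow> 'a \<Rightarrow> 'a tvec" where
  "anchor_field A \<pi> \<alpha> = (\<lambda>p. anchor A \<pi> p (\<alpha> p))"

text \<open>Image and kernel of the anchor at a point; the former is the tangent space of the
  symplectic leaf.\<close>

definition TS ::
  "('a::topological_space, 'e::euclidean_space) atlas \<Rightarrow> 'a bivector \<Rightarrow> 'a \<Rightarrow> 'a tvec set" where
  "TS A \<pi> p = anchor A \<pi> p ` cotangent_space A p"

definition anchor_ker ::
  "('a::topological_space, 'e::euclidean_space) atlas \<Rightarrow> 'a bivector \<Rightarrow> 'a \<Rightarrow> 'a alt set" where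
  "anchor_ker A \<pi> p = {a \<in> cotangent_space A p. anchor A \<pi> p a = 0}"

definition poisson_rank ::
  "('a::topological_space, 'e::euclidean_space) atlas \<Rightarrow> 'a bivector \<Rightarrow> 'a \<Rightarrow> nat" where
  "poisson_rank A \<pi> p = dim (TS A \<pi> p)"

definition regular_set ::
  "('a::topological_space, 'e::euclidean_space) atlas \<Rightarrow> 'a bivector \<Rightarrow> 'a set" where
  "regular_set A \<pi> = {p. \<forall>\<^sub>F q in nhds p. poisson_rank A \<pi> q = poisson_rank A \<pi> p}"

definition koszul_bracket ::
  "('a::topological_space, 'e::euclidean_space) atlas \<Rightarrow> 'a bivector \<Rightarrow> 'a form \<Rightarrow> 'a form \<Rightarrow> 'a form" where
  "koszul_bracket A \<pi> \<alpha> \<beta> =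
     lie_deriv A (anchor_field A \<pi> \<alpha>) \<beta> - lie_deriv A (anchor_field A \<pi> \<beta>) \<alpha>
     - diff_fun A (\<lambda>p. \<pi> p (\<alpha> p) (\<beta> p))"


section \<open>Contravariant connections\<close>

type_synonym 'a form_op = "'a form \<Rightarrow> 'a form \<Rightarrow> 'a form"

definition contravariant_connection ::
  "('a::topological_space, 'e::euclidean_space) atlas \<Rightarrow> 'a bivector \<Rightarrow> 'a form_op \<Rightarrow> bool" where
  "contravariant_connection A \<pi> D \<longleftrightarrow>
     (\<forall>\<alpha>\<in>Omega A 1. \<forall>\<beta>\<in>Omega A 1. D \<alpha> \<beta> \<in> Omega A 1) \<and>
     (\<forall>\<alpha>\<in>Omega A 1. \<forall>\<alpha>'\<in>Omega A 1. \<forall>\<beta>\<in>Omega A 1. \<forall>c.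
        D (c *\<^sub>R \<alpha> + \<alpha>') \<beta> = c *\<^sub>R D \<alpha> \<beta> + D \<alpha>' \<beta> \<and>
        D \<beta> (c *\<^sub>R \<alpha> + \<alpha>') = c *\<^sub>R D \<beta> \<alpha> + D \<beta> \<alpha>') \<and>
     (\<forall>\<alpha>\<in>Omega A 1. \<forall>\<beta>\<in>Omega A 1. \<forall>f. smooth_fun_on A UNIV f \<longrightarrow>
        D (fmul f \<alpha>) \<beta> = fmul f (D \<alpha> \<beta>) \<and>
        D \<alpha> (fmul f \<beta>) = fmul f (D \<alpha> \<beta>) + fmul (\<lambda>p. anchor A \<pi> p (\<alpha> p) f) \<beta>)"

definition torsion_free ::
  "('a::topological_space, 'e::euclidean_space) atlas \<Rightarrow> 'a bivector \<Rightarrow> 'a form_op \<Rightarrow> bool" where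
  "torsion_free A \<pi> D \<longleftrightarrow>
     (\<forall>\<alpha>\<in>Omega A 1. \<forall>\<beta>\<in>Omega A 1. D \<alpha> \<beta> - D \<beta> \<alpha> = koszul_bracket A \<pi> \<alpha> \<beta>)"

definition flat ::
  "('a::topological_space, 'e::euclidean_space) atlas \<Rightarrow> 'a bivector \<Rightarrow> 'a form_op \<Rightarrow> bool" where
  "flat A \<pi> D \<longleftrightarrow>
     (\<forall>\<alpha>\<in>Omega A 1. \<forall>\<beta>\<in>Omega A 1. \<forall>\<gamma>\<in>Omega A 1.
        D \<alpha> (D \<beta> \<gamma>) - D \<beta> (D \<alpha> \<gamma>) - D (koszul_bracket A \<pi> \<alpha> \<beta>) \<gamma> = 0)"

text \<open>For a covector \<open>a\<close> at \<open>p\<close>, \<open>D\<^sub>a \<beta>\<close> is \<open>(D\<^sub>\<alpha> \<beta>)(p)\<close> for any 1-form \<open>\<alpha>\<close> with value \<open>a\<close>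
  at \<open>p\<close>.\<close>

definition F_reg_connection ::
  "('a::topological_space, 'e::euclidean_space) atlas \<Rightarrow> 'a bivector \<Rightarrow> 'a form_op \<Rightarrow> bool" where
  "F_reg_connection A \<pi> D \<longleftrightarrow>
     (\<forall>p\<in>regular_set A \<pi>. \<forall>\<alpha>\<in>Omega A 1. anchor A \<pi> p (\<alpha> p) = 0 \<longrightarrow>
        (\<forall>\<beta>\<in>Omega A 1. D \<alpha> \<beta> p = 0))"

text \<open>A connection is local, hence acts on forms defined near a point: replace them by global
  forms with the same germs.\<close>

definition global_ext ::
  "('a::topological_space, 'e::euclidean_space) atlas \<Rightarrow> 'a \<Rightarrow> 'a form \<Rightarrow> 'a form" where
  "global_ext A p \<alpha> = (SOME \<alpha>'. \<alpha>' \<in> Omega A 1 \<and> (\<forall>\<^sub>F q in nhds p. \<alpha>' q = \<alpha> q))"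

definition local_conn ::
  "('a::topological_space, 'e::euclidean_space) atlas \<Rightarrow> 'a form_op \<Rightarrow> 'a form_op" where
  "local_conn A D \<alpha> \<beta> = (\<lambda>p. D (global_ext A p \<alpha>) (global_ext A p \<beta>) p)"

definition parallel_on ::
  "('a::topological_space, 'e::euclidean_space) atlas \<Rightarrow> 'a form_op \<Rightarrow> 'a set \<Rightarrow> 'a form \<Rightarrow> bool" where
  "parallel_on A D V \<beta> \<longleftrightarrow> smooth_form_on A V 1 \<beta> \<and>
     (\<forall>\<alpha>. smooth_form_on A V 1 \<alpha> \<longrightarrow> (\<forall>q\<in>V. local_conn A D \<alpha> \<beta> q = 0))"


section \<open>Complements of the kernel of the anchor, flat coordinates\<close>

definition frame_of :: "nat \<Rightarrow> (nat \<Rightarrow> 'v::real_vector) \<Rightarrow> 'v set \<Rightarrow> bool" where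
  "frame_of n s V \<longleftrightarrow> inj_on s {1..n} \<and> independent (s ` {1..n}) \<and> span (s ` {1..n}) = V"

definition smooth_subbundle ::
  "('a::topological_space, 'e::euclidean_space) atlas \<Rightarrow> 'a set \<Rightarrow> ('a \<Rightarrow> 'a alt set) \<Rightarrow> bool" where
  "smooth_subbundle A W H \<longleftrightarrow>
     (\<forall>p\<in>W. subspace (H p) \<and> H p \<subseteq> cotangent_space A p) \<and>
     (\<forall>p\<in>W. \<exists>V n s. open V \<and> p \<in> V \<and> V \<subseteq> W \<and>
        (\<forall>i\<in>{1..n}. smooth_form_on A V 1 (s i)) \<and>
        (\<forall>q\<in>V. frame_of n (\<lambda>i. s i q) (H q)))"

definition bundle_section_on ::
  "('a::topological_space, 'e::euclidean_space) atlas \<Rightarrow> 'a set \<Rightarrow> ('a \<Rightarrow> 'a alt set) \<Rightarrow> 'a form \<Rightarrow> bool" where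
  "bundle_section_on A W H \<beta> \<longleftrightarrow> smooth_form_on A W 1 \<beta> \<and> (\<forall>q\<in>W. \<beta> q \<in> H q)"

definition invariant_complement ::
  "('a::topological_space, 'e::euclidean_space) atlas \<Rightarrow> 'a bivector \<Rightarrow> 'a form_op \<Rightarrow>
   'a set \<Rightarrow> ('a \<Rightarrow> 'a alt set) \<Rightarrow> bool" where
  "invariant_complement A \<pi> D W H \<longleftrightarrow>
     smooth_subbundle A W H \<and>
     (\<forall>q\<in>W. anchor_ker A \<pi> q \<inter> H q = {0} \<and>
             {a + b | a b. a \<in> anchor_ker A \<pi> q \<and> b \<in> H q} = cotangent_space A q) \<and>
     (\<forall>\<alpha> \<beta>. smooth_form_on A W 1 \<alpha> \<longrightarrow> bundle_section_on A W H \<beta> \<longrightarrow>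
        bundle_section_on A W H (local_conn A D \<alpha> \<beta>))"

definition varpi ::
  "('a::topological_space, 'e::euclidean_space) atlas \<Rightarrow> 'a bivector \<Rightarrow> ('a \<Rightarrow> 'a alt set) \<Rightarrow>
   'a \<Rightarrow> 'a tvec \<Rightarrow> 'a alt" where
  "varpi A \<pi> H p = inv_into (H p) (anchor A \<pi> p)"

text \<open>Coordinates are the components of a chart \<open>c\<close> with respect to an enumeration \<open>b\<close> of the
  standard basis of the model space by \<open>1, \<dots>, d\<close>. Relative to a number \<open>r\<close>, the first \<open>2 r\<close>
  components are the leafwise coordinates \<open>x\<^sub>i\<close>, and component \<open>2 r + u\<close> is the transverse
  coordinate \<open>y\<^sub>u\<close>.\<close>

definition coord :: "('a, 'e::euclidean_space) chart \<Rightarrow> (nat \<Rightarrow> 'e) \<Rightarrow> nat \<Rightarrow> 'a \<Rightarrow> real" where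
  "coord c b k = (\<lambda>q. snd c q \<bullet> b k)"

abbreviation coord_d ::
  "('a::topological_space, 'e::euclidean_space) atlas \<Rightarrow> ('a, 'e) chart \<Rightarrow> (nat \<Rightarrow> 'e) \<Rightarrow> nat \<Rightarrow> 'a form" where
  "coord_d A c b k \<equiv> diff_fun A (coord c b k)"

abbreviation coord_vec ::
  "('a::topological_space, 'e::euclidean_space) atlas \<Rightarrow> ('a, 'e) chart \<Rightarrow> (nat \<Rightarrow> 'e) \<Rightarrow> nat \<Rightarrow>
   'a \<Rightarrow> 'a tvec" where
  "coord_vec A c b k \<equiv> chart_vec A c (b k)"

definition partial_deriv ::
  "('a::topological_space, 'e::euclidean_space) atlas \<Rightarrow> ('a, 'e) chart \<Rightarrow> (nat \<Rightarrow> 'e) \<Rightarrow> nat \<Rightarrow>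
   ('a \<Rightarrow> real) \<Rightarrow> 'a \<Rightarrow> real" where
  "partial_deriv A c b k f = (\<lambda>q. coord_vec A c b k q f)"

definition foliated_coords ::
  "('a::topological_space, 'e::euclidean_space) atlas \<Rightarrow> 'a bivector \<Rightarrow> nat \<Rightarrow>
   ('a, 'e) chart \<Rightarrow> (nat \<Rightarrow> 'e) \<Rightarrow> bool" where
  "foliated_coords A \<pi> r c b \<longleftrightarrow>
     smooth_chart A c \<and> bij_betw b {1..DIM('e)} Basis \<and> 2 * r \<le> DIM('e) \<and>
     (\<forall>q\<in>fst c. TS A \<pi> q = span ((\<lambda>i. coord_vec A c b i q) ` {1..2 * r}) \<and>
        anchor_ker A \<pi> q = span ((\<lambda>u. coord_d A c b (2 * r + u) q) ` {1..DIM('e) - 2 * r}))"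

definition phi_form ::
  "('a::topological_space, 'e::euclidean_space) atlas \<Rightarrow> 'a bivector \<Rightarrow> ('a \<Rightarrow> 'a alt set) \<Rightarrow>
   ('a, 'e) chart \<Rightarrow> (nat \<Rightarrow> 'e) \<Rightarrow> nat \<Rightarrow> 'a form" where
  "phi_form A \<pi> H c b i = (\<lambda>q. varpi A \<pi> H q (coord_vec A c b i q))"

definition flat_coords ::
  "('a::topological_space, 'e::euclidean_space) atlas \<Rightarrow> 'a bivector \<Rightarrow> 'a form_op \<Rightarrow> nat \<Rightarrow> 'a \<Rightarrow>
   ('a, 'e) chart \<Rightarrow> (nat \<Rightarrow> 'e) \<Rightarrow> bool" where
  "flat_coords A \<pi> D r x c b \<longleftrightarrow>
     x \<in> fst c \<and> foliated_coords A \<pi> r c b \<and>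
     (\<forall>W H. open W \<longrightarrow> x \<in> W \<longrightarrow> invariant_complement A \<pi> D W H \<longrightarrow>
        (\<exists>V. open V \<and> x \<in> V \<and> V \<subseteq> W \<inter> fst c \<and>
           (\<forall>i\<in>{1..2 * r}. parallel_on A D V (phi_form A \<pi> H c b i)) \<and>
           (\<forall>u\<in>{1..DIM('e) - 2 * r}. parallel_on A D V (coord_d A c b (2 * r + u))) \<and>
           (\<forall>q\<in>V. frame_of DIM('e)
              (\<lambda>k. if k \<le> 2 * r then phi_form A \<pi> H c b k q else coord_d A c b k q)
              (cotangent_space A q))))"

definition inverse_matrix :: "nat \<Rightarrow> (nat \<Rightarrow> nat \<Rightarrow> real) \<Rightarrow> (nat \<Rightarrow> nat \<Rightarrow> real) \<Rightarrow> bool" where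
  "inverse_matrix n P Q \<longleftrightarrow> (\<forall>i\<in>{1..n}. \<forall>j\<in>{1..n}.
     (\<Sum>k=1..n. P i k * Q k j) = (if i = j then 1 else 0) \<and>
     (\<Sum>k=1..n. Q i k * P k j) = (if i = j then 1 else 0))"


section \<open>Hawkins bracket and metacurvature\<close>

text \<open>\<open>E\<close> is the extension of \<open>D\<close> to forms of all degrees: \<open>E\<^sub>\<alpha>\<close> is the derivation of the exterior
  algebra that is \<open>D\<^sub>\<alpha>\<close> on 1-forms and the derivative along the anchor of \<open>\<alpha>\<close> on functions.\<close>

definition extends_to_forms ::
  "('a::topological_space, 'e::euclidean_space) atlas \<Rightarrow> 'a bivector \<Rightarrow> 'a form_op \<Rightarrow> 'a form_op \<Rightarrow> bool" where
  "extends_to_forms A \<pi> D E \<longleftrightarrow> (\<forall>\<alpha>\<in>Omega A 1.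
     (\<forall>k. \<forall>\<sigma>\<in>Omega A k. E \<alpha> \<sigma> \<in> Omega A k) \<and>
     (\<forall>k c. \<forall>\<sigma>\<in>Omega A k. \<forall>\<tau>\<in>Omega A k. E \<alpha> (c *\<^sub>R \<sigma> + \<tau>) = c *\<^sub>R E \<alpha> \<sigma> + E \<alpha> \<tau>) \<and>
     (\<forall>k l. \<forall>\<sigma>\<in>Omega A k. \<forall>\<tau>\<in>Omega A l. E \<alpha> (wedge \<sigma> \<tau>) = wedge (E \<alpha> \<sigma>) \<tau> + wedge \<sigma> (E \<alpha> \<tau>)) \<and>
     (\<forall>f. smooth_fun_on A UNIV f \<longrightarrow> E \<alpha> (fun_form f) = fun_form (\<lambda>p. anchor A \<pi> p (\<alpha> p) f)) \<and>
     (\<forall>\<beta>\<in>Omega A 1. E \<alpha> \<beta> = D \<alpha> \<beta>))"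

definition hawkins_bracket ::
  "('a::topological_space, 'e::euclidean_space) atlas \<Rightarrow> 'a bivector \<Rightarrow> 'a form_op \<Rightarrow> 'a form_op \<Rightarrow> bool" where
  "hawkins_bracket A \<pi> D br \<longleftrightarrow>
     (\<forall>\<sigma>\<in>Omega_all A. \<forall>\<sigma>'\<in>Omega_all A. \<forall>\<tau>\<in>Omega_all A. \<forall>c.
        br (c *\<^sub>R \<sigma> + \<sigma>') \<tau> = c *\<^sub>R br \<sigma> \<tau> + br \<sigma>' \<tau> \<and>
        br \<tau> (c *\<^sub>R \<sigma> + \<sigma>') = c *\<^sub>R br \<tau> \<sigma> + br \<tau> \<sigma>') \<and>
     (\<forall>k l. \<forall>\<sigma>\<in>Omega A k. \<forall>\<tau>\<in>Omega A l.
        br \<sigma> \<tau> \<in> Omega A (k + l) \<and>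
        br \<sigma> \<tau> = - ((- 1) ^ (k * l) *\<^sub>R br \<tau> \<sigma>) \<and>
        ext_d A (br \<sigma> \<tau>) = br (ext_d A \<sigma>) \<tau> + (- 1) ^ k *\<^sub>R br \<sigma> (ext_d A \<tau>)) \<and>
     (\<forall>k l m. \<forall>\<sigma>\<in>Omega A k. \<forall>\<tau>\<in>Omega A l. \<forall>\<rho>\<in>Omega A m.
        br \<sigma> (wedge \<tau> \<rho>) = wedge (br \<sigma> \<tau>) \<rho> + (- 1) ^ (k * l) *\<^sub>R wedge \<tau> (br \<sigma> \<rho>)) \<and>
     (\<forall>f h. smooth_fun_on A UNIV f \<longrightarrow> smooth_fun_on A UNIV h \<longrightarrow>
        br (fun_form f) (fun_form h) = fun_form (\<lambda>p. \<pi> p (diff_fun A f p) (diff_fun A h p))) \<and>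
     (\<exists>E. extends_to_forms A \<pi> D E \<and>
        (\<forall>f k. smooth_fun_on A UNIV f \<longrightarrow>
           (\<forall>\<sigma>\<in>Omega A k. br (fun_form f) \<sigma> = E (diff_fun A f) \<sigma>)))"

text \<open>For a flat, torsion-free connection with Hawkins bracket \<open>br\<close>: \<open>mc\<close> is the metacurvature,
  a smooth tensor field that takes three covectors at a point symmetrically to a 2-form at that
  point.\<close>

definition metacurvature ::
  "('a::topological_space, 'e::euclidean_space) atlas \<Rightarrow> 'a form_op \<Rightarrow>
   ('a \<Rightarrow> 'a alt \<Rightarrow> 'a alt \<Rightarrow> 'a alt \<Rightarrow> 'a alt) \<Rightarrow> bool" where
  "metacurvature A br mc \<longleftrightarrow>
     (\<forall>p. \<forall>a\<in>cotangent_space A p. \<forall>a'\<in>cotangent_space A p.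
          \<forall>b\<in>cotangent_space A p. \<forall>c\<in>cotangent_space A p. \<forall>t.
        mc p (t *\<^sub>R a + a') b c = t *\<^sub>R mc p a b c + mc p a' b c \<and>
        mc p a b c = mc p b a c \<and> mc p a b c = mc p a c b) \<and>
     (\<forall>\<alpha>\<in>Omega A 1. \<forall>\<beta>\<in>Omega A 1. \<forall>\<gamma>\<in>Omega A 1.
        (\<lambda>p. mc p (\<alpha> p) (\<beta> p) (\<gamma> p)) \<in> Omega A 2) \<and>
     (\<forall>f. smooth_fun_on A UNIV f \<longrightarrow> (\<forall>\<alpha>\<in>Omega A 1. \<forall>\<beta>\<in>Omega A 1.
        (\<lambda>p. mc p (diff_fun A f p) (\<alpha> p) (\<beta> p)) =
          br (fun_form f) (br \<alpha> \<beta>) - br (br (fun_form f) \<alpha>) \<beta> - br \<alpha> (br (fun_form f) \<beta>)))"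

end

theory Submission
  imports Defs
begin

text \<open>Everything is local near \<open>x\<close>, and the bracket is local, so all functions are multiplied by a bump
  function that is 1 on a neighbourhood \<open>U\<close> of \<open>x\<close>. There \<open>\<phi>\<^sub>i\<close> and \<open>dy\<^sub>u\<close> are parallel, that is,
  \<open>{f, \<phi>\<^sub>i} = {f, dy\<^sub>u} = 0\<close>. The forms \<open>dx\<^sub>l + \<Sum>\<^sub>u A\<^sub>l\<^sup>u dy\<^sub>u\<close> and \<open>\<Sum>\<^sub>i \<pi>\<^sub>l\<^sub>i \<phi>\<^sub>i\<close> are both
  sections of the complement with the same image under the anchor, hence equal. Differentiating
  this equality, and comparing coefficients in
  \<open>d{x\<^sub>l, x\<^sub>j} = {x\<^sub>l, dx\<^sub>j} - {x\<^sub>j, dx\<^sub>l}\<close>, yields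
  \<open>d\<phi>\<^sub>k = \<Sum>\<^bsub>l<m\<^esub> \<partial>\<^sub>k \<pi>\<^sub>l\<^sub>m \<phi>\<^sub>l \<and> \<phi>\<^sub>m - \<Sum> \<partial>\<^sub>k A\<^sub>l\<^sup>u \<phi>\<^sub>l \<and> dy\<^sub>u - \<Sum>\<^bsub>u<v\<^esub> R\<^sub>u\<^sub>v dy\<^sub>u \<and> dy\<^sub>v\<close>,
  where \<open>R\<^sub>u\<^sub>v\<close> is the function differentiated in the last sum of (b), summed over \<open>l\<close>.
  Applying \<open>d\<close> to \<open>{h, \<phi>\<^sub>k} = 0\<close> gives \<open>{\<phi>\<^sub>k, dh} = - {h, d\<phi>\<^sub>k}\<close>, so \<open>{\<phi>\<^sub>j, \<phi>\<^sub>k} = - D\<^bsub>\<phi>\<^sub>j\<^esub> d\<phi>\<^sub>k\<close> and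
  \<open>M(\<phi>\<^sub>i, \<phi>\<^sub>j, \<phi>\<^sub>k) = - D\<^bsub>\<phi>\<^sub>i\<^esub> D\<^bsub>\<phi>\<^sub>j\<^esub> d\<phi>\<^sub>k\<close>; since the coframe is parallel and \<open>\<phi>\<^sub>i\<close> is mapped to
  \<open>\<partial>/\<partial>x\<^sub>i\<close>, this differentiates only the coefficients. Part (a) holds because
  \<open>{y\<^sub>u, \<cdot>}\<close> and \<open>{dy\<^sub>u, \<cdot>}\<close> annihilate functions, the coframe and all \<open>{h, dx\<^sub>l}\<close>.\<close>

section \<open>Smooth functions on Euclidean space\<close>

text \<open>The bracket and the connection act on global forms, and locality is not among their
  axioms: it is forced by the Leibniz rule and smooth bump functions, whence the cutoff built from
  exp(-1/t) and the use of the Hausdorff property. The cut-off data satisfy their equations on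
  \<open>U\<close> only, so every identity that is differentiated once more has to be proved at all
  points of \<open>U\<close>. Tangent vectors are derivations; Hadamard's lemma gives them finitely
  many components, on which all frame expansions rest, and also the symmetry of second derivatives
  behind d d f = 0. The bracket provides D only along exact forms, and the metacurvature is
  prescribed for an exact first argument. Hence \<phi>_i is expanded in the dx_l and dy_u with
  globally smooth coefficients, and tensoriality does the rest. In d\<phi>_k the coefficients first
  appear as derivatives along different Hamiltonian directions; the Jacobi identity for the x_i and
  its mixed companion align them along a single x_l, and contraction with the inverse matrix then
  produces the derivative along x_k.\<close>

declare Ck_on.simps(2) [simp del]

lemma Ck_on_SucI:
  assumes "\<And>x. x \<in> S \<Longrightarrow> (f has_derivative f' x) (at x)" "\<And>v. Ck_on k S (\<lambda>x. f' x v)"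
  shows "Ck_on (Suc k) S f"
  using assms by (auto simp: Ck_on.simps(2))

lemma Ck_on_SucE:
  assumes "Ck_on (Suc k) S f"
  obtains f' where "\<And>x. x \<in> S \<Longrightarrow> (f has_derivative f' x) (at x)" "\<And>v. Ck_on k S (\<lambda>x. f' x v)"
  using assms by (auto simp: Ck_on.simps(2))

lemma Ck_on_subset: "Ck_on k S f \<Longrightarrow> T \<subseteq> S \<Longrightarrow> Ck_on k T f"
proof (induction k arbitrary: f)
  case 0
  then show ?case by (simp add: continuous_on_subset)
next
  case (Suc k)
  from Suc.prems(1) obtain f' where "\<And>x. x \<in> S \<Longrightarrow> (f has_derivative f' x) (at x)" "\<And>v. Ck_on k S (\<lambda>x. f' x v)"
    using Ck_on_SucE[OF Suc.prems(1)] by blast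
  then show ?case
    by (intro Ck_on_SucI[where f' = f'] Suc.IH Suc.prems(2)) (use Suc.prems(2) in auto)
qed

lemma Ck_on_cong:
  assumes "open S" "\<And>x. x \<in> S \<Longrightarrow> f x = g x" "Ck_on k S f"
  shows "Ck_on k S g"
proof (cases k)
  case 0
  then show ?thesis using assms continuous_on_eq[of S f g] by simp
next
  case (Suc m)
  then obtain f' where f': "\<And>x. x \<in> S \<Longrightarrow> (f has_derivative f' x) (at x)" "\<And>v. Ck_on m S (\<lambda>x. f' x v)"
    using Ck_on_SucE[OF assms(3)[unfolded Suc]] by blast
  have "(g has_derivative f' x) (at x)" if "x \<in> S" for x
    using has_derivative_transform_within_open[OF f'(1)[OF that] assms(1) that assms(2)] .
  then show ?thesis unfolding Suc using f'(2) by (rule Ck_on_SucI)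
qed

lemma Ck_on_Suc_imp: "Ck_on (Suc k) S f \<Longrightarrow> Ck_on k S f"
proof (induction k arbitrary: f)
  case 0
  obtain f' where "\<And>x. x \<in> S \<Longrightarrow> (f has_derivative f' x) (at x)"
      "\<And>v. Ck_on 0 S (\<lambda>x. f' x v)"
    using Ck_on_SucE[OF 0] by blast
  then show ?case
    by (metis Ck_on.simps(1) continuous_at_imp_continuous_on has_derivative_continuous)
next
  case (Suc k)
  obtain f' where f': "\<And>x. x \<in> S \<Longrightarrow> (f has_derivative f' x) (at x)"
      and "\<And>v. Ck_on (Suc k) S (\<lambda>x. f' x v)" using Ck_on_SucE[OF Suc.prems] by blast
  have "Ck_on k S (\<lambda>x. f' x v)" for v by (rule Suc.IH) fact
  with f' show ?case by (rule Ck_on_SucI)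
qed

lemma Ck_on_frechet:
  assumes "Ck_on (Suc k) S f" "open S"
  shows "Ck_on k S (\<lambda>x. frechet_derivative f (at x) v)"
proof -
  obtain f' where f': "\<And>x. x \<in> S \<Longrightarrow> (f has_derivative f' x) (at x)" "\<And>v. Ck_on k S (\<lambda>x. f' x v)"
    using Ck_on_SucE[OF assms(1)] by blast
  have "f' x v = frechet_derivative f (at x) v" if "x \<in> S" for x
    using frechet_derivative_at[OF f'(1)[OF that]] by simp
  from Ck_on_cong[OF assms(2) this f'(2)] show ?thesis .
qed

text \<open>The derivative in \<open>Ck_on\<close> is an existential witness, which may differ from
  set to set. \<open>frechet_derivative\<close> is a canonical choice independent of the set, as the
  gluing in \<open>Ck_on_local\<close> requires.\<close>

lemma Ck_on_Suc_iff_frechet: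
  assumes "open S"
  shows "Ck_on (Suc k) S f \<longleftrightarrow> (\<forall>x\<in>S. f differentiable (at x)) \<and>
           (\<forall>v. Ck_on k S (\<lambda>x. frechet_derivative f (at x) v))"
proof
  assume "Ck_on (Suc k) S f"
  then show "(\<forall>x\<in>S. f differentiable (at x)) \<and> (\<forall>v. Ck_on k S (\<lambda>x. frechet_derivative f (at x) v))"
    using Ck_on_frechet[OF _ assms] Ck_on_SucE unfolding differentiable_def by metis
next
  assume "(\<forall>x\<in>S. f differentiable (at x)) \<and> (\<forall>v. Ck_on k S (\<lambda>x. frechet_derivative f (at x) v))"
  then show "Ck_on (Suc k) S f"
    using frechet_derivative_works by (intro Ck_on_SucI) blast+
qed

lemma Ck_on_local:
  assumes "open S" "\<And>x. x \<in> S \<Longrightarrow> \<exists>T. open T \<and> x \<in> T \<and> Ck_on k T f"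
  shows "Ck_on k S f"
  using assms(2)
proof (induction k arbitrary: f)
  case 0
  have "isCont f x" if "x \<in> S" for x
    using 0[OF that] continuous_on_eq_continuous_at by auto
  then show ?case by (simp add: continuous_at_imp_continuous_on)
next
  case (Suc k)
  have "f differentiable (at x)" if "x \<in> S" for x
    using Suc.prems[OF that] Ck_on_Suc_iff_frechet by blast
  moreover have "Ck_on k S (\<lambda>x. frechet_derivative f (at x) v)" for v
  proof (rule Suc.IH)
    fix x assume "x \<in> S"
    from Suc.prems[OF this] obtain T where "open T" "x \<in> T" "Ck_on (Suc k) T f" by auto
    then show "\<exists>T. open T \<and> x \<in> T \<and> Ck_on k T (\<lambda>x. frechet_derivative f (at x) v)"
      using Ck_on_frechet[of k T f v] by blast
  qed
  ultimately show ?case using Ck_on_Suc_iff_frechet[OF assms(1)] by blast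
qed

lemma Ck_on_const: "Ck_on k S (\<lambda>x. a)"
proof (induction k arbitrary: a)
  case (Suc k)
  show ?case by (rule Ck_on_SucI[where f' = "\<lambda>x v. 0"]) (rule has_derivative_const Suc)+
qed simp

lemma Ck_on_bounded_linear:
  assumes "bounded_linear L" shows "Ck_on k S f \<Longrightarrow> Ck_on k S (\<lambda>x. L (f x))"
proof (induction k arbitrary: f)
  case 0
  then show ?case using bounded_linear.continuous_on[OF assms] by auto
next
  case (Suc k)
  from Suc.prems obtain f' where f': "\<And>x. x \<in> S \<Longrightarrow> (f has_derivative f' x) (at x)"
      "\<And>v. Ck_on k S (\<lambda>x. f' x v)" using Ck_on_SucE[OF Suc.prems] by blast
  show ?case
    by (rule Ck_on_SucI[where f' = "\<lambda>x v. L (f' x v)"])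
      (rule bounded_linear.has_derivative[OF assms f'(1)] Suc.IH f'(2) | assumption)+
qed

lemma Ck_on_id: "Ck_on k S (\<lambda>x. x)"
proof (cases k)
  case (Suc m)
  show ?thesis unfolding Suc
    by (rule Ck_on_SucI[where f' = "\<lambda>x v. v"]) (rule has_derivative_ident Ck_on_const)+
qed (simp add: continuous_on_id)

lemma Ck_on_add: "Ck_on k S f \<Longrightarrow> Ck_on k S g \<Longrightarrow> Ck_on k S (\<lambda>x. f x + g x)"
proof (induction k arbitrary: f g)
  case (Suc k)
  from Suc.prems obtain f' g' where *: "\<And>x. x \<in> S \<Longrightarrow> (f has_derivative f' x) (at x)"
      "\<And>v. Ck_on k S (\<lambda>x. f' x v)"  "\<And>x. x \<in> S \<Longrightarrow> (g has_derivative g' x) (at x)"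
      "\<And>v. Ck_on k S (\<lambda>x. g' x v)"
    using Ck_on_SucE[OF Suc.prems(1)] Ck_on_SucE[OF Suc.prems(2)] by metis
  show ?case
    by (rule Ck_on_SucI[where f' = "\<lambda>x v. f' x v + g' x v"])
      (rule has_derivative_add * Suc.IH | assumption)+
qed (simp add: continuous_on_add)

lemma Ck_on_scaleR: "Ck_on k S f \<Longrightarrow> Ck_on k S g \<Longrightarrow> Ck_on k S (\<lambda>x. f x *\<^sub>R g x)"
proof (induction k arbitrary: f g)
  case (Suc k)
  from Suc.prems obtain f' g' where *: "\<And>x. x \<in> S \<Longrightarrow> (f has_derivative f' x) (at x)"
      "\<And>v. Ck_on k S (\<lambda>x. f' x v)"  "\<And>x. x \<in> S \<Longrightarrow> (g has_derivative g' x) (at x)"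
      "\<And>v. Ck_on k S (\<lambda>x. g' x v)"
    using Ck_on_SucE[OF Suc.prems(1)] Ck_on_SucE[OF Suc.prems(2)] by metis
  show ?case
    by (rule Ck_on_SucI[where f' = "\<lambda>x v. f x *\<^sub>R g' x v + f' x v *\<^sub>R g x"])
      (rule has_derivative_scaleR Ck_on_add * Suc.IH Suc.prems[THEN Ck_on_Suc_imp] | assumption)+
qed (simp add: continuous_on_scaleR)

lemma Ck_on_mult: "Ck_on k S f \<Longrightarrow> Ck_on k S g \<Longrightarrow> Ck_on k S (\<lambda>x. f x * g x :: real)"
  using Ck_on_scaleR[of k S f g] by simp

lemma Ck_on_sum:
  "(\<And>i. i \<in> I \<Longrightarrow> Ck_on k S (f i)) \<Longrightarrow> Ck_on k S (\<lambda>x. \<Sum>i\<in>I. f i x)"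
  by (induction I rule: infinite_finite_induct) (auto intro: Ck_on_const Ck_on_add)

lemma Ck_on_diff:
  assumes "Ck_on k S f" "Ck_on k S g" shows "Ck_on k S (\<lambda>x. f x - g x)"
  using Ck_on_add[OF assms(1) Ck_on_bounded_linear[OF bounded_linear_minus[OF bounded_linear_ident] assms(2)]]
  by simp

text \<open>By the chain rule the derivative is \<open>h' (g x) (g' x v)\<close>, whose inner
  direction varies with \<open>x\<close>, whereas \<open>Ck_on\<close> controls \<open>h'\<close> in
  fixed directions only. Expanding \<open>g' x v\<close> in the basis turns it into a sum of
  products of functions of class \<open>k\<close>.\<close>

lemma Ck_on_compose:
  fixes g :: "'e::euclidean_space \<Rightarrow> 'g::euclidean_space"
  shows "Ck_on k T h \<Longrightarrow> Ck_on k S g \<Longrightarrow> g ` S \<subseteq> T \<Longrightarrow> Ck_on k S (\<lambda>x. h (g x))"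
proof (induction k arbitrary: h)
  case 0
  then show ?case using continuous_on_compose2[of T h S g] by simp
next
  case (Suc k)
  from Suc.prems obtain h' g' where *: "\<And>x. x \<in> T \<Longrightarrow> (h has_derivative h' x) (at x)"
      "\<And>v. Ck_on k T (\<lambda>x. h' x v)"  "\<And>x. x \<in> S \<Longrightarrow> (g has_derivative g' x) (at x)"
      "\<And>v. Ck_on k S (\<lambda>x. g' x v)"
    using Ck_on_SucE[OF Suc.prems(1)] Ck_on_SucE[OF Suc.prems(2)] by metis
  have g: "Ck_on k S g" using Suc.prems Ck_on_Suc_imp by blast
  show ?case
  proof (rule Ck_on_SucI[where f' = "\<lambda>x v. \<Sum>e\<in>Basis. (g' x v \<bullet> e) *\<^sub>R h' (g x) e"])
    fix x assume x: "x \<in> S"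
    with Suc.prems(3) have "g x \<in> T" by auto
    have lin: "linear (h' (g x))" using *(1)[OF \<open>g x \<in> T\<close>] has_derivative_linear by blast
    have "h' (g x) (g' x v) = (\<Sum>e\<in>Basis. (g' x v \<bullet> e) *\<^sub>R h' (g x) e)" for v
      using arg_cong[OF euclidean_representation[of "g' x v"], of "h' (g x)"]
      by (simp add: linear_sum[OF lin] linear_cmul[OF lin] del: euclidean_representation)
    then show "((\<lambda>x. h (g x)) has_derivative (\<lambda>v. \<Sum>e\<in>Basis. (g' x v \<bullet> e) *\<^sub>R h' (g x) e)) (at x)"
      using has_derivative_compose[OF *(3)[OF x] *(1)[OF \<open>g x \<in> T\<close>]] by simp
  next
    fix v
    show "Ck_on k S (\<lambda>x. \<Sum>e\<in>Basis. (g' x v \<bullet> e) *\<^sub>R h' (g x) e)"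
    proof (rule Ck_on_sum, rule Ck_on_scaleR)
      fix e :: 'g
      show "Ck_on k S (\<lambda>x. g' x v \<bullet> e)"
        by (rule Ck_on_bounded_linear[OF bounded_linear_inner_left *(4)])
      show "Ck_on k S (\<lambda>x. h' (g x) e)"
        by (rule Suc.IH[OF *(2) g Suc.prems(3)])
    qed
  qed
qed

lemma Ck_on_inverse: "0 \<notin> S \<Longrightarrow> Ck_on k S (inverse :: real \<Rightarrow> real)"
proof (induction k)
  case (Suc k)
  show ?case
  proof (rule Ck_on_SucI[where f' = "\<lambda>x v. - (inverse x * v * inverse x)"])
    fix x assume "x \<in> S"
    with Suc.prems show "(inverse has_derivative (\<lambda>v. - (inverse x * v * inverse x))) (at x)"
      by (intro has_derivative_inverse') auto
  next
    fix v
    have "Ck_on k S (\<lambda>x. (- v) * (inverse x * inverse x))"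
      by (intro Ck_on_mult Ck_on_const Suc)
    then show "Ck_on k S (\<lambda>x. - (inverse x * v * inverse x))" by (simp add: algebra_simps)
  qed
qed (auto intro!: continuous_intros)


section \<open>A smooth cutoff function on the real line\<close>

definition flat_exp :: "nat \<Rightarrow> real \<Rightarrow> real" where
  "flat_exp n t = (if t > 0 then inverse t ^ n * exp (- inverse t) else 0)"

lemma power_le_fact_mult_exp:
  fixes s :: real assumes "0 \<le> s" shows "s ^ m \<le> fact m * exp s"
proof -
  have "s ^ m /\<^sub>R fact m \<le> exp s"
    using sum_le_suminf[OF sums_summable[OF exp_converges[of s]], of "{m}"]
      sums_unique[OF exp_converges[of s]] assms by simp
  then show ?thesis by (simp add: field_simps)
qed

text \<open>Bounding the power \<open>n + 2\<close> of \<open>inverse t\<close> by the exponential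
  leaves two spare powers of \<open>t\<close>: at 0 one absorbs the division in the difference
  quotient, the other makes the quotient tend to 0.\<close>

lemma flat_exp_le: "\<bar>flat_exp n t\<bar> \<le> fact (n + 2) * t\<^sup>2"
proof (cases "t > 0")
  case True
  have "inverse t ^ (n + 2) * exp (- inverse t) \<le> fact (n + 2) * exp (inverse t) * exp (- inverse t)"
    by (rule mult_right_mono[OF power_le_fact_mult_exp]) (use True in auto)
  also have "\<dots> = fact (n + 2)"
    by (simp add: exp_minus field_simps del: fact_Suc add_2_eq_Suc')
  finally have "t\<^sup>2 * (inverse t ^ (n + 2) * exp (- inverse t)) \<le> t\<^sup>2 * fact (n + 2)"
    by (rule mult_left_mono) simp
  moreover have "t\<^sup>2 * (inverse t ^ (n + 2) * exp (- inverse t)) = flat_exp n t"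
    using True by (simp add: flat_exp_def power_add field_simps power2_eq_square)
  moreover have "0 \<le> flat_exp n t" using True by (simp add: flat_exp_def)
  ultimately show ?thesis by (simp add: mult.commute)
qed (simp add: flat_exp_def)

text \<open>The functions t^(-n) exp(-1/t), extended by zero, are closed under differentiation up to
  linear combinations, so smoothness of all of them is one induction with \<open>n\<close>
  arbitrary.\<close>

lemma flat_exp_has_derivative:
  "(flat_exp n has_real_derivative flat_exp (n + 2) t - n * flat_exp (n + 1) t) (at t)"
proof (cases t "0 :: real" rule: linorder_cases)
  case less
  have "((\<lambda>_. 0) has_real_derivative 0) (at t)" by simp
  then have "(flat_exp n has_real_derivative 0) (at t)"
    by (rule has_field_derivative_transform_within_open[where S = "{..<0}"])
      (use less in \<open>auto simp: flat_exp_def\<close>)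
  then show ?thesis using less by (simp add: flat_exp_def)
next
  case greater
  have inv: "(inverse has_real_derivative - ((inverse t)\<^sup>2)) (at t)"
    using DERIV_inverse[of t] greater by (simp add: numeral_2_eq_2)
  have "((\<lambda>t. inverse t ^ n * exp (- inverse t)) has_real_derivative
      flat_exp (n + 2) t - n * flat_exp (n + 1) t) (at t)"
    by (rule DERIV_cong[OF DERIV_mult[OF DERIV_power[OF inv] DERIV_fun_exp[OF DERIV_minus[OF inv]]]])
      (use greater in \<open>cases n; simp add: flat_exp_def algebra_simps power2_eq_square\<close>)
  then show ?thesis
    by (rule has_field_derivative_transform_within_open[where S = "{0<..}"])
      (use greater in \<open>auto simp: flat_exp_def\<close>)
next
  case equal
  have "(\<lambda>h. (flat_exp n (0 + h) - flat_exp n 0) / h) \<midarrow>0\<rightarrow> 0"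
  proof (rule Lim_null_comparison)
    show "\<forall>\<^sub>F h in at 0. norm ((flat_exp n (0 + h) - flat_exp n 0) / h) \<le> fact (n + 2) * \<bar>h\<bar>"
    proof (rule always_eventually, rule allI)
      fix h :: real
      show "norm ((flat_exp n (0 + h) - flat_exp n 0) / h) \<le> fact (n + 2) * \<bar>h\<bar>"
        using divide_right_mono[OF flat_exp_le[of n h], of "\<bar>h\<bar>"]
        by (simp add: flat_exp_def[of n 0] power2_eq_square abs_divide abs_mult_self_eq[symmetric, of h]
            del: fact_Suc add_2_eq_Suc' abs_mult_self_eq split: if_splits)
    qed
    have "((\<lambda>h::real. fact (n + 2) * \<bar>h\<bar>) \<longlongrightarrow> fact (n + 2) * \<bar>0\<bar>) (at 0)"
      by (intro tendsto_intros)
    then show "((\<lambda>h::real. fact (n + 2) * \<bar>h\<bar>) \<longlongrightarrow> 0) (at 0)" by simp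
  qed
  then show ?thesis unfolding DERIV_def equal by (simp add: flat_exp_def)
qed

lemma Ck_on_flat_exp: "Ck_on k S (flat_exp n)"
proof (induction k arbitrary: n)
  case 0
  show ?case
    by (simp add: continuous_at_imp_continuous_on DERIV_isCont[OF flat_exp_has_derivative])
next
  case (Suc k)
  show ?case
  proof (rule Ck_on_SucI[where f' = "\<lambda>t v. (flat_exp (n + 2) t - n * flat_exp (n + 1) t) * v"])
    show "(flat_exp n has_derivative (*) (flat_exp (n + 2) t - n * flat_exp (n + 1) t)) (at t)" for t
      using flat_exp_has_derivative[of n t] by (simp add: has_field_derivative_def)
    show "Ck_on k S (\<lambda>t. (flat_exp (n + 2) t - n * flat_exp (n + 1) t) * v)" for v
      by (intro Ck_on_mult Ck_on_diff Ck_on_const Suc)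
  qed
qed

text \<open>For every \<open>s\<close> one of \<open>2 - s\<close> and \<open>s - 1\<close> is
  positive, so the denominator never vanishes. The transition from 1 to 0 takes place between 1 and
  2.\<close>

definition cutoff :: "real \<Rightarrow> real" where
  "cutoff s = flat_exp 0 (2 - s) * inverse (flat_exp 0 (2 - s) + flat_exp 0 (s - 1))"

lemma cutoff_eq_1: "s \<le> 1 \<Longrightarrow> cutoff s = 1"
  by (simp add: cutoff_def flat_exp_def)

lemma cutoff_eq_0: "s \<ge> 2 \<Longrightarrow> cutoff s = 0"
  by (simp add: cutoff_def flat_exp_def)

lemma Ck_on_cutoff: "Ck_on k UNIV cutoff"
proof -
  let ?g = "\<lambda>s. flat_exp 0 (2 - s) + flat_exp 0 (s - 1)"
  have pos: "?g s > 0" for s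
    by (cases "s < 2"; cases "s > 1") (auto simp: flat_exp_def add_pos_pos)
  have 1: "Ck_on k UNIV (\<lambda>s. flat_exp 0 (2 - s))" "Ck_on k UNIV (\<lambda>s. flat_exp 0 (s - 1))"
    by (rule Ck_on_compose[OF Ck_on_flat_exp _ subset_UNIV], intro Ck_on_diff Ck_on_const Ck_on_id)+
  have "Ck_on k UNIV (\<lambda>s. inverse (?g s))"
    by (rule Ck_on_compose[OF Ck_on_inverse[of "{0<..}"] Ck_on_add[OF 1]]) (use pos in auto)
  from Ck_on_mult[OF 1(1) this] show ?thesis
    by (rule Ck_on_cong[rotated 2]) (auto simp: cutoff_def)
qed

section \<open>Hadamard's lemma and symmetry of second derivatives\<close>

lemma Ck_on_integral_segment:
  fixes h :: "'e::euclidean_space \<Rightarrow> real"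
  assumes "open B" "convex B" "z0 \<in> B"
  shows "Ck_on k B h \<Longrightarrow> Ck_on k B (\<lambda>z. integral (cbox 0 1) (\<lambda>t. t ^ m * h (z0 + t *\<^sub>R (z - z0))))"
\<comment> \<open>Each differentiation under the integral sign produces one more factor
  \<open>t\<close>, so the exponent \<open>m\<close> has to be arbitrary.\<close>
proof (induction k arbitrary: h m)
  have seg: "z0 + t *\<^sub>R (z - z0) \<in> B" if "z \<in> B" "t \<in> cbox 0 1" for z and t :: real
    using convexD_alt[OF assms(2,3) that(1), of t] that(2) by (simp add: algebra_simps)
  have cont: "continuous_on (B \<times> cbox 0 1) (\<lambda>(z, t). t ^ m * g (z0 + t *\<^sub>R (z - z0)))"
    if "continuous_on B g" for g :: "'e \<Rightarrow> real" and m
    unfolding split_beta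
    by (intro continuous_intros continuous_on_compose2[OF that]) (auto intro!: seg[simplified])
  {
    case 0
    then show ?case
      using integral_continuous_on_param[OF cont[of h m]] by simp
  next
    case (Suc k)
    from Suc.prems obtain h' where h': "\<And>x. x \<in> B \<Longrightarrow> (h has_derivative h' x) (at x)"
        "\<And>v. Ck_on k B (\<lambda>x. h' x v)" using Ck_on_SucE[OF Suc.prems] by blast
    have h'_cont: "continuous_on B (\<lambda>x. h' x v)" for v
      using h'(2) by (induction k) (auto dest: Ck_on_Suc_imp)
    \<comment> \<open>The Leibniz rule for parameter integrals asks for the derivative as a bounded
      linear map that is jointly continuous in both variables; the continuity is then checked on
      basis vectors.\<close>
    define fx where "fx z t = Blinfun (\<lambda>v. t ^ Suc m * h' (z0 + t *\<^sub>R (z - z0)) v)" for z and t :: real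
    have fx: "blinfun_apply (fx z t) = (\<lambda>v. t ^ Suc m * h' (z0 + t *\<^sub>R (z - z0)) v)"
      if "z \<in> B" "t \<in> cbox 0 1" for z t
      unfolding fx_def
      by (intro bounded_linear_Blinfun_apply bounded_linear_const_mult has_derivative_bounded_linear[OF h'(1)[OF seg[OF that]]])
    have h_cont: "continuous_on B h"
      using h'(1) by (meson continuous_at_imp_continuous_on has_derivative_continuous)
    have fx_cont: "continuous_on (B \<times> cbox 0 1) (\<lambda>(z, t). fx z t)"
      unfolding split_beta
    proof (rule continuous_on_blinfun_componentwise)
      fix i :: 'e
      show "continuous_on (B \<times> cbox 0 1) (\<lambda>x. blinfun_apply (fx (fst x) (snd x)) i)"
        by (rule continuous_on_eq[OF cont[OF h'_cont, of "Suc m" i]]) (auto simp: fx)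
    qed
    have int: "(\<lambda>t. t ^ m * g (z0 + t *\<^sub>R (z - z0))) integrable_on cbox 0 1"
      if "continuous_on B g" "z \<in> B" for g :: "'e \<Rightarrow> real" and z m
      by (intro integrable_continuous continuous_intros continuous_on_compose2[OF that(1)])
        (auto intro!: seg[simplified] that)
    have der: "((\<lambda>z. integral (cbox 0 1) (\<lambda>t. t ^ m * h (z0 + t *\<^sub>R (z - z0)))) has_derivative
        (\<lambda>v. integral (cbox 0 1) (\<lambda>t. t ^ Suc m * h' (z0 + t *\<^sub>R (z - z0)) v))) (at z)"
      if z: "z \<in> B" for z
    proof -
      have "((\<lambda>z. integral (cbox 0 1) (\<lambda>t. t ^ m * h (z0 + t *\<^sub>R (z - z0)))) has_derivative
        blinfun_apply (integral (cbox 0 1) (fx z))) (at z within B)"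
      proof (rule leibniz_rule[OF _ int[OF h_cont] fx_cont z assms(2)])
        fix y t assume yt: "y \<in> B" "t \<in> cbox 0 (1 :: real)"
        have "((\<lambda>y. z0 + t *\<^sub>R (y - z0)) has_derivative (\<lambda>v. t *\<^sub>R v)) (at y)"
          by (auto intro!: derivative_eq_intros)
        from has_derivative_compose[OF this h'(1)[OF seg[OF yt]]]
        have "((\<lambda>y. t ^ m * h (z0 + t *\<^sub>R (y - z0))) has_derivative
            (\<lambda>v. t ^ m * h' (z0 + t *\<^sub>R (y - z0)) (t *\<^sub>R v))) (at y)"
          by (rule has_derivative_mult_right)
        moreover have "t ^ m * h' (z0 + t *\<^sub>R (y - z0)) (t *\<^sub>R v) = t ^ Suc m * h' (z0 + t *\<^sub>R (y - z0)) v" for v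
          using linear_cmul[OF has_derivative_linear[OF h'(1)[OF seg[OF yt]]]] by simp
        ultimately show "((\<lambda>y. t ^ m * h (z0 + t *\<^sub>R (y - z0))) has_derivative
            blinfun_apply (fx y t)) (at y within B)"
          by (simp add: fx[OF yt] has_derivative_at_withinI)
      qed
      moreover have "blinfun_apply (integral (cbox 0 1) (fx z)) v =
          integral (cbox 0 1) (\<lambda>t. t ^ Suc m * h' (z0 + t *\<^sub>R (z - z0)) v)" for v
      proof -
        have "fx z integrable_on cbox 0 1"
          by (rule integrable_continuous)
            (rule continuous_on_compose2[OF fx_cont, of _ "Pair z", simplified split_beta fst_conv snd_conv],
              use z in \<open>auto intro: continuous_intros\<close>)
        then have "blinfun_apply (integral (cbox 0 1) (fx z)) v = integral (cbox 0 1) (\<lambda>t. fx z t v)"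
          by (rule blinfun_apply_integral)
        also have "\<dots> = integral (cbox 0 1) (\<lambda>t. t ^ Suc m * h' (z0 + t *\<^sub>R (z - z0)) v)"
          by (rule integral_cong) (simp add: fx[OF z])
        finally show ?thesis .
      qed
      ultimately have "((\<lambda>z. integral (cbox 0 1) (\<lambda>t. t ^ m * h (z0 + t *\<^sub>R (z - z0)))) has_derivative
         (\<lambda>v. integral (cbox 0 1) (\<lambda>t. t ^ Suc m * h' (z0 + t *\<^sub>R (z - z0)) v))) (at z within B)"
        by (metis (no_types, lifting) ext)
      then show ?thesis using at_within_open[OF z assms(1)] by simp
    qed
    show ?case
      by (rule Ck_on_SucI[OF der]) (use Suc.IH h'(2) in blast)+
  }
qed

lemma Cinf_on_frechet:
  "Cinf_on S f \<Longrightarrow> open S \<Longrightarrow> Cinf_on S (\<lambda>x. frechet_derivative f (at x) v)"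
  using Ck_on_frechet unfolding Cinf_on_def by blast

lemma Cinf_on_has_derivative:
  assumes "Cinf_on S f" "x \<in> S"
  shows "(f has_derivative frechet_derivative f (at x)) (at x)"
proof -
  have "Ck_on (Suc 0) S f" using assms(1) unfolding Cinf_on_def by blast
  then obtain f' where "\<And>x. x \<in> S \<Longrightarrow> (f has_derivative f' x) (at x)" "\<And>v. Ck_on 0 S (\<lambda>x. f' x v)"
    by (rule Ck_on_SucE) blast
  from this(1)[OF assms(2)] have "(f has_derivative f' x) (at x)" .
  then show ?thesis using frechet_derivative_at by metis
qed

lemma Cinf_on_imp_continuous_on: "Cinf_on S f \<Longrightarrow> continuous_on S f"
  unfolding Cinf_on_def by (metis Ck_on.simps(1))

text \<open>The fundamental theorem of calculus along the segment from \<open>z0\<close> to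
  \<open>z\<close>: \<open>G e\<close> is the mean of the partial derivative in direction
  \<open>e\<close> over this segment, hence smooth by \<open>Ck_on_integral_segment\<close> with
  exponent 0.\<close>

lemma hadamard:
  fixes F :: "'e::euclidean_space \<Rightarrow> real"
  assumes "open B" "convex B" "z0 \<in> B" "Cinf_on B F"
  obtains G where "\<And>e. Cinf_on B (G e)"
    "\<And>z. z \<in> B \<Longrightarrow> F z = F z0 + (\<Sum>e\<in>Basis. ((z - z0) \<bullet> e) * G e z)"
proof
  define G where "G e z = integral (cbox 0 1) (\<lambda>t. t ^ 0 * frechet_derivative F (at (z0 + t *\<^sub>R (z - z0))) e)" for e z
  note smooth = Cinf_on_frechet[OF assms(4,1)]
  show "Cinf_on B (G e)" for e
    using Ck_on_integral_segment[OF assms(1,2,3)] smooth[of e]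
    unfolding Cinf_on_def G_def by blast
  fix z assume z: "z \<in> B"
  have seg: "z0 + t *\<^sub>R (z - z0) \<in> B" if "t \<in> {0..1}" for t :: real
    using convexD_alt[OF assms(2,3) z, of t] that by (simp add: algebra_simps)
  let ?D = "\<lambda>t. frechet_derivative F (at (z0 + t *\<^sub>R (z - z0)))"
  have D: "?D t (z - z0) = (\<Sum>e\<in>Basis. ((z - z0) \<bullet> e) * ?D t e)" if "t \<in> {0..1}" for t
  proof -
    have "linear (?D t)" using has_derivative_linear[OF Cinf_on_has_derivative[OF assms(4) seg[OF that]]] .
    then show ?thesis
      using arg_cong[OF euclidean_representation[of "z - z0"], of "?D t"]
      by (simp add: linear_sum linear_cmul del: euclidean_representation)
  qed
  have "((\<lambda>t. ?D t (z - z0)) has_integral F (z0 + 1 *\<^sub>R (z - z0)) - F (z0 + 0 *\<^sub>R (z - z0))) {0..1}"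
  proof (rule fundamental_theorem_of_calculus)
    fix t :: real assume t: "t \<in> {0..1}"
    have "((\<lambda>t. z0 + t *\<^sub>R (z - z0)) has_derivative (\<lambda>s. s *\<^sub>R (z - z0))) (at t)"
      by (auto intro!: derivative_eq_intros)
    from has_derivative_compose[OF this Cinf_on_has_derivative[OF assms(4) seg[OF t]]]
    show "((\<lambda>t. F (z0 + t *\<^sub>R (z - z0))) has_vector_derivative ?D t (z - z0)) (at t within {0..1})"
      using linear_cmul[OF has_derivative_linear[OF Cinf_on_has_derivative[OF assms(4) seg[OF t]]]]
      by (simp add: has_vector_derivative_def has_derivative_at_withinI)
  qed simp
  then have "F z - F z0 = integral {0..1} (\<lambda>t. \<Sum>e\<in>Basis. ((z - z0) \<bullet> e) * ?D t e)"
    using integral_unique[of "\<lambda>t. ?D t (z - z0)"] integral_cong[OF D, of "{0..1}" "\<lambda>t. t"] by simp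
  also have "\<dots> = (\<Sum>e\<in>Basis. integral {0..1} (\<lambda>t. ((z - z0) \<bullet> e) * ?D t e))"
  proof (rule integral_sum)
    fix e :: 'e
    have "continuous_on {0..1} (\<lambda>t. ?D t e)"
      by (rule continuous_on_compose2[OF Cinf_on_imp_continuous_on[OF smooth[of e]]])
        (auto intro!: continuous_intros seg[simplified])
    then show "(\<lambda>t. ((z - z0) \<bullet> e) * ?D t e) integrable_on {0..1}"
      by (intro integrable_continuous_real continuous_intros)
  qed simp
  also have "\<dots> = (\<Sum>e\<in>Basis. ((z - z0) \<bullet> e) * G e z)"
    by (simp add: G_def)
  finally show "F z = F z0 + (\<Sum>e\<in>Basis. ((z - z0) \<bullet> e) * G e z)" by simp
qed

lemma Cinf_on_subset: "Cinf_on S f \<Longrightarrow> T \<subseteq> S \<Longrightarrow> Cinf_on T f"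
  unfolding Cinf_on_def using Ck_on_subset by blast

lemma Cinf_on_cong:
  assumes "open S" "\<And>x. x \<in> S \<Longrightarrow> f x = g x" "Cinf_on S f" shows "Cinf_on S g"
  using Ck_on_cong[of S f g, OF assms(1,2)] assms(3) unfolding Cinf_on_def by blast

lemma Cinf_on_local:
  assumes "open S" "\<And>x. x \<in> S \<Longrightarrow> \<exists>T. open T \<and> x \<in> T \<and> Cinf_on T f"
  shows "Cinf_on S f"
  unfolding Cinf_on_def using Ck_on_local[OF assms(1)] assms(2) unfolding Cinf_on_def by metis

lemma Cinf_on_const: "Cinf_on S (\<lambda>x. a)"
  by (simp add: Cinf_on_def Ck_on_const)

lemma Cinf_on_id: "Cinf_on S (\<lambda>x. x)"
  by (simp add: Cinf_on_def Ck_on_id)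

lemma Cinf_on_add: "Cinf_on S f \<Longrightarrow> Cinf_on S g \<Longrightarrow> Cinf_on S (\<lambda>x. f x + g x)"
  by (simp add: Cinf_on_def Ck_on_add)

lemma Cinf_on_diff: "Cinf_on S f \<Longrightarrow> Cinf_on S g \<Longrightarrow> Cinf_on S (\<lambda>x. f x - g x)"
  by (simp add: Cinf_on_def Ck_on_diff)

lemma Cinf_on_mult: "Cinf_on S f \<Longrightarrow> Cinf_on S g \<Longrightarrow> Cinf_on S (\<lambda>x. f x * g x :: real)"
  by (simp add: Cinf_on_def Ck_on_mult)

lemma Cinf_on_sum:
  "(\<And>i. i \<in> I \<Longrightarrow> Cinf_on S (f i)) \<Longrightarrow> Cinf_on S (\<lambda>x. \<Sum>i\<in>I. f i x)"
  by (simp add: Cinf_on_def Ck_on_sum)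

lemma Cinf_on_bounded_linear: "bounded_linear L \<Longrightarrow> Cinf_on S f \<Longrightarrow> Cinf_on S (\<lambda>x. L (f x))"
  by (simp add: Cinf_on_def Ck_on_bounded_linear)

lemma Cinf_on_compose:
  fixes g :: "'e::euclidean_space \<Rightarrow> 'g::euclidean_space"
  shows "Cinf_on T h \<Longrightarrow> Cinf_on S g \<Longrightarrow> g ` S \<subseteq> T \<Longrightarrow> Cinf_on S (\<lambda>x. h (g x))"
  unfolding Cinf_on_def using Ck_on_compose by blast

lemma Cinf_on_cutoff: "Cinf_on UNIV cutoff"
  by (simp add: Cinf_on_def Ck_on_cutoff)

text \<open>In the Hadamard form the linear factors vanish at \<open>z0\<close>, so the second
  derivative there consists only of terms with one derivative on the factor and one on
  \<open>G e\<close>. Their sum is symmetric in the two directions.\<close>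

lemma frechet_derivative_commute:
  fixes F :: "'e::euclidean_space \<Rightarrow> real"
  assumes "open S" "z0 \<in> S" "Cinf_on S F"
  shows "frechet_derivative (\<lambda>z. frechet_derivative F (at z) w') (at z0) w =
         frechet_derivative (\<lambda>z. frechet_derivative F (at z) w) (at z0) w'"
proof -
  obtain \<rho> where \<rho>: "\<rho> > 0" "ball z0 \<rho> \<subseteq> S" using assms(1,2) open_contains_ball by blast
  let ?B = "ball z0 \<rho>"
  have B: "open ?B" "convex ?B" "z0 \<in> ?B" "Cinf_on ?B F"
    using \<rho> Cinf_on_subset[OF assms(3)] by auto
  obtain G where G: "\<And>e. Cinf_on ?B (G e)"
    "\<And>z. z \<in> ?B \<Longrightarrow> F z = F z0 + (\<Sum>e\<in>Basis. ((z - z0) \<bullet> e) * G e z)"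
    using hadamard[OF B] by blast
  let ?D = "\<lambda>e z. frechet_derivative (G e) (at z)"
  have 1: "frechet_derivative F (at z) u = (\<Sum>e\<in>Basis. ((z - z0) \<bullet> e) * ?D e z u + (u \<bullet> e) * G e z)"
    if z: "z \<in> ?B" for z u
  proof -
    have "((\<lambda>z. \<Sum>e\<in>Basis. ((z - z0) \<bullet> e) * G e z) has_derivative
        (\<lambda>u. \<Sum>e\<in>Basis. ((z - z0) \<bullet> e) * ?D e z u + (u \<bullet> e) * G e z)) (at z)"
    proof (rule has_derivative_sum)
      fix e :: 'e
      have "((\<lambda>z. (z - z0) \<bullet> e) has_derivative (\<lambda>u. u \<bullet> e)) (at z)"
        by (auto intro!: derivative_eq_intros)
      from has_derivative_mult[OF this Cinf_on_has_derivative[OF G(1)[of e] z]]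
      show "((\<lambda>z. ((z - z0) \<bullet> e) * G e z) has_derivative
          (\<lambda>u. ((z - z0) \<bullet> e) * ?D e z u + (u \<bullet> e) * G e z)) (at z)" .
    qed
    from has_derivative_add[OF has_derivative_const[of "F z0"] this]
    have "((\<lambda>z. F z0 + (\<Sum>e\<in>Basis. ((z - z0) \<bullet> e) * G e z)) has_derivative
        (\<lambda>u. \<Sum>e\<in>Basis. ((z - z0) \<bullet> e) * ?D e z u + (u \<bullet> e) * G e z)) (at z)"
      by simp
    then have "(F has_derivative
        (\<lambda>u. \<Sum>e\<in>Basis. ((z - z0) \<bullet> e) * ?D e z u + (u \<bullet> e) * G e z)) (at z)"
      by (rule has_derivative_transform_within_open[OF _ B(1) z]) (simp add: G(2)[symmetric])
    from fun_cong[OF frechet_derivative_at[OF this], of u] show ?thesis by (rule sym)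
  qed
  have 2: "frechet_derivative (\<lambda>z. frechet_derivative F (at z) u) (at z0) u' =
      (\<Sum>e\<in>Basis. (u' \<bullet> e) * ?D e z0 u + (u \<bullet> e) * ?D e z0 u')" for u u'
  proof -
    have "((\<lambda>z. \<Sum>e\<in>Basis. ((z - z0) \<bullet> e) * ?D e z u + (u \<bullet> e) * G e z) has_derivative
        (\<lambda>u'. \<Sum>e\<in>Basis. (u' \<bullet> e) * ?D e z0 u + (u \<bullet> e) * ?D e z0 u')) (at z0)"
    proof (rule has_derivative_sum)
      fix e :: 'e
      have "((\<lambda>z. (z - z0) \<bullet> e) has_derivative (\<lambda>u'. u' \<bullet> e)) (at z0)"
        by (auto intro!: derivative_eq_intros)
      from has_derivative_add[OF has_derivative_mult[OF this
          Cinf_on_has_derivative[OF Cinf_on_frechet[OF G(1)[of e] B(1)] B(3)]]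
          has_derivative_mult_right[OF Cinf_on_has_derivative[OF G(1)[of e] B(3)]]]
      show "((\<lambda>z. ((z - z0) \<bullet> e) * ?D e z u + (u \<bullet> e) * G e z) has_derivative
          (\<lambda>u'. (u' \<bullet> e) * ?D e z0 u + (u \<bullet> e) * ?D e z0 u')) (at z0)"
        by simp
    qed
    then have "((\<lambda>z. frechet_derivative F (at z) u) has_derivative
        (\<lambda>u'. \<Sum>e\<in>Basis. (u' \<bullet> e) * ?D e z0 u + (u \<bullet> e) * ?D e z0 u')) (at z0)"
      by (rule has_derivative_transform_within_open[OF _ B(1,3)]) (simp add: 1)
    from fun_cong[OF frechet_derivative_at[OF this], of u'] show ?thesis by (rule sym)
  qed
  show ?thesis unfolding 2 by (simp add: add.commute)
qed

section \<open>Smooth functions and tangent vectors on a manifold\<close>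

abbreviation chart_inv :: "('a, 'e) chart \<Rightarrow> 'e \<Rightarrow> 'a" where
  "chart_inv c \<equiv> inv_into (fst c) (snd c)"

lemma smooth_chart_open:
  assumes "smooth_chart A c" shows "open (fst c)" "open (snd c ` fst c)"
  using assms by (auto simp: smooth_chart_def)

lemma smooth_chart_inv:
  assumes "smooth_chart A c" "p \<in> fst c" shows "chart_inv c (snd c p) = p"
  using assms homeomorphism_apply1 by (fastforce simp: smooth_chart_def)

lemma smooth_chart_inv_right:
  assumes "z \<in> snd c ` fst c" shows "snd c (chart_inv c z) = z" "chart_inv c z \<in> fst c"
  using assms by (auto simp: f_inv_into_f inv_into_into)

lemma smooth_chart_open_image:
  assumes "smooth_chart A c" "open V" shows "open (snd c ` (fst c \<inter> V))"
proof -
  have "homeomorphism (fst c) (snd c ` fst c) (snd c) (chart_inv c)"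
    using assms(1) by (simp add: smooth_chart_def)
  then have "openin (top_of_set (snd c ` fst c)) (snd c ` (fst c \<inter> V))"
    by (rule homeomorphism_imp_open_map) (simp add: openin_open_Int assms(2))
  then show ?thesis
    using openin_open_eq smooth_chart_open(2)[OF assms(1)] by blast
qed

lemma smooth_chart_continuous:
  assumes "smooth_chart A c" shows "continuous_on (fst c) (snd c)"
  using assms by (simp add: smooth_chart_def homeomorphism_def)

lemma smooth_chart_inv_continuous:
  assumes "smooth_chart A c" shows "continuous_on (snd c ` fst c) (chart_inv c)"
  using assms by (simp add: smooth_chart_def homeomorphism_def)

lemma smooth_compatible_sym: "smooth_compatible c c' \<Longrightarrow> smooth_compatible c' c"
  by (simp add: smooth_compatible_def Int_commute)

text \<open>On the overlap the function read in \<open>c'\<close> is the function read in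
  \<open>c\<close> after the coordinate change. This moves smoothness from the atlas to any chart of
  the maximal atlas and back.\<close>

lemma chart_transfer:
  assumes c: "smooth_chart A c" and c': "smooth_chart A c'" and comp: "smooth_compatible c c'"
    and "open V" "Cinf_on (snd c ` (fst c \<inter> V)) (f \<circ> chart_inv c)"
  shows "Cinf_on (snd c' ` (fst c' \<inter> (fst c \<inter> V))) (f \<circ> chart_inv c')"
proof -
  let ?S = "snd c' ` (fst c' \<inter> (fst c \<inter> V))"
  have inv: "chart_inv c' z \<in> fst c' \<inter> (fst c \<inter> V)" if "z \<in> ?S" for z
    using that smooth_chart_inv[OF c'] by auto
  have "Cinf_on ?S (\<lambda>z. (f \<circ> chart_inv c) ((snd c \<circ> chart_inv c') z))"
  proof (rule Cinf_on_compose[OF assms(5)])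
    show "Cinf_on ?S (snd c \<circ> chart_inv c')"
      by (rule Cinf_on_subset[of "snd c' ` (fst c \<inter> fst c')"])
        (use comp in \<open>auto simp: smooth_compatible_def\<close>)
    show "(snd c \<circ> chart_inv c') ` ?S \<subseteq> snd c ` (fst c \<inter> V)"
      using inv by auto
  qed
  then show ?thesis
    by (rule Cinf_on_cong[rotated 2])
      (use inv smooth_chart_inv[OF c] smooth_chart_open_image[OF c'] smooth_chart_open(1)[OF c] \<open>open V\<close>
        in \<open>auto simp: open_Int\<close>)
qed

locale smooth_manifold =
  fixes A :: "('a::t2_space, 'e::euclidean_space) atlas"
  assumes smooth_atlas: "smooth_atlas A"
begin

lemma atlas_chart: "c \<in> A \<Longrightarrow> smooth_chart A c"
  using smooth_atlas by (auto simp: smooth_atlas_def)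

lemma atlas_cover: obtains c where "c \<in> A" "p \<in> fst c" "smooth_chart A c"
proof -
  have "p \<in> (\<Union>c\<in>A. fst c)" using smooth_atlas unfolding smooth_atlas_def by simp
  then show ?thesis using that atlas_chart by blast
qed

lemma chart_compatible: "smooth_chart A c \<Longrightarrow> c' \<in> A \<Longrightarrow> smooth_compatible c c'"
  by (simp add: smooth_chart_def)

lemma smooth_fun_on_subset: "smooth_fun_on A V f \<Longrightarrow> W \<subseteq> V \<Longrightarrow> smooth_fun_on A W f"
  unfolding smooth_fun_on_def by (meson Cinf_on_subset Int_mono image_mono subset_refl)

lemma smooth_fun_on_cong:
  assumes "open V" "smooth_fun_on A V f" "\<And>q. q \<in> V \<Longrightarrow> f q = g q"
  shows "smooth_fun_on A V g"
  unfolding smooth_fun_on_def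
proof
  fix c assume c: "c \<in> A"
  show "Cinf_on (snd c ` (fst c \<inter> V)) (g \<circ> chart_inv c)"
    by (rule Cinf_on_cong[of _ "f \<circ> chart_inv c"])
      (use c assms smooth_chart_open_image[OF atlas_chart[OF c]] smooth_chart_inv[OF atlas_chart[OF c]]
        in \<open>auto simp: smooth_fun_on_def\<close>)
qed

lemma smooth_fun_on_chart:
  assumes c: "smooth_chart A c" and "open V" "smooth_fun_on A V f"
  shows "Cinf_on (snd c ` (fst c \<inter> V)) (f \<circ> chart_inv c)"
proof (rule Cinf_on_local[OF smooth_chart_open_image[OF c \<open>open V\<close>]])
  fix z assume "z \<in> snd c ` (fst c \<inter> V)"
  then obtain p where p: "p \<in> fst c" "p \<in> V" "z = snd c p" by auto
  obtain c' where c': "c' \<in> A" "p \<in> fst c'" "smooth_chart A c'" by (rule atlas_cover)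
  have "Cinf_on (snd c ` (fst c \<inter> (fst c' \<inter> V))) (f \<circ> chart_inv c)"
    using chart_transfer[OF c'(3) c smooth_compatible_sym[OF chart_compatible[OF c c'(1)]] \<open>open V\<close>]
      assms(3) c'(1) unfolding smooth_fun_on_def by blast
  moreover have "open (snd c ` (fst c \<inter> (fst c' \<inter> V)))"
    by (rule smooth_chart_open_image[OF c]) (use smooth_chart_open(1)[OF c'(3)] \<open>open V\<close> in auto)
  ultimately show "\<exists>T. open T \<and> z \<in> T \<and> Cinf_on T (f \<circ> chart_inv c)"
    using p c' by blast
qed

lemma smooth_fun_on_chartI:
  assumes c: "smooth_chart A c" and "open V" "V \<subseteq> fst c" "Cinf_on (snd c ` V) (f \<circ> chart_inv c)"
  shows "smooth_fun_on A V f"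
  unfolding smooth_fun_on_def
proof
  fix c' assume c': "c' \<in> A"
  have V: "fst c \<inter> V = V" using assms(3) by auto
  show "Cinf_on (snd c' ` (fst c' \<inter> V)) (f \<circ> chart_inv c')"
    using chart_transfer[OF c atlas_chart[OF c'] chart_compatible[OF c c'] \<open>open V\<close>, of f] assms(4)
    by (simp add: V)
qed

lemma smooth_fun_on_local:
  assumes "open V" "\<And>p. p \<in> V \<Longrightarrow> \<exists>T. open T \<and> p \<in> T \<and> smooth_fun_on A T f"
  shows "smooth_fun_on A V f"
  unfolding smooth_fun_on_def
proof
  fix c assume c: "c \<in> A"
  note sc = atlas_chart[OF c]
  show "Cinf_on (snd c ` (fst c \<inter> V)) (f \<circ> chart_inv c)"
  proof (rule Cinf_on_local[OF smooth_chart_open_image[OF sc assms(1)]])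
    fix z assume "z \<in> snd c ` (fst c \<inter> V)"
    then obtain p where p: "p \<in> fst c" "p \<in> V" "z = snd c p" by auto
    then obtain T where T: "open T" "p \<in> T" "smooth_fun_on A T f" using assms(2) by blast
    then show "\<exists>S. open S \<and> z \<in> S \<and> Cinf_on S (f \<circ> chart_inv c)"
      using smooth_chart_open_image[OF sc T(1)] p c by (auto simp: smooth_fun_on_def)
  qed
qed

lemma smooth_fun_on_const: "smooth_fun_on A V (\<lambda>_. a)"
  by (simp add: smooth_fun_on_def o_def Cinf_on_const)

lemma smooth_fun_on_add:
  "smooth_fun_on A V f \<Longrightarrow> smooth_fun_on A V g \<Longrightarrow> smooth_fun_on A V (\<lambda>q. f q + g q)"
  using Cinf_on_add by (fastforce simp: smooth_fun_on_def o_def)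

lemma smooth_fun_on_diff:
  "smooth_fun_on A V f \<Longrightarrow> smooth_fun_on A V g \<Longrightarrow> smooth_fun_on A V (\<lambda>q. f q - g q)"
  using Cinf_on_diff by (fastforce simp: smooth_fun_on_def o_def)

lemma smooth_fun_on_mult:
  "smooth_fun_on A V f \<Longrightarrow> smooth_fun_on A V g \<Longrightarrow> smooth_fun_on A V (\<lambda>q. f q * g q)"
  using Cinf_on_mult by (fastforce simp: smooth_fun_on_def o_def)

lemma smooth_fun_on_sum:
  "(\<And>i. i \<in> I \<Longrightarrow> smooth_fun_on A V (f i)) \<Longrightarrow> smooth_fun_on A V (\<lambda>q. \<Sum>i\<in>I. f i q)"
  by (induction I rule: infinite_finite_induct) (auto intro: smooth_fun_on_const smooth_fun_on_add)

lemma smooth_fun_on_chart_inner: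
  assumes "smooth_chart A c" shows "smooth_fun_on A (fst c) (\<lambda>q. snd c q \<bullet> w)"
proof (rule smooth_fun_on_chartI[OF assms smooth_chart_open(1)[OF assms] order_refl])
  show "Cinf_on (snd c ` fst c) ((\<lambda>q. snd c q \<bullet> w) \<circ> chart_inv c)"
    by (rule Cinf_on_cong[OF smooth_chart_open(2)[OF assms] _
          Cinf_on_bounded_linear[OF bounded_linear_inner_left[of w] Cinf_on_id]])
      (simp add: smooth_chart_inv[OF assms] o_def smooth_chart_inv_right)
qed

lemma smooth_atI: "open V \<Longrightarrow> p \<in> V \<Longrightarrow> smooth_fun_on A V f \<Longrightarrow> smooth_at A p f"
  by (auto simp: smooth_at_def)

lemma smooth_at_cong:
  assumes "\<forall>\<^sub>F q in nhds p. f q = g q" "smooth_at A p f"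
  shows "smooth_at A p g"
proof -
  obtain V where V: "open V" "p \<in> V" "smooth_fun_on A V f" using assms(2) by (auto simp: smooth_at_def)
  obtain U where U: "open U" "p \<in> U" "\<And>q. q \<in> U \<Longrightarrow> f q = g q"
    using assms(1) unfolding eventually_nhds by blast
  have "smooth_fun_on A (V \<inter> U) g"
    by (rule smooth_fun_on_cong[OF _ smooth_fun_on_subset[OF V(3)]]) (use U V in auto)
  then show ?thesis using U V by (intro smooth_atI[of "V \<inter> U"]) auto
qed

lemma smooth_at_eventually_eq:
  assumes "\<forall>\<^sub>F q in nhds p. f q = g q" shows "smooth_at A p f \<longleftrightarrow> smooth_at A p g"
proof -
  have "\<forall>\<^sub>F q in nhds p. g q = f q" using assms by eventually_elim simp
  then show ?thesis using assms smooth_at_cong by blast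
qed

lemma smooth_at2:
  assumes "smooth_at A p f" "smooth_at A p g"
  obtains V where "open V" "p \<in> V" "smooth_fun_on A V f" "smooth_fun_on A V g"
proof -
  obtain V W where "open V" "p \<in> V" "smooth_fun_on A V f" "open W" "p \<in> W" "smooth_fun_on A W g"
    using assms by (auto simp: smooth_at_def)
  then show ?thesis
    using that[of "V \<inter> W"] smooth_fun_on_subset by (simp add: open_Int)
qed

lemma smooth_at_const: "smooth_at A p (\<lambda>_. a)"
  using smooth_atI[OF open_UNIV UNIV_I smooth_fun_on_const] .

lemma smooth_at_add: "smooth_at A p f \<Longrightarrow> smooth_at A p g \<Longrightarrow> smooth_at A p (\<lambda>q. f q + g q)"
  by (erule (1) smooth_at2) (auto intro: smooth_atI smooth_fun_on_add)

lemma smooth_at_diff: "smooth_at A p f \<Longrightarrow> smooth_at A p g \<Longrightarrow> smooth_at A p (\<lambda>q. f q - g q)"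
  by (erule (1) smooth_at2) (auto intro: smooth_atI smooth_fun_on_diff)

lemma smooth_at_mult: "smooth_at A p f \<Longrightarrow> smooth_at A p g \<Longrightarrow> smooth_at A p (\<lambda>q. f q * g q)"
  by (erule (1) smooth_at2) (auto intro: smooth_atI smooth_fun_on_mult)

lemma smooth_at_sum:
  "(\<And>i. i \<in> I \<Longrightarrow> smooth_at A p (f i)) \<Longrightarrow> smooth_at A p (\<lambda>q. \<Sum>i\<in>I. f i q)"
  by (induction I rule: infinite_finite_induct) (auto intro: smooth_at_const smooth_at_add)

lemma bump_function:
  assumes "open V" "p \<in> V"
  obtains \<eta> K where "closed K" "K \<subseteq> V" "smooth_fun_on A UNIV \<eta>" "\<And>q. q \<notin> K \<Longrightarrow> \<eta> q = 0"
    "\<forall>\<^sub>F q in nhds p. \<eta> q = 1"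
proof -
  obtain c where c: "c \<in> A" "p \<in> fst c" "smooth_chart A c" by (rule atlas_cover)
  let ?S = "snd c ` (fst c \<inter> V)" and ?z = "snd c p"
  have "open ?S" "?z \<in> ?S" using smooth_chart_open_image[OF c(3) assms(1)] c(2) assms(2) by auto
  then obtain \<rho> where \<rho>: "\<rho> > 0" "cball ?z \<rho> \<subseteq> ?S" using open_contains_cball by blast
  define K where "K = chart_inv c ` cball ?z \<rho>"
  have "?S \<subseteq> snd c ` fst c" by auto
  then have "compact K" unfolding K_def
    by (intro compact_continuous_image continuous_on_subset[OF smooth_chart_inv_continuous[OF c(3)]])
      (use \<rho> in auto)
  \<comment> \<open>Closed in the whole manifold, by the Hausdorff property, and not just in the
    chart domain: the complement is open, and there the extension by zero is smooth.\<close>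
  then have "closed K" by (rule compact_imp_closed)
  have KV: "K \<subseteq> fst c \<inter> V"
    unfolding K_def using \<rho>(2) smooth_chart_inv[OF c(3)] by fastforce
  \<comment> \<open>Scaled so that \<open>g\<close> reaches 2, where \<open>cutoff\<close> starts to
    vanish, on the sphere of radius \<rho>. Near the centre \<open>g\<close> is below 1, so the bump
    is 1 there.\<close>
  define g where "g z = 2 / \<rho>\<^sup>2 * ((z - ?z) \<bullet> (z - ?z))" for z
  define \<eta> where "\<eta> q = (if q \<in> fst c then cutoff (g (snd c q)) else 0)" for q
  have zero: "\<eta> q = 0" if "q \<notin> K" for q
  proof (cases "q \<in> fst c")
    case True
    then have "snd c q \<notin> cball ?z \<rho>" using that smooth_chart_inv[OF c(3) True] K_def by force
    then have "norm (snd c q - ?z) > \<rho>" by (simp add: dist_norm norm_minus_commute)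
    then have "(snd c q - ?z) \<bullet> (snd c q - ?z) \<ge> \<rho>\<^sup>2"
      using power_mono[of \<rho> "norm (snd c q - ?z)" 2] \<rho>(1) by (simp add: power2_norm_eq_inner)
    then have "g (snd c q) \<ge> 2" using \<rho>(1) by (simp add: g_def field_simps)
    then show ?thesis by (simp add: \<eta>_def cutoff_eq_0)
  qed (simp add: \<eta>_def)
  have "Cinf_on UNIV (\<lambda>z. \<Sum>e\<in>Basis. ((z - ?z) \<bullet> e) * ((z - ?z) \<bullet> e))"
    by (intro Cinf_on_sum Cinf_on_mult Cinf_on_bounded_linear[OF bounded_linear_inner_left]
        Cinf_on_diff Cinf_on_id Cinf_on_const)
  then have "Cinf_on UNIV g"
    unfolding g_def by (intro Cinf_on_mult Cinf_on_const) (simp add: euclidean_inner[symmetric])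
  then have "Cinf_on (snd c ` fst c) (\<lambda>z. cutoff (g z))"
    using Cinf_on_compose[OF Cinf_on_cutoff, of UNIV g] Cinf_on_subset by blast
  then have "Cinf_on (snd c ` fst c) (\<eta> \<circ> chart_inv c)"
    by (rule Cinf_on_cong[OF smooth_chart_open(2)[OF c(3)], rotated])
      (simp add: \<eta>_def smooth_chart_inv[OF c(3)] o_def smooth_chart_inv_right image_iff)
  then have 1: "smooth_fun_on A (fst c) \<eta>"
    by (intro smooth_fun_on_chartI[OF c(3) smooth_chart_open(1)[OF c(3)] order_refl])
  have 2: "smooth_fun_on A (- K) \<eta>"
    by (rule smooth_fun_on_cong[OF _ smooth_fun_on_const[of _ 0]]) (use zero \<open>closed K\<close> in auto)
  have smooth: "smooth_fun_on A UNIV \<eta>"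
  proof (rule smooth_fun_on_local[OF open_UNIV])
    fix q
    show "\<exists>T. open T \<and> q \<in> T \<and> smooth_fun_on A T \<eta>"
      using 1 2 KV smooth_chart_open(1)[OF c(3)] \<open>closed K\<close> by (cases "q \<in> fst c") blast+
  qed
  have "isCont (\<lambda>q. g (snd c q)) p"
    unfolding g_def using smooth_chart_continuous[OF c(3)] smooth_chart_open(1)[OF c(3)] c(2)
    by (intro continuous_intros) (auto simp: continuous_on_eq_continuous_at)
  then have "((\<lambda>q. g (snd c q)) \<longlongrightarrow> g (snd c p)) (nhds p)"
    using tendsto_at_iff_tendsto_nhds[of "\<lambda>q. g (snd c q)" p] by (simp add: isCont_def)
  then have "\<forall>\<^sub>F q in nhds p. g (snd c q) < 1"
    by (rule order_tendstoD(2)) (simp add: g_def)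
  moreover have "\<forall>\<^sub>F q in nhds p. q \<in> fst c"
    using smooth_chart_open(1)[OF c(3)] c(2) by (rule eventually_nhds_in_open)
  ultimately have "\<forall>\<^sub>F q in nhds p. \<eta> q = 1"
    by eventually_elim (simp add: \<eta>_def cutoff_eq_1)
  then show ?thesis using that[OF \<open>closed K\<close> _ smooth zero] KV by blast
qed

text \<open>Off the closed set \<open>K\<close> the product is 0 whatever values \<open>f\<close>
  takes outside \<open>V\<close>. In this way local data become globally smooth functions.\<close>

lemma smooth_fun_on_cut_off:
  assumes "closed K" "K \<subseteq> V" "open V" "smooth_fun_on A UNIV \<eta>" "\<And>q. q \<notin> K \<Longrightarrow> \<eta> q = 0"
    "smooth_fun_on A V f"
  shows "smooth_fun_on A UNIV (\<lambda>q. \<eta> q * f q)"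
proof (rule smooth_fun_on_local[OF open_UNIV])
  fix q
  have "smooth_fun_on A V (\<lambda>q. \<eta> q * f q)"
    using smooth_fun_on_mult smooth_fun_on_subset assms(4,6) by blast
  moreover have "smooth_fun_on A (- K) (\<lambda>q. \<eta> q * f q)"
    by (rule smooth_fun_on_cong[OF _ smooth_fun_on_const[of _ 0]]) (use assms in auto)
  ultimately show "\<exists>T. open T \<and> q \<in> T \<and> smooth_fun_on A T (\<lambda>q. \<eta> q * f q)"
    using assms(1,2,3) by (cases "q \<in> K") blast+
qed

section \<open>Derivations at a point\<close>

lemma tangent_add:
  "v \<in> tangent_space A p \<Longrightarrow> smooth_at A p f \<Longrightarrow> smooth_at A p g \<Longrightarrow> v (\<lambda>q. f q + g q) = v f + v g"
  by (simp add: tangent_space_def)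

lemma tangent_mult:
  "v \<in> tangent_space A p \<Longrightarrow> smooth_at A p f \<Longrightarrow> smooth_at A p g \<Longrightarrow>
    v (\<lambda>q. f q * g q) = f p * v g + g p * v f"
  by (simp add: tangent_space_def)

lemma tangent_cmult:
  "v \<in> tangent_space A p \<Longrightarrow> smooth_at A p f \<Longrightarrow> v (\<lambda>q. a * f q) = a * v f"
  by (simp add: tangent_space_def)

lemma tangent_not_smooth: "v \<in> tangent_space A p \<Longrightarrow> \<not> smooth_at A p f \<Longrightarrow> v f = 0"
  by (simp add: tangent_space_def)

lemma tangent_const:
  assumes "v \<in> tangent_space A p" shows "v (\<lambda>_. a) = 0"
proof -
  have "v (\<lambda>_. 1) = 0"
    using tangent_mult[OF assms smooth_at_const[of p 1] smooth_at_const[of p 1]] by simp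
  then show ?thesis using tangent_cmult[OF assms smooth_at_const[of p 1], of a] by simp
qed

lemma tangent_diff:
  assumes "v \<in> tangent_space A p" "smooth_at A p f" "smooth_at A p g"
  shows "v (\<lambda>q. f q - g q) = v f - v g"
  using tangent_add[OF assms(1) smooth_at_diff[OF assms(2,3)] assms(3)] by simp

lemma tangent_sum:
  assumes "v \<in> tangent_space A p"
  shows "(\<And>i. i \<in> I \<Longrightarrow> smooth_at A p (f i)) \<Longrightarrow> v (\<lambda>q. \<Sum>i\<in>I. f i q) = (\<Sum>i\<in>I. v (f i))"
  by (induction I rule: infinite_finite_induct)
    (auto simp: tangent_const[OF assms] tangent_add[OF assms] smooth_at_sum)

text \<open>A derivation kills \<open>f\<close> vanishing near \<open>p\<close>: apply the Leibniz rule to the product of \<open>f\<close>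
  with the indicator function of a neighbourhood, which is smooth at \<open>p\<close>.\<close>

lemma tangent_cong:
  assumes v: "v \<in> tangent_space A p" and eq: "\<forall>\<^sub>F q in nhds p. f q = g q"
  shows "v f = v g"
proof (cases "smooth_at A p f")
  case True
  then have g: "smooth_at A p g" using smooth_at_eventually_eq[OF eq] by blast
  obtain U where U: "open U" "p \<in> U" "\<And>q. q \<in> U \<Longrightarrow> f q = g q"
    using eq unfolding eventually_nhds by blast
  let ?i = "\<lambda>q. if q \<in> U then 1 else 0 :: real" and ?h = "\<lambda>q. f q - g q"
  have "smooth_fun_on A U ?i"
    by (rule smooth_fun_on_cong[OF U(1) smooth_fun_on_const[of _ 1]]) simp
  then have i: "smooth_at A p ?i" using U by (auto intro: smooth_atI)
  have "(\<lambda>q. ?i q * ?h q) = (\<lambda>_. 0)" using U(3) by auto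
  with tangent_mult[OF v i smooth_at_diff[OF True g]] tangent_const[OF v, of 0]
  have "v ?h = 0" using U(2,3) by simp
  then show ?thesis using tangent_diff[OF v True g] by simp
next
  case False
  then show ?thesis using smooth_at_eventually_eq[OF eq] tangent_not_smooth[OF v] by metis
qed

lemma tangent_space_add: "v \<in> tangent_space A p \<Longrightarrow> w \<in> tangent_space A p \<Longrightarrow> v + w \<in> tangent_space A p"
  by (auto simp: tangent_space_def algebra_simps)

lemma tangent_space_scaleR: "v \<in> tangent_space A p \<Longrightarrow> a *\<^sub>R v \<in> tangent_space A p"
  by (auto simp: tangent_space_def scaleR_fun_def algebra_simps)

lemma tangent_space_0: "0 \<in> tangent_space A p"
  by (auto simp: tangent_space_def)

lemma tangent_space_sum: "(\<And>i. i \<in> I \<Longrightarrow> v i \<in> tangent_space A p) \<Longrightarrow> (\<Sum>i\<in>I. v i) \<in> tangent_space A p"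
  by (induction I rule: infinite_finite_induct) (auto simp: tangent_space_0 tangent_space_add)

lemma sum_fun_apply: "(\<Sum>i\<in>I. f i) x = (\<Sum>i\<in>I. f i x)"
  for f :: "'i \<Rightarrow> 'b \<Rightarrow> 'c::comm_monoid_add"
  by (induction I rule: infinite_finite_induct) auto

section \<open>Coordinate vectors and components of tangent vectors\<close>

lemma chart_has_derivative:
  assumes c: "smooth_chart A c" and p: "p \<in> fst c" and f: "smooth_at A p f"
  shows "((f \<circ> chart_inv c) has_derivative frechet_derivative (f \<circ> chart_inv c) (at (snd c p))) (at (snd c p))"
proof -
  obtain V where V: "open V" "p \<in> V" "smooth_fun_on A V f" using f by (auto simp: smooth_at_def)
  show ?thesis
    by (rule Cinf_on_has_derivative[OF smooth_fun_on_chart[OF c V(1,3)]]) (use p V(2) in auto)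
qed

lemma chart_vec_apply:
  "q \<in> fst c \<Longrightarrow> smooth_at A q f \<Longrightarrow>
    chart_vec A c w q f = frechet_derivative (f \<circ> chart_inv c) (at (snd c q)) w"
  by (simp add: chart_vec_def)

lemma chart_vec_tangent:
  assumes c: "smooth_chart A c" shows "chart_vec A c w p \<in> tangent_space A p"
proof (cases "p \<in> fst c")
  case False
  then have "chart_vec A c w p = 0" by (auto simp: chart_vec_def)
  then show ?thesis by (simp add: tangent_space_0)
next
  case p: True
  note D = chart_has_derivative[OF c p]
  have inv: "chart_inv c (snd c p) = p" using smooth_chart_inv[OF c p] .
  show ?thesis unfolding tangent_space_def
  proof (intro CollectI conjI allI impI)
    fix f g assume f: "smooth_at A p f" and g: "smooth_at A p g"
    have "((\<lambda>q. f q + g q) \<circ> chart_inv c has_derivative (\<lambda>w. chart_vec A c w p f + chart_vec A c w p g)) (at (snd c p))"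
      using has_derivative_add[OF D[OF f] D[OF g]] by (simp add: o_def chart_vec_apply p f g)
    from fun_cong[OF frechet_derivative_at[OF this], of w]
    show "chart_vec A c w p (\<lambda>q. f q + g q) = chart_vec A c w p f + chart_vec A c w p g"
      by (simp add: chart_vec_apply p f g smooth_at_add)
    have "((\<lambda>q. f q * g q) \<circ> chart_inv c has_derivative (\<lambda>w. f p * chart_vec A c w p g + chart_vec A c w p f * g p)) (at (snd c p))"
      using has_derivative_mult[OF D[OF f] D[OF g]] by (simp add: o_def chart_vec_apply p f g inv)
    from fun_cong[OF frechet_derivative_at[OF this], of w]
    show "chart_vec A c w p (\<lambda>q. f q * g q) = f p * chart_vec A c w p g + g p * chart_vec A c w p f"
      by (simp add: chart_vec_apply p f g smooth_at_mult mult.commute)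
  next
    fix a f assume f: "smooth_at A p f"
    have "((\<lambda>q. a * f q) \<circ> chart_inv c has_derivative (\<lambda>w. a * chart_vec A c w p f)) (at (snd c p))"
      using has_derivative_mult_right[OF D[OF f], of a] by (simp add: o_def chart_vec_apply p f)
    from fun_cong[OF frechet_derivative_at[OF this], of w]
    show "chart_vec A c w p (\<lambda>q. a * f q) = a * chart_vec A c w p f"
      by (simp add: chart_vec_apply p f smooth_at_mult smooth_at_const)
  qed (simp add: chart_vec_def)
qed

lemma chart_vec_inner:
  assumes c: "smooth_chart A c" and p: "p \<in> fst c"
  shows "chart_vec A c w p (\<lambda>q. snd c q \<bullet> u) = w \<bullet> u"
proof -
  have s: "smooth_at A p (\<lambda>q. snd c q \<bullet> u)"
    using smooth_atI[OF smooth_chart_open(1)[OF c] p smooth_fun_on_chart_inner[OF c]] .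
  have "((\<lambda>z. z \<bullet> u) has_derivative (\<lambda>z. z \<bullet> u)) (at (snd c p))"
    by (auto intro!: derivative_eq_intros)
  then have "((\<lambda>q. snd c q \<bullet> u) \<circ> chart_inv c has_derivative (\<lambda>z. z \<bullet> u)) (at (snd c p))"
    by (rule has_derivative_transform_within_open[OF _ smooth_chart_open(2)[OF c]])
      (use p smooth_chart_inv[OF c] in auto)
  from fun_cong[OF frechet_derivative_at[OF this], of w] show ?thesis
    by (simp add: chart_vec_apply p s)
qed

lemma chart_vec_sum:
  assumes c: "smooth_chart A c"
  shows "chart_vec A c (\<Sum>i\<in>I. a i *\<^sub>R w i) p f = (\<Sum>i\<in>I. a i * chart_vec A c (w i) p f)"
proof (cases "p \<in> fst c \<and> smooth_at A p f")
  case True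
  then have "linear (frechet_derivative (f \<circ> chart_inv c) (at (snd c p)))"
    using has_derivative_linear chart_has_derivative[OF c] by blast
  then show ?thesis using True by (simp add: chart_vec_apply linear_sum linear_cmul)
qed (auto simp: chart_vec_def)

text \<open>By Hadamard's lemma a derivation is determined by its values on the coordinates.\<close>

lemma tangent_expansion:
  assumes c: "smooth_chart A c" and p: "p \<in> fst c" and f: "smooth_at A p f"
    and v: "v \<in> tangent_space A p"
  shows "v f = (\<Sum>e\<in>Basis. v (\<lambda>q. snd c q \<bullet> e) * chart_vec A c e p f)"
proof -
  obtain V where V: "open V" "p \<in> V" "smooth_fun_on A V f" using f by (auto simp: smooth_at_def)
  let ?S = "snd c ` (fst c \<inter> V)" and ?z = "snd c p" and ?F = "f \<circ> chart_inv c"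
  have S: "open ?S" "?z \<in> ?S" using smooth_chart_open_image[OF c V(1)] V(2) p by auto
  then obtain \<rho> where \<rho>: "\<rho> > 0" "ball ?z \<rho> \<subseteq> ?S" using open_contains_ball by blast
  have B: "open (ball ?z \<rho>)" "convex (ball ?z \<rho>)" "?z \<in> ball ?z \<rho>" "Cinf_on (ball ?z \<rho>) ?F"
    using \<rho> Cinf_on_subset[OF smooth_fun_on_chart[OF c V(1,3)]] by auto
  obtain G where G: "\<And>e. Cinf_on (ball ?z \<rho>) (G e)"
    "\<And>z. z \<in> ball ?z \<rho> \<Longrightarrow> ?F z = ?F ?z + (\<Sum>e\<in>Basis. ((z - ?z) \<bullet> e) * G e z)"
    using hadamard[OF B] by blast
  define U where "U = fst c \<inter> snd c -` ball ?z \<rho>"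
  have U: "open U" "p \<in> U" "U \<subseteq> fst c"
    using continuous_open_preimage[OF smooth_chart_continuous[OF c] smooth_chart_open(1)[OF c] B(1)] p \<rho>(1)
    by (auto simp: U_def)
  have z: "smooth_at A p (\<lambda>q. snd c q \<bullet> e)" for e
    using smooth_atI[OF smooth_chart_open(1)[OF c] p smooth_fun_on_chart_inner[OF c]] .
  have "smooth_fun_on A U (\<lambda>q. G e (snd c q))" for e
  proof (rule smooth_fun_on_chartI[OF c U(1,3)])
    have "snd c ` U \<subseteq> ball ?z \<rho>" by (auto simp: U_def)
    from Cinf_on_subset[OF G(1)[of e] this]
    show "Cinf_on (snd c ` U) ((\<lambda>q. G e (snd c q)) \<circ> chart_inv c)"
      by (rule Cinf_on_cong[rotated 2])
        (use smooth_chart_open_image[OF c U(1)] smooth_chart_inv[OF c] U(3) in \<open>auto simp: Int_absorb1 dest: subsetD\<close>)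
  qed
  then have G': "smooth_at A p (\<lambda>q. G e (snd c q))" for e using U by (auto intro: smooth_atI)
  have ev: "\<forall>\<^sub>F q in nhds p. f q = f p + (\<Sum>e\<in>Basis. (snd c q \<bullet> e - ?z \<bullet> e) * G e (snd c q))"
    using eventually_nhds_in_open[OF U(1,2)]
  proof eventually_elim
    case (elim q)
    then have "q \<in> fst c" "snd c q \<in> ball ?z \<rho>" by (auto simp: U_def)
    with G(2)[of "snd c q"] smooth_chart_inv[OF c] p show ?case
      by (simp add: inner_diff_left)
  qed
  \<comment> \<open>A derivation kills the constant, and in each product only the factor vanishing
    at \<open>p\<close> can be the differentiated one. Coordinate vectors are derivations as well,
    so \<open>key\<close> also identifies \<open>G e ?z\<close> as a partial derivative of
    \<open>f\<close>.\<close>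
  have key: "u f = (\<Sum>e\<in>Basis. u (\<lambda>q. snd c q \<bullet> e) * G e ?z)" if u: "u \<in> tangent_space A p" for u
  proof -
    have "u f = u (\<lambda>q. f p + (\<Sum>e\<in>Basis. (snd c q \<bullet> e - ?z \<bullet> e) * G e (snd c q)))"
      by (rule tangent_cong[OF u ev])
    also have "\<dots> = u (\<lambda>_. f p) + (\<Sum>e\<in>Basis. u (\<lambda>q. (snd c q \<bullet> e - ?z \<bullet> e) * G e (snd c q)))"
      by (subst tangent_add[OF u]; (subst tangent_sum[OF u])?)
        (auto intro!: smooth_at_const smooth_at_sum smooth_at_mult smooth_at_diff z G')
    also have "\<dots> = (\<Sum>e\<in>Basis. u (\<lambda>q. snd c q \<bullet> e) * G e ?z)"
      by (simp add: tangent_const[OF u] tangent_mult[OF u] tangent_diff[OF u] z G' smooth_at_diff smooth_at_const mult.commute)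
    finally show ?thesis .
  qed
  have "chart_vec A c e p f = G e ?z" if "e \<in> Basis" for e
    unfolding key[OF chart_vec_tangent[OF c]]
    using that by (simp add: chart_vec_inner[OF c p] inner_Basis if_distrib[of "\<lambda>x. x * _"] sum.delta cong: if_cong)
  then show ?thesis using key[OF v] by simp
qed

lemma chart_vec_components:
  assumes c: "smooth_chart A c" and p: "p \<in> fst c" and v: "v \<in> tangent_space A p"
  shows "chart_vec A c (\<Sum>e\<in>Basis. v (\<lambda>q. snd c q \<bullet> e) *\<^sub>R e) p = v"
proof
  fix f
  show "chart_vec A c (\<Sum>e\<in>Basis. v (\<lambda>q. snd c q \<bullet> e) *\<^sub>R e) p f = v f"
  proof (cases "smooth_at A p f")
    case True
    show ?thesis unfolding chart_vec_sum[OF c] using tangent_expansion[OF c p True v] by simp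
  next
    case False
    then show ?thesis using tangent_not_smooth[OF v] tangent_not_smooth[OF chart_vec_tangent[OF c]] by simp
  qed
qed

lemma smooth_fun_on_chart_vec:
  assumes c: "smooth_chart A c" and V: "open V" "V \<subseteq> fst c" and f: "smooth_fun_on A V f"
  shows "smooth_fun_on A V (\<lambda>q. chart_vec A c w q f)"
proof (rule smooth_fun_on_chartI[OF c V])
  have int: "fst c \<inter> V = V" using V(2) by auto
  have op: "open (snd c ` V)" using smooth_chart_open_image[OF c V(1)] by (simp add: int)
  have "Cinf_on (snd c ` V) (f \<circ> chart_inv c)" using smooth_fun_on_chart[OF c V(1) f] by (simp add: int)
  from Cinf_on_frechet[OF this op, of w]
  show "Cinf_on (snd c ` V) ((\<lambda>q. chart_vec A c w q f) \<circ> chart_inv c)"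
  proof (rule Cinf_on_cong[OF op, rotated])
    fix z assume "z \<in> snd c ` V"
    then obtain q where q: "q \<in> V" "z = snd c q" by auto
    then show "frechet_derivative (f \<circ> chart_inv c) (at z) w = ((\<lambda>q. chart_vec A c w q f) \<circ> chart_inv c) z"
      using V smooth_atI[OF V(1) q(1) f] smooth_chart_inv[OF c] by (auto simp: chart_vec_apply)
  qed
qed

lemma smooth_vfield_on_chart_vec:
  assumes c: "smooth_chart A c" and "V \<subseteq> fst c" shows "smooth_vfield_on A V (chart_vec A c w)"
  unfolding smooth_vfield_on_def
  using chart_vec_tangent[OF c] smooth_fun_on_chart_vec[OF c] assms(2) by (meson order_trans)

text \<open>Schwarz's theorem read in the chart; it is the reason why the constant extensions used
  by \<open>ext_d\<close> commute.\<close>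

lemma chart_vec_commute:
  assumes c: "smooth_chart A c" and p: "p \<in> fst c" and V: "open V" "p \<in> V" and f: "smooth_fun_on A V f"
  shows "chart_vec A c w p (\<lambda>q. chart_vec A c u q f) = chart_vec A c u p (\<lambda>q. chart_vec A c w q f)"
proof -
  let ?V = "fst c \<inter> V" and ?F = "f \<circ> chart_inv c"
  have f': "smooth_fun_on A ?V f" using smooth_fun_on_subset[OF f] by auto
  have V': "open ?V" "?V \<subseteq> fst c" "p \<in> ?V" using V smooth_chart_open(1)[OF c] p by auto
  have op: "open (snd c ` ?V)" using smooth_chart_open_image[OF c V(1)] .
  have eq: "chart_vec A c w p (\<lambda>q. chart_vec A c u q f) =
     frechet_derivative (\<lambda>z. frechet_derivative ?F (at z) u) (at (snd c p)) w" for w u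
  proof -
    let ?g = "(\<lambda>q. chart_vec A c u q f) \<circ> chart_inv c"
    have "smooth_at A p (\<lambda>q. chart_vec A c u q f)"
      using smooth_atI[OF V'(1,3) smooth_fun_on_chart_vec[OF c V'(1,2) f']] .
    note g = chart_has_derivative[OF c p this] chart_vec_apply[OF p this]
    have "((\<lambda>z. frechet_derivative ?F (at z) u) has_derivative frechet_derivative ?g (at (snd c p))) (at (snd c p))"
    proof (rule has_derivative_transform_within_open[OF g(1) op])
      show "snd c p \<in> snd c ` ?V" using V'(3) by blast
      fix z assume "z \<in> snd c ` ?V"
      then obtain q where q: "q \<in> ?V" "z = snd c q" by auto
      then show "?g z = frechet_derivative ?F (at z) u"
        using smooth_atI[OF V'(1) q(1) f'] smooth_chart_inv[OF c] by (auto simp: chart_vec_apply)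
    qed
    from fun_cong[OF frechet_derivative_at[OF this], of w] show ?thesis using g(2) by simp
  qed
  show ?thesis unfolding eq
    by (rule frechet_derivative_commute[OF op _ smooth_fun_on_chart[OF c V(1) f]]) (use V'(3) in blast)
qed

end

section \<open>Forms\<close>

text \<open>Degrees are written \<open>1\<close> in \<open>Omega A 1\<close> and
  \<open>alt_space A p 1\<close>; rewriting them to \<open>Suc 0\<close> would keep facts about
  1-forms from matching.\<close>

declare One_nat_def [simp del]

lemma alt_wedge_add_left: "alt_wedge (a + a') b = alt_wedge a b + alt_wedge a' b"
  by (rule ext) (simp add: alt_wedge_def algebra_simps sum.distrib)

lemma alt_wedge_scaleR_left: "alt_wedge (t *\<^sub>R a) b = t *\<^sub>R alt_wedge a b"
  by (rule ext) (simp add: alt_wedge_def scaleR_fun_def sum_distrib_left mult_ac)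

lemma alt_wedge_0_left: "alt_wedge 0 b = 0"
  by (rule ext) (simp add: alt_wedge_def)

lemma alt_wedge_0_right: "alt_wedge a 0 = 0"
  by (rule ext) (simp add: alt_wedge_def)

lemma alt_wedge_sum_left: "alt_wedge (\<Sum>i\<in>I. f i) b = (\<Sum>i\<in>I. alt_wedge (f i) b)"
  by (induction I rule: infinite_finite_induct) (simp_all add: alt_wedge_0_left alt_wedge_add_left del: zero_fun_apply plus_fun_apply)

text \<open>A function evaluates to 0 on every nonempty list, so only the shuffle
  \<open>I = {}\<close> contributes. Thereby the Leibniz rule for wedge products contains the one
  for multiplication by functions.\<close>

lemma alt_wedge_fun_form: "alt_wedge (fun_form f p) b = f p *\<^sub>R b"
proof
  fix vs :: "'a tvec list"
  let ?c = "\<lambda>I. (- 1) ^ card {(i, j). i \<in> I \<and> j \<in> {..<length vs} - I \<and> j < i} :: real"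
  have "fun_form f p (nths vs I) = (if I = {} then f p else 0)" if "I \<in> Pow {..<length vs}" for I
  proof (cases "I = {}")
    case False
    then obtain i where "i \<in> I" by blast
    moreover from this have "i < length vs" using that by auto
    ultimately
    have "vs ! i \<in> set (nths vs I)" by (auto simp: set_nths)
    then show ?thesis using False by (auto simp: fun_form_def)
  qed (simp add: fun_form_def)
  then have "alt_wedge (fun_form f p) b vs =
      (\<Sum>I\<in>Pow {..<length vs}. if I = {} then ?c I * f p * b (nths vs (- I)) else 0)"
    unfolding alt_wedge_def by (intro sum.cong refl) simp
  also have "\<dots> = f p * b (nths vs (- {}))" by (subst sum.delta) simp_all
  finally show "alt_wedge (fun_form f p) b vs = (f p *\<^sub>R b) vs"
    by (simp add: scaleR_fun_def nths_all)
qed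

lemma wedge_fun_form: "wedge (fun_form f) \<omega> = fmul f \<omega>"
  by (simp add: wedge_def fmul_def alt_wedge_fun_form)

lemma covector_apply_0:
  assumes "a \<in> cotangent_space A p" "\<not> (\<exists>v\<in>tangent_space A p. vs = [v])"
  shows "a vs = 0"
proof -
  have "\<not> (length vs = 1 \<and> set vs \<subseteq> tangent_space A p)"
    using assms(2) by (auto simp: length_Suc_conv One_nat_def)
  then show ?thesis using assms(1) unfolding alt_space_def by blast
qed

lemma length_nths_compl: "length (nths vs I) + length (nths vs (- I)) = length vs"
proof -
  have "{..<length vs} = {i. i < length vs \<and> i \<in> I} \<union> {i. i < length vs \<and> i \<in> - I}" by auto
  then have "card {..<length vs} = card {i. i < length vs \<and> i \<in> I} + card {i. i < length vs \<and> i \<in> - I}"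
    by (metis (no_types, lifting) card_Un_disjoint finite_Un finite_lessThan disjoint_iff Compl_iff mem_Collect_eq)
  then show ?thesis by (simp add: length_nths)
qed

text \<open>Of the four shuffles of two vectors only the singletons give each covector exactly one
  argument. For any other length some factor gets a list of the wrong length.\<close>

lemma alt_wedge_covectors:
  assumes a: "a \<in> cotangent_space A p" and b: "b \<in> cotangent_space A p"
  shows "alt_wedge a b vs = (if length vs = 2 then a [vs ! 0] * b [vs ! 1] - a [vs ! 1] * b [vs ! 0] else 0)"
proof (cases "length vs = 2")
  case False
  have "a (nths vs I) * b (nths vs (- I)) = 0" for I
  proof (cases "length (nths vs I) = 1")
    case True
    then have "length (nths vs (- I)) \<noteq> 1" using length_nths_compl[of vs I] False by simp
    then have "b (nths vs (- I)) = 0" by (intro covector_apply_0[OF b]) auto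
    then show ?thesis by simp
  next
    case False
    then have "a (nths vs I) = 0" by (intro covector_apply_0[OF a]) auto
    then show ?thesis by simp
  qed
  then have "alt_wedge a b vs = 0" unfolding alt_wedge_def by (intro sum.neutral ballI) simp
  then show ?thesis using False by simp
next
  case True
  then obtain v w where vs: "vs = [v, w]" by (auto simp: length_Suc_conv numeral_2_eq_2)
  have P: "Pow {..<length vs} = {{}, {0}, {1}, {0, 1}}"
    by (simp add: vs numeral_2_eq_2 lessThan_Suc Pow_insert) auto
  \<comment> \<open>The shuffle that feeds the second vector to \<open>a\<close> has exactly one
    inversion, whence the minus sign.\<close>
  have e: "{(i, j). i \<in> {0::nat} \<and> j \<in> {..<length vs} - {0} \<and> j < i} = {}"
    "{(i, j). i \<in> {1::nat} \<and> j \<in> {..<length vs} - {1} \<and> j < i} = {(1, 0)}" by (auto simp: vs)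
  have a0: "a [] = 0" "b [] = 0" "a [v, w] = 0" "b [v, w] = 0"
    using covector_apply_0[OF a] covector_apply_0[OF b] by auto
  show ?thesis
  proof -
    define t where "t I = (- 1) ^ card {(i, j). i \<in> I \<and> j \<in> {..<length vs} - I \<and> j < i} *
      a (nths vs I) * b (nths vs (- I))" for I
    have "t {} = 0" "t {0, 1} = 0" by (simp_all add: t_def vs nths_Cons a0 One_nat_def)
    moreover have "t {0} = a [v] * b [w]"
      unfolding t_def e(1) by (simp add: vs nths_Cons One_nat_def)
    moreover have "t {1} = - a [w] * b [v]"
      unfolding t_def e(2) by (simp add: vs nths_Cons One_nat_def)
    moreover have "alt_wedge a b vs = t {} + t {0} + t {1} + t {0, 1}"
    proof -
      have "alt_wedge a b vs = (\<Sum>I\<in>{{}, {0}, {1}, {0, 1}}. t I)"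
        by (simp only: alt_wedge_def P t_def)
      also have "\<dots> = t {} + t {0} + t {1} + t {0, 1}"
        by (subst sum.insert; (subst sum.insert)?; (subst sum.insert)?; simp add: add.assoc)
      finally show ?thesis .
    qed
    ultimately show ?thesis by (simp add: vs One_nat_def)
  qed
qed

lemma alt_wedge_antisym:
  assumes "a \<in> cotangent_space A p" "b \<in> cotangent_space A p"
  shows "alt_wedge b a = - alt_wedge a b"
  by (rule ext) (simp add: alt_wedge_covectors[OF assms] alt_wedge_covectors[OF assms(2,1)])

lemma alt_space_add: "a \<in> alt_space A p k \<Longrightarrow> b \<in> alt_space A p k \<Longrightarrow> a + b \<in> alt_space A p k"
  by (auto simp: alt_space_def algebra_simps)

lemma alt_space_scaleR: "a \<in> alt_space A p k \<Longrightarrow> t *\<^sub>R a \<in> alt_space A p k"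
  by (auto simp: alt_space_def scaleR_fun_def algebra_simps)

lemma alt_space_0: "0 \<in> alt_space A p k"
  by (simp add: alt_space_def)

lemma alt_space_sum: "(\<And>i. i \<in> I \<Longrightarrow> a i \<in> alt_space A p k) \<Longrightarrow> (\<Sum>i\<in>I. a i) \<in> alt_space A p k"
  by (induction I rule: infinite_finite_induct) (auto simp: alt_space_0 alt_space_add)

lemma alt_wedge_alt_space:
  assumes a: "a \<in> cotangent_space A p" and b: "b \<in> cotangent_space A p"
  shows "alt_wedge a b \<in> alt_space A p 2"
  unfolding alt_space_def
proof (intro CollectI conjI allI impI)
  fix vs :: "'a tvec list" assume "\<not> (length vs = 2 \<and> set vs \<subseteq> tangent_space A p)"
  then show "alt_wedge a b vs = 0"
  proof (cases "length vs = 2")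
    case True
    then obtain v w where vs: "vs = [v, w]" by (auto simp: length_Suc_conv numeral_2_eq_2)
    then have "v \<notin> tangent_space A p \<or> w \<notin> tangent_space A p"
      using \<open>\<not> (length vs = 2 \<and> set vs \<subseteq> tangent_space A p)\<close> by simp
    then have "a [v] = 0 \<and> b [v] = 0 \<or> a [w] = 0 \<and> b [w] = 0"
      using covector_apply_0[OF a] covector_apply_0[OF b] by auto
    then show ?thesis by (auto simp: alt_wedge_covectors[OF a b] vs)
  qed (simp add: alt_wedge_covectors[OF a b])
next
  have lin: "x [t *\<^sub>R v + w] = t * x [v] + x [w]"
    if "x \<in> cotangent_space A p" "v \<in> tangent_space A p" "w \<in> tangent_space A p" for x t v w
  proof -
    have "\<forall>vs i v w c. length vs = 1 \<longrightarrow> set vs \<subseteq> tangent_space A p \<longrightarrow> i < 1 \<longrightarrow>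
        v \<in> tangent_space A p \<longrightarrow> w \<in> tangent_space A p \<longrightarrow>
        x (vs[i := c *\<^sub>R v + w]) = c * x (vs[i := v]) + x (vs[i := w])"
      using that(1) unfolding alt_space_def by blast
    from this[rule_format, of "[v]" 0 v w t] that show ?thesis by simp
  qed
  fix vs :: "'a tvec list" and i v w t
  assume h: "length vs = 2" "set vs \<subseteq> tangent_space A p" "i < (2::nat)"
    "v \<in> tangent_space A p" "w \<in> tangent_space A p"
  obtain x y where vs: "vs = [x, y]" using h(1) by (auto simp: length_Suc_conv numeral_2_eq_2)
  show "alt_wedge a b (vs[i := t *\<^sub>R v + w]) = t * alt_wedge a b (vs[i := v]) + alt_wedge a b (vs[i := w])"
    using h less_2_cases[OF h(3)]
    by (auto simp: vs alt_wedge_covectors[OF a b] lin[OF a] lin[OF b] One_nat_def) (simp_all add: algebra_simps)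
next
  fix vs :: "'a tvec list" and i j assume h: "i < j" "j < length vs" "vs ! i = vs ! j"
  then show "alt_wedge a b vs = 0"
    by (cases "length vs = 2") (auto simp: alt_wedge_covectors[OF a b] less_2_cases_iff One_nat_def)
qed

context smooth_manifold
begin

section \<open>Covectors and smooth forms\<close>

lemma covector_linear:
  assumes "a \<in> cotangent_space A p" "v \<in> tangent_space A p" "w \<in> tangent_space A p"
  shows "a [t *\<^sub>R v + w] = t * a [v] + a [w]"
proof -
  have "\<forall>vs i v w c. length vs = 1 \<longrightarrow> set vs \<subseteq> tangent_space A p \<longrightarrow> i < 1 \<longrightarrow>
      v \<in> tangent_space A p \<longrightarrow> w \<in> tangent_space A p \<longrightarrow>
      a (vs[i := c *\<^sub>R v + w]) = c * a (vs[i := v]) + a (vs[i := w])"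
    using assms(1) unfolding alt_space_def by blast
  from this[rule_format, of "[v]" 0 v w t] assms(2,3) show ?thesis by simp
qed

lemma covector_vec_0: "a \<in> cotangent_space A p \<Longrightarrow> a [0] = 0"
  using covector_linear[of a p 0 0 1] tangent_space_0 by simp

lemma covector_vec_sum:
  assumes "a \<in> cotangent_space A p"
  shows "(\<And>i. i \<in> I \<Longrightarrow> v i \<in> tangent_space A p) \<Longrightarrow> a [\<Sum>i\<in>I. t i *\<^sub>R v i] = (\<Sum>i\<in>I. t i * a [v i])"
  by (induction I rule: infinite_finite_induct)
    (auto simp: covector_vec_0[OF assms] covector_linear[OF assms] tangent_space_sum tangent_space_scaleR)

lemma covector_eqI:
  assumes "a \<in> cotangent_space A p" "b \<in> cotangent_space A p"
    "\<And>v. v \<in> tangent_space A p \<Longrightarrow> a [v] = b [v]"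
  shows "a = b"
proof
  fix vs show "a vs = b vs"
    using covector_apply_0[OF assms(1), of vs] covector_apply_0[OF assms(2), of vs] assms(3) by metis
qed

lemma diff_fun_eq: "diff_fun A f p vs = (if \<exists>v\<in>tangent_space A p. vs = [v] then hd vs f else 0)"
proof -
  consider "\<not> set vs \<subseteq> tangent_space A p" | "vs = []" | v where "vs = [v]" "v \<in> tangent_space A p"
    | "set vs \<subseteq> tangent_space A p" "length vs \<ge> 2"
    by (cases vs rule: remdups_adj.cases) auto
  then show ?thesis
  proof cases
    \<comment> \<open>Omitting one of at least two arguments leaves a nonempty list, on which
      \<open>fun_form\<close> is 0, and a derivation of the zero function is 0.\<close>
    case 4
    have "(vs ! i) (\<lambda>q. fun_form f q (map (\<lambda>v. const_ext A p v q) (take i vs @ drop (Suc i) vs))) = 0"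
      if "i < length vs" for i
    proof -
      have "vs ! i \<in> tangent_space A p" using 4 that by (meson nth_mem subsetD)
      moreover have "take i vs @ drop (Suc i) vs \<noteq> []" using 4(2) that by auto
      ultimately show ?thesis using tangent_const by (auto simp: fun_form_def)
    qed
    then show ?thesis using 4 by (auto simp: ext_d_def)
  qed (auto simp: ext_d_def fun_form_def)
qed

lemma diff_fun_apply: "v \<in> tangent_space A p \<Longrightarrow> diff_fun A f p [v] = v f"
  by (simp add: diff_fun_eq)

lemma cotangentI:
  assumes "\<And>vs. \<not> (\<exists>v\<in>tangent_space A p. vs = [v]) \<Longrightarrow> a vs = 0"
    "\<And>v w t. v \<in> tangent_space A p \<Longrightarrow> w \<in> tangent_space A p \<Longrightarrow> a [t *\<^sub>R v + w] = t * a [v] + a [w]"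
  shows "a \<in> cotangent_space A p"
  unfolding alt_space_def
proof (intro CollectI conjI allI impI)
  fix vs :: "'a tvec list" assume "\<not> (length vs = 1 \<and> set vs \<subseteq> tangent_space A p)"
  then show "a vs = 0" by (intro assms(1)) auto
next
  fix vs :: "'a tvec list" and i v w t assume "length vs = 1" "i < (1::nat)" "v \<in> tangent_space A p" "w \<in> tangent_space A p"
  then show "a (vs[i := t *\<^sub>R v + w]) = t * a (vs[i := v]) + a (vs[i := w])"
    using assms(2) by (auto simp: length_Suc_conv One_nat_def)
next
  fix vs :: "'a tvec list" and i j assume "i < j" "j < length vs" "vs ! i = vs ! j"
  then show "a vs = 0" by (intro assms(1)) auto
qed

lemma diff_fun_cotangent: "diff_fun A f p \<in> cotangent_space A p"
  by (rule cotangentI)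
    (auto simp: diff_fun_eq tangent_space_add tangent_space_scaleR, simp add: scaleR_fun_def)

lemma diff_fun_cong: "\<forall>\<^sub>F q in nhds p. f q = g q \<Longrightarrow> diff_fun A f p = diff_fun A g p"
  by (intro covector_eqI[OF diff_fun_cotangent diff_fun_cotangent])
    (auto simp: diff_fun_apply intro: tangent_cong)

lemma covector_expansion:
  assumes c: "smooth_chart A c" and p: "p \<in> fst c" and a: "a \<in> cotangent_space A p"
  shows "a = (\<Sum>e\<in>Basis. a [chart_vec A c e p] *\<^sub>R diff_fun A (\<lambda>q. snd c q \<bullet> e) p)"
proof (rule covector_eqI[OF a])
  show "(\<Sum>e\<in>Basis. a [chart_vec A c e p] *\<^sub>R diff_fun A (\<lambda>q. snd c q \<bullet> e) p) \<in> cotangent_space A p"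
    by (intro alt_space_sum alt_space_scaleR diff_fun_cotangent)
  fix v assume v: "v \<in> tangent_space A p"
  have "v = (\<Sum>e\<in>Basis. v (\<lambda>q. snd c q \<bullet> e) *\<^sub>R chart_vec A c e p)"
  proof
    fix f
    show "v f = (\<Sum>e\<in>Basis. v (\<lambda>q. snd c q \<bullet> e) *\<^sub>R chart_vec A c e p) f"
      using fun_cong[OF chart_vec_components[OF c p v], of f]
        chart_vec_sum[OF c, of "\<lambda>e. v (\<lambda>q. snd c q \<bullet> e)" "\<lambda>e. e" Basis p f]
      by (simp add: sum_fun_apply scaleR_fun_def)
  qed
  then have "a [v] = a [\<Sum>e\<in>Basis. v (\<lambda>q. snd c q \<bullet> e) *\<^sub>R chart_vec A c e p]" by simp
  also have "\<dots> = (\<Sum>e\<in>Basis. v (\<lambda>q. snd c q \<bullet> e) * a [chart_vec A c e p])"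
    by (rule covector_vec_sum[OF a chart_vec_tangent[OF c]])
  finally show "a [v] = (\<Sum>e\<in>Basis. a [chart_vec A c e p] *\<^sub>R diff_fun A (\<lambda>q. snd c q \<bullet> e) p) [v]"
    by (simp add: sum_fun_apply scaleR_fun_def diff_fun_apply[OF v] mult.commute)
qed

lemma smooth_form_cotangent: "smooth_form_on A V 1 \<alpha> \<Longrightarrow> q \<in> V \<Longrightarrow> \<alpha> q \<in> cotangent_space A q"
  by (simp add: smooth_form_on_def)

lemma smooth_form_eval:
  assumes "smooth_form_on A V 1 \<alpha>" "open W" "W \<subseteq> V" "smooth_vfield_on A W X"
  shows "smooth_fun_on A W (\<lambda>q. \<alpha> q [X q])"
proof -
  have "\<forall>V' Xs. open V' \<longrightarrow> V' \<subseteq> V \<longrightarrow> length Xs = 1 \<longrightarrow> (\<forall>X\<in>set Xs. smooth_vfield_on A V' X) \<longrightarrow>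
        smooth_fun_on A V' (\<lambda>q. \<alpha> q (map (\<lambda>X. X q) Xs))"
    using assms(1) unfolding smooth_form_on_def by blast
  from this[rule_format, of W "[X]"] assms show ?thesis by simp
qed

lemma smooth_form1I:
  assumes "\<And>q. q \<in> V \<Longrightarrow> \<alpha> q \<in> cotangent_space A q"
    "\<And>W X. open W \<Longrightarrow> W \<subseteq> V \<Longrightarrow> smooth_vfield_on A W X \<Longrightarrow> smooth_fun_on A W (\<lambda>q. \<alpha> q [X q])"
  shows "smooth_form_on A V 1 \<alpha>"
  unfolding smooth_form_on_def using assms by (auto simp: length_Suc_conv One_nat_def)

lemma smooth_form_subset:
  assumes "smooth_form_on A V k \<alpha>" "W \<subseteq> V" shows "smooth_form_on A W k \<alpha>"
  unfolding smooth_form_on_def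
proof (intro conjI ballI allI impI)
  fix q assume "q \<in> W" then show "\<alpha> q \<in> alt_space A q k"
    using assms by (auto simp: smooth_form_on_def)
next
  fix U Xs assume "open U" "U \<subseteq> W" "length Xs = k" "\<forall>X\<in>set Xs. smooth_vfield_on A U X"
  moreover from this have "U \<subseteq> V" using assms(2) by blast
  ultimately show "smooth_fun_on A U (\<lambda>q. \<alpha> q (map (\<lambda>X. X q) Xs))"
    using assms(1) unfolding smooth_form_on_def by blast
qed

lemma smooth_form_add:
  assumes "smooth_form_on A V k \<alpha>" "smooth_form_on A V k \<beta>" shows "smooth_form_on A V k (\<alpha> + \<beta>)"
  using assms unfolding smooth_form_on_def by (auto intro!: alt_space_add smooth_fun_on_add)

lemma smooth_form_fmul:
  assumes "smooth_fun_on A V f" "smooth_form_on A V k \<alpha>" shows "smooth_form_on A V k (fmul f \<alpha>)"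
  unfolding smooth_form_on_def
proof (intro conjI ballI allI impI)
  fix q assume "q \<in> V" then show "fmul f \<alpha> q \<in> alt_space A q k"
    using assms(2) by (simp add: fmul_def alt_space_scaleR smooth_form_on_def)
next
  fix W Xs assume "open W" "W \<subseteq> V" "length Xs = k" "\<forall>X\<in>set Xs. smooth_vfield_on A W X"
  then have "smooth_fun_on A W (\<lambda>q. f q * \<alpha> q (map (\<lambda>X. X q) Xs))"
    using assms(2) smooth_fun_on_subset[OF assms(1)] unfolding smooth_form_on_def
    by (intro smooth_fun_on_mult) auto
  then show "smooth_fun_on A W (\<lambda>q. fmul f \<alpha> q (map (\<lambda>X. X q) Xs))"
    by (simp add: fmul_def scaleR_fun_def)
qed

lemma smooth_form_0: "smooth_form_on A V k 0"
  unfolding smooth_form_on_def by (auto intro: alt_space_0 smooth_fun_on_const)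

lemma smooth_form_sum:
  "(\<And>i. i \<in> I \<Longrightarrow> smooth_form_on A V k (\<alpha> i)) \<Longrightarrow> smooth_form_on A V k (\<Sum>i\<in>I. \<alpha> i)"
  by (induction I rule: infinite_finite_induct) (auto simp: smooth_form_0 smooth_form_add)

lemma smooth_form_diff_fun:
  assumes "smooth_fun_on A V f" shows "smooth_form_on A V 1 (diff_fun A f)"
proof (rule smooth_form1I[OF diff_fun_cotangent])
  fix W X assume W: "open W" "W \<subseteq> V" and X: "smooth_vfield_on A W X"
  have "smooth_fun_on A W (\<lambda>q. X q f)"
    using X W(1) smooth_fun_on_subset[OF assms W(2)] unfolding smooth_vfield_on_def by blast
  then show "smooth_fun_on A W (\<lambda>q. diff_fun A f q [X q])"
    by (rule smooth_fun_on_cong[OF W(1)]) (use X in \<open>auto simp: diff_fun_apply smooth_vfield_on_def\<close>)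
qed

lemma smooth_form_wedge:
  assumes a: "smooth_form_on A V 1 \<alpha>" and b: "smooth_form_on A V 1 \<beta>"
  shows "smooth_form_on A V 2 (wedge \<alpha> \<beta>)"
  unfolding smooth_form_on_def
proof (intro conjI ballI allI impI)
  note c = smooth_form_cotangent[OF a] smooth_form_cotangent[OF b]
  fix q assume "q \<in> V" then show "wedge \<alpha> \<beta> q \<in> alt_space A q 2"
    unfolding wedge_def using alt_wedge_alt_space c by blast
next
  note c = smooth_form_cotangent[OF a] smooth_form_cotangent[OF b]
  fix W and Xs :: "('a \<Rightarrow> 'a tvec) list"
  assume h: "open W" "W \<subseteq> V" "length Xs = 2" "\<forall>X\<in>set Xs. smooth_vfield_on A W X"
  obtain X Y where Xs: "Xs = [X, Y]" using h(3) by (auto simp: length_Suc_conv numeral_2_eq_2)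
  have "smooth_fun_on A W (\<lambda>q. \<alpha> q [X q] * \<beta> q [Y q] - \<alpha> q [Y q] * \<beta> q [X q])"
    using h(4) Xs by (intro smooth_fun_on_diff smooth_fun_on_mult smooth_form_eval[OF a h(1,2)]
        smooth_form_eval[OF b h(1,2)]) auto
  then show "smooth_fun_on A W (\<lambda>q. wedge \<alpha> \<beta> q (map (\<lambda>X. X q) Xs))"
  proof (rule smooth_fun_on_cong[OF h(1)])
    fix q assume "q \<in> W"
    then have "q \<in> V" using h(2) by auto
    then show "\<alpha> q [X q] * \<beta> q [Y q] - \<alpha> q [Y q] * \<beta> q [X q] = wedge \<alpha> \<beta> q (map (\<lambda>X. X q) Xs)"
      by (simp add: wedge_def Xs alt_wedge_covectors[OF c])
  qed
qed

lemma smooth_form_fun_form: "smooth_fun_on A V f \<Longrightarrow> smooth_form_on A V 0 (fun_form f)"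
  unfolding smooth_form_on_def alt_space_def fun_form_def
  by (auto intro: smooth_fun_on_subset)

lemmas Omega_iff = mem_Collect_eq[of _ "\<lambda>\<omega>. smooth_form_on A UNIV k \<omega>" for k, folded Omega_def]

lemma Omega_sum: "(\<And>i. i \<in> I \<Longrightarrow> \<alpha> i \<in> Omega A k) \<Longrightarrow> (\<Sum>i\<in>I. \<alpha> i) \<in> Omega A k"
  by (simp add: Omega_iff smooth_form_sum)

lemma Omega_0: "0 \<in> Omega A k"
  by (simp add: Omega_iff smooth_form_0)

lemma Omega_fmul: "smooth_fun_on A UNIV f \<Longrightarrow> \<alpha> \<in> Omega A k \<Longrightarrow> fmul f \<alpha> \<in> Omega A k"
  by (simp add: Omega_iff smooth_form_fmul)

lemma Omega_diff_fun: "smooth_fun_on A UNIV f \<Longrightarrow> diff_fun A f \<in> Omega A 1"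
  unfolding Omega_iff by (rule smooth_form_diff_fun)

lemma Omega_fun_form: "smooth_fun_on A UNIV f \<Longrightarrow> fun_form f \<in> Omega A 0"
  by (simp add: Omega_iff smooth_form_fun_form)

lemma Omega_wedge: "\<alpha> \<in> Omega A 1 \<Longrightarrow> \<beta> \<in> Omega A 1 \<Longrightarrow> wedge \<alpha> \<beta> \<in> Omega A 2"
  unfolding Omega_iff by (rule smooth_form_wedge)

lemma Omega_cotangent: "\<alpha> \<in> Omega A 1 \<Longrightarrow> \<alpha> p \<in> cotangent_space A p"
  unfolding Omega_iff by (rule smooth_form_cotangent) auto

lemma Omega_alt_space: "\<alpha> \<in> Omega A k \<Longrightarrow> \<alpha> p \<in> alt_space A p k"
  by (simp add: Omega_iff smooth_form_on_def)

text \<open>Bilinearity of the bracket is postulated on inhomogeneous forms; homogeneous forms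
  access it through this inclusion.\<close>

lemma Omega_imp_Omega_all:
  assumes "\<alpha> \<in> Omega A k" shows "\<alpha> \<in> Omega_all A"
  unfolding Omega_all_def
proof (intro CollectI allI)
  fix j
  have z: "\<alpha> p vs = 0" if "length vs \<noteq> k" for p vs
    using Omega_alt_space[OF assms, of p] that by (auto simp: alt_space_def)
  show "(\<lambda>p vs. if length vs = j then \<alpha> p vs else 0) \<in> Omega A j"
  proof (cases "j = k")
    case True
    then have "(\<lambda>p vs. if length vs = j then \<alpha> p vs else 0) = \<alpha>" using z by (auto simp: fun_eq_iff)
    then show ?thesis using assms True by simp
  next
    case False
    then have "(\<lambda>p vs. if length vs = j then \<alpha> p vs else 0) = 0" using z by (auto simp: fun_eq_iff)
    then show ?thesis using Omega_0 by simp
  qed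
qed

section \<open>The exterior derivative of functions and 1-forms\<close>

lemma const_ext_chart:
  obtains c where "smooth_chart A c" "p \<in> fst c"
    "\<And>v. const_ext A p v = chart_vec A c (\<Sum>e\<in>Basis. v (\<lambda>z. snd c z \<bullet> e) *\<^sub>R e)"
proof -
  let ?c = "SOME c. c \<in> A \<and> p \<in> fst c"
  have "?c \<in> A \<and> p \<in> fst ?c" by (rule someI_ex) (metis atlas_cover)
  then show ?thesis using that[of ?c] atlas_chart by (simp add: const_ext_def Let_def)
qed

lemma const_ext_at: "v \<in> tangent_space A p \<Longrightarrow> const_ext A p v p = v"
  by (rule const_ext_chart[of p]) (simp add: chart_vec_components)

lemma smooth_at_form_const_ext:
  assumes "\<alpha> \<in> Omega A 1" shows "smooth_at A p (\<lambda>q. \<alpha> q [const_ext A p v q])"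
proof (rule const_ext_chart[of p])
  fix c assume c: "smooth_chart A c" "p \<in> fst c"
    "\<And>v. const_ext A p v = chart_vec A c (\<Sum>e\<in>Basis. v (\<lambda>z. snd c z \<bullet> e) *\<^sub>R e)"
  show ?thesis
    using assms unfolding c(3) Omega_iff
    by (intro smooth_atI[OF smooth_chart_open(1)[OF c(1)] c(2)]
        smooth_form_eval[OF _ smooth_chart_open(1)[OF c(1)]] smooth_vfield_on_chart_vec c(1)) auto
qed

lemma const_ext_tangent: "const_ext A p v q \<in> tangent_space A q"
  by (rule const_ext_chart[of p]) (simp add: chart_vec_tangent)

lemma ext_d_1form:
  assumes a: "\<And>q. \<alpha> q \<in> cotangent_space A q"
  shows "ext_d A \<alpha> p vs = (if length vs = 2 \<and> set vs \<subseteq> tangent_space A p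
    then (vs ! 0) (\<lambda>q. \<alpha> q [const_ext A p (vs ! 1) q]) - (vs ! 1) (\<lambda>q. \<alpha> q [const_ext A p (vs ! 0) q]) else 0)"
proof (cases "set vs \<subseteq> tangent_space A p")
  case True
  show ?thesis
  proof (cases "length vs = 2")
    case False
    have "(vs ! i) (\<lambda>q. \<alpha> q (map (\<lambda>v. const_ext A p v q) (take i vs @ drop (Suc i) vs))) = 0"
      if "i < length vs" for i
    proof -
      have "length (take i vs @ drop (Suc i) vs) \<noteq> 1" using False that by auto
      then have "\<alpha> q (map (\<lambda>v. const_ext A p v q) (take i vs @ drop (Suc i) vs)) = 0" for q
        by (intro covector_apply_0[OF a]) (auto simp del: map_append length_append dest!: arg_cong[where f = length])
      moreover have "vs ! i \<in> tangent_space A p" using True that by (meson nth_mem subsetD)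
      ultimately show ?thesis using tangent_const by simp
    qed
    then show ?thesis using False True by (simp add: ext_d_def)
  next
    case 2: True
    then obtain v w where vs: "vs = [v, w]" by (auto simp: length_Suc_conv numeral_2_eq_2)
    show ?thesis using True by (simp add: ext_d_def vs numeral_2_eq_2)
  qed
qed (simp add: ext_d_def)

text \<open>\<open>ext_d\<close> at \<open>p\<close> is assembled from derivations at
  \<open>p\<close>, and these see germs only.\<close>

lemma ext_d_cong:
  assumes "\<forall>\<^sub>F q in nhds p. \<alpha> q = \<beta> q" shows "ext_d A \<alpha> p = ext_d A \<beta> p"
proof
  fix vs
  have "(vs ! i) (\<lambda>q. \<alpha> q (map (\<lambda>v. const_ext A p v q) us)) = (vs ! i) (\<lambda>q. \<beta> q (map (\<lambda>v. const_ext A p v q) us))"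
    if "set vs \<subseteq> tangent_space A p" "i < length vs" for i us
    by (rule tangent_cong[of _ p]) (use assms that in \<open>auto elim: eventually_mono\<close>)
  then show "ext_d A \<alpha> p vs = ext_d A \<beta> p vs"
    unfolding ext_d_def by (auto intro!: sum.cong simp del: map_append)
qed

lemma ext_d_0: "ext_d A 0 = 0"
proof (intro ext)
  fix p vs show "ext_d A 0 p vs = (0 :: 'a form) p vs"
    by (subst ext_d_1form) (auto simp: alt_space_0 tangent_const length_Suc_conv numeral_2_eq_2)
qed

lemma ext_d_add:
  assumes a: "\<alpha> \<in> Omega A 1" and b: "\<beta> \<in> Omega A 1"
  shows "ext_d A (\<alpha> + \<beta>) = ext_d A \<alpha> + ext_d A \<beta>"
proof (intro ext)
  fix p vs
  note c = Omega_cotangent[OF a] Omega_cotangent[OF b]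
  have c': "(\<alpha> + \<beta>) q \<in> cotangent_space A q" for q
    unfolding plus_fun_apply[of \<alpha> \<beta> q] by (rule alt_space_add[OF c])
  show "ext_d A (\<alpha> + \<beta>) p vs = (ext_d A \<alpha> + ext_d A \<beta>) p vs"
  proof (cases "length vs = 2 \<and> set vs \<subseteq> tangent_space A p")
    case True
    then obtain v u where vs: "vs = [v, u]" by (auto simp: length_Suc_conv numeral_2_eq_2)
    with True have t: "v \<in> tangent_space A p" "u \<in> tangent_space A p" by auto
    show ?thesis
      using t by (simp add: ext_d_1form[OF c'] ext_d_1form[OF c(1)] ext_d_1form[OF c(2)] vs)
        (simp add: tangent_add[OF t(1)] tangent_add[OF t(2)] smooth_at_form_const_ext a b)
  qed (auto simp: ext_d_1form[OF c'] ext_d_1form[OF c(1)] ext_d_1form[OF c(2)])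
qed

lemma ext_d_sum:
  "(\<And>i. i \<in> I \<Longrightarrow> \<alpha> i \<in> Omega A 1) \<Longrightarrow> ext_d A (\<Sum>i\<in>I. \<alpha> i) = (\<Sum>i\<in>I. ext_d A (\<alpha> i))"
  by (induction I rule: infinite_finite_induct) (auto simp: ext_d_0 ext_d_add Omega_sum)

lemma ext_d_fmul:
  assumes f: "smooth_fun_on A UNIV f" and a: "\<alpha> \<in> Omega A 1"
  shows "ext_d A (fmul f \<alpha>) = wedge (diff_fun A f) \<alpha> + fmul f (ext_d A \<alpha>)"
proof (intro ext)
  fix p and vs :: "'a tvec list"
  note c = Omega_cotangent[OF a]
  have c': "fmul f \<alpha> q \<in> cotangent_space A q" for q by (simp add: fmul_def alt_space_scaleR c)
  have sf: "smooth_at A p f" using smooth_atI[OF open_UNIV UNIV_I f] .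
  have w: "wedge (diff_fun A f) \<alpha> p \<in> alt_space A p 2"
    unfolding wedge_def by (rule alt_wedge_alt_space[OF diff_fun_cotangent c])
  show "ext_d A (fmul f \<alpha>) p vs = (wedge (diff_fun A f) \<alpha> + fmul f (ext_d A \<alpha>)) p vs"
  proof (cases "length vs = 2 \<and> set vs \<subseteq> tangent_space A p")
    case True
    then obtain v u where vs: "vs = [v, u]" by (auto simp: length_Suc_conv numeral_2_eq_2)
    with True have t: "v \<in> tangent_space A p" "u \<in> tangent_space A p" by auto
    show ?thesis
      using t by (simp add: ext_d_1form[OF c'] ext_d_1form[OF c] vs)
        (simp add: fmul_def scaleR_fun_def tangent_mult[OF t(1)] tangent_mult[OF t(2)] sf smooth_at_form_const_ext a
          const_ext_at wedge_def alt_wedge_covectors[OF diff_fun_cotangent c] diff_fun_apply ext_d_1form[OF c] algebra_simps)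
  next
    case False
    then have "wedge (diff_fun A f) \<alpha> p vs = 0" using w by (simp add: alt_space_def)
    moreover have "ext_d A (fmul f \<alpha>) p vs = 0" "ext_d A \<alpha> p vs = 0"
      using False by (auto simp only: ext_d_1form[OF c'] ext_d_1form[OF c] if_False)
    ultimately show ?thesis by (simp add: fmul_def scaleR_fun_def)
  qed
qed

text \<open>All extensions \<open>const_ext A p v\<close> use the same chart around
  \<open>p\<close>, so \<open>chart_vec_commute\<close> cancels the two terms.\<close>

lemma ext_d_diff_fun:
  assumes f: "smooth_fun_on A UNIV f" shows "ext_d A (diff_fun A f) = 0"
proof (intro ext)
  fix p and vs :: "'a tvec list"
  have "v (\<lambda>q. diff_fun A f q [const_ext A p w q]) = w (\<lambda>q. diff_fun A f q [const_ext A p v q])"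
    if vw: "v \<in> tangent_space A p" "w \<in> tangent_space A p" for v w
  proof (rule const_ext_chart[of p])
    fix c assume c: "smooth_chart A c" "p \<in> fst c"
      "\<And>v. const_ext A p v = chart_vec A c (\<Sum>e\<in>Basis. v (\<lambda>z. snd c z \<bullet> e) *\<^sub>R e)"
    have "v (\<lambda>q. const_ext A p w q f) = const_ext A p v p (\<lambda>q. const_ext A p w q f)"
      by (simp add: const_ext_at[OF vw(1)])
    also have "\<dots> = const_ext A p w p (\<lambda>q. const_ext A p v q f)"
      unfolding c(3) by (rule chart_vec_commute[OF c(1,2) open_UNIV UNIV_I f])
    also have "\<dots> = w (\<lambda>q. const_ext A p v q f)" by (simp add: const_ext_at[OF vw(2)])
    finally show ?thesis by (simp add: diff_fun_apply[OF const_ext_tangent])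
  qed
  then show "ext_d A (diff_fun A f) p vs = (0 :: 'a form) p vs"
    by (auto simp: ext_d_1form[OF diff_fun_cotangent] length_Suc_conv numeral_2_eq_2)
qed

end

text \<open>A form is a function of the point and then of a list of vectors. Unfolding pointwise
  operations all the way would break up equations between alternating forms at a point; the rules
  \<open>form_apply\<close> go down one level only.\<close>

declare plus_fun_apply [simp del] zero_fun_apply [simp del] minus_apply [simp del] uminus_apply [simp del]

lemma form_plus: "(\<alpha> + \<beta>) p = \<alpha> p + \<beta> p" for \<alpha> \<beta> :: "'a form"
  by (rule plus_fun_apply)

lemma form_zero: "(0 :: 'a form) p = 0"
  by (rule zero_fun_apply)

lemma form_sum: "(\<Sum>i\<in>I. \<alpha> i) p = (\<Sum>i\<in>I. \<alpha> i p)" for \<alpha> :: "'i \<Rightarrow> 'a form"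
  by (induction I rule: infinite_finite_induct) (simp_all add: form_plus form_zero)

lemma form_uminus: "(- \<alpha>) p = - \<alpha> p" for \<alpha> :: "'a form"
  by (rule uminus_apply)

lemma form_minus: "(\<alpha> - \<beta>) p = \<alpha> p - \<beta> p" for \<alpha> \<beta> :: "'a form"
  by (rule minus_apply)

lemma form_scaleR: "(t *\<^sub>R \<alpha>) p = t *\<^sub>R \<alpha> p" for \<alpha> :: "'a form"
  by (simp add: scaleR_fun_def)

lemmas form_apply = form_plus form_zero form_sum form_uminus form_minus form_scaleR

lemma fmul_apply: "fmul f \<alpha> p = f p *\<^sub>R \<alpha> p"
  by (simp add: fmul_def)

lemma fmul_0: "fmul f 0 = 0"
  by (rule ext) (simp add: fmul_apply form_zero)

lemma wedge_apply: "wedge \<alpha> \<beta> p = alt_wedge (\<alpha> p) (\<beta> p)"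
  by (simp add: wedge_def)

text \<open>Diagonal terms vanish since \<open>w i i\<close> equals its own negative, and reflecting
  the lower triangle onto the upper one yields the sign. Double sums of wedges thus become sums over
  i < j.\<close>

lemma sum_antisymmetric:
  fixes w :: "nat \<Rightarrow> nat \<Rightarrow> 'v::real_vector"
  assumes "\<And>i j. i \<in> {1..n} \<Longrightarrow> j \<in> {1..n} \<Longrightarrow> w j i = - w i j"
  shows "(\<Sum>i=1..n. \<Sum>j=1..n. s i j *\<^sub>R w i j) = (\<Sum>i=1..n. \<Sum>j\<in>{i<..n}. (s i j - s j i) *\<^sub>R w i j)"
proof -
  let ?I = "{1..n} \<times> {1..n}"
  let ?f = "\<lambda>(i, j). s i j *\<^sub>R w i j"
  let ?L = "{(i, j). (i, j) \<in> ?I \<and> i < j}" and ?G = "{(i, j). (i, j) \<in> ?I \<and> j < i}" and ?E = "{(i, j). (i, j) \<in> ?I \<and> i = j}"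
  have fin: "finite ?I" by simp
  then have f: "finite ?L" "finite ?G" "finite ?E" by - (rule finite_subset[OF _ fin], blast)+
  have "?I = ?L \<union> (?G \<union> ?E)" by auto
  then have "sum ?f ?I = sum ?f (?L \<union> (?G \<union> ?E))" by (rule arg_cong)
  also have "\<dots> = sum ?f ?L + sum ?f (?G \<union> ?E)"
    by (rule sum.union_disjoint) (use f in auto)
  also have "sum ?f (?G \<union> ?E) = sum ?f ?G + sum ?f ?E"
    by (rule sum.union_disjoint) (use f in auto)
  finally have "sum ?f ?I = sum ?f ?L + (sum ?f ?G + sum ?f ?E)" .
  have "sum ?f ?E = 0"
  proof (rule sum.neutral, safe)
    fix i assume "i \<in> {1..n}"
    from assms[OF this this] have "w i i + w i i = 0" unfolding eq_neg_iff_add_eq_0 .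
    then have "w i i = 0" by (simp add: scaleR_2[symmetric])
    then show "s i i *\<^sub>R w i i = 0" by simp
  qed
  have neg: "- (s i j *\<^sub>R w j i) = s i j *\<^sub>R w i j" if "1 \<le> i" "i \<le> n" "1 \<le> j" "j \<le> n" for i j
  proof -
    have "w j i = - w i j" using that by (intro assms) auto
    then show ?thesis by (simp only: scaleR_minus_right minus_minus)
  qed
  have "sum ?f ?G = (\<Sum>(i, j)\<in>?L. - s j i *\<^sub>R w i j)"
    by (rule sum.reindex_bij_witness[where i = "\<lambda>(i, j). (j, i)" and j = "\<lambda>(i, j). (j, i)"])
      (use neg in auto)
  moreover note \<open>sum ?f ?E = 0\<close> \<open>sum ?f ?I = sum ?f ?L + (sum ?f ?G + sum ?f ?E)\<close>
  ultimately have "sum ?f ?I = (\<Sum>(i, j)\<in>?L. (s i j - s j i) *\<^sub>R w i j)"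
    by (simp add: sum.distrib[symmetric] case_prod_unfold scaleR_diff_left)
  also have "?L = (SIGMA i:{1..n}. {i<..n})" by auto
  finally show ?thesis by (simp add: sum.Sigma sum.cartesian_product)
qed

context smooth_manifold
begin

lemma Omega_add: "\<alpha> \<in> Omega A k \<Longrightarrow> \<beta> \<in> Omega A k \<Longrightarrow> \<alpha> + \<beta> \<in> Omega A k"
  by (simp add: Omega_iff smooth_form_add)

lemma Omega_scaleR:
  assumes "\<alpha> \<in> Omega A k" shows "t *\<^sub>R \<alpha> \<in> Omega A k"
proof -
  have "t *\<^sub>R \<alpha> = fmul (\<lambda>_. t) \<alpha>" by (simp add: fmul_def scaleR_fun_def)
  then show ?thesis using Omega_fmul[OF smooth_fun_on_const assms] by simp
qed

lemma chart_frame_expansion: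
  assumes c: "smooth_chart A c" and b: "bij_betw b {1..n + m} Basis" and p: "p \<in> fst c"
    and \<alpha>: "\<alpha> \<in> cotangent_space A p"
  shows "\<alpha> = (\<Sum>l=1..n. \<alpha> [coord_vec A c b l p] *\<^sub>R coord_d A c b l p)
    + (\<Sum>u=1..m. \<alpha> [coord_vec A c b (n + u) p] *\<^sub>R coord_d A c b (n + u) p)"
proof -
  have "\<alpha> = (\<Sum>e\<in>Basis. \<alpha> [chart_vec A c e p] *\<^sub>R diff_fun A (\<lambda>q. snd c q \<bullet> e) p)"
    by (rule covector_expansion[OF c p \<alpha>])
  also have "\<dots> = (\<Sum>k\<in>{1..n + m}. \<alpha> [coord_vec A c b k p] *\<^sub>R coord_d A c b k p)"
    unfolding coord_def by (rule sum.reindex_bij_betw[OF b, symmetric])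
  also have "{1..n + m} = {1..n} \<union> {1 + n..m + n}" by auto
  also have "(\<Sum>k\<in>{1..n} \<union> {1 + n..m + n}. \<alpha> [coord_vec A c b k p] *\<^sub>R coord_d A c b k p) =
    (\<Sum>l=1..n. \<alpha> [coord_vec A c b l p] *\<^sub>R coord_d A c b l p)
    + (\<Sum>k=1 + n..m + n. \<alpha> [coord_vec A c b k p] *\<^sub>R coord_d A c b k p)"
    by (rule sum.union_disjoint) auto
  also have "(\<Sum>k=1 + n..m + n. \<alpha> [coord_vec A c b k p] *\<^sub>R coord_d A c b k p) =
      (\<Sum>u=1..m. \<alpha> [coord_vec A c b (n + u) p] *\<^sub>R coord_d A c b (n + u) p)"
    unfolding sum.shift_bounds_cl_nat_ivl by (simp add: add.commute)
  finally show ?thesis .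
qed

lemma coord_vec_coord:
  assumes c: "smooth_chart A c" and b: "bij_betw b {1..N} Basis" and p: "p \<in> fst c"
    and "k \<in> {1..N}" "l \<in> {1..N}"
  shows "coord_vec A c b k p (coord c b l) = (if k = l then 1 else 0)"
proof -
  have "coord_vec A c b k p (coord c b l) = b k \<bullet> b l"
    unfolding coord_def by (rule chart_vec_inner[OF c p])
  moreover have "b k \<in> Basis" "b l \<in> Basis" using bij_betwE[OF b] assms(4,5) by blast+
  moreover have "b k = b l \<longleftrightarrow> k = l" using inj_on_eq_iff[OF bij_betw_imp_inj_on[OF b] assms(4,5)] .
  ultimately show ?thesis by (simp add: inner_Basis)
qed

lemma smooth_coord: "smooth_chart A c \<Longrightarrow> smooth_fun_on A (fst c) (coord c b k)"
  unfolding coord_def by (rule smooth_fun_on_chart_inner)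

end

section \<open>The Hawkins bracket\<close>

locale hawkins_manifold = smooth_manifold A
  for A :: "('a::t2_space, 'e::euclidean_space) atlas" +
  fixes \<pi> :: "'a bivector" and D br :: "'a form_op"
  assumes bivector: "smooth_bivector A \<pi>"
    and bracket: "hawkins_bracket A \<pi> D br"
begin

abbreviation pb :: "('a \<Rightarrow> real) \<Rightarrow> ('a \<Rightarrow> real) \<Rightarrow> 'a \<Rightarrow> real" where
  "pb \<equiv> poisson_bracket A \<pi>"

abbreviation d0 :: "('a \<Rightarrow> real) \<Rightarrow> 'a form" where
  "d0 \<equiv> \<lambda>f. diff_fun A f"

lemma pi_linear:
  assumes "a \<in> cotangent_space A p" "b \<in> cotangent_space A p" "a' \<in> cotangent_space A p"
  shows "\<pi> p (t *\<^sub>R a + a') b = t * \<pi> p a b + \<pi> p a' b"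
  using bivector assms unfolding smooth_bivector_def by blast

lemma pi_antisym:
  assumes "a \<in> cotangent_space A p" "b \<in> cotangent_space A p"
  shows "\<pi> p a b = - \<pi> p b a"
  using bivector assms unfolding smooth_bivector_def by blast

lemma pi_0: "b \<in> cotangent_space A p \<Longrightarrow> \<pi> p 0 b = 0"
  using pi_linear[of 0 p b 0 1] by (simp add: alt_space_0)

lemma pi_add:
  "a \<in> cotangent_space A p \<Longrightarrow> b \<in> cotangent_space A p \<Longrightarrow> a' \<in> cotangent_space A p \<Longrightarrow>
    \<pi> p (a + a') b = \<pi> p a b + \<pi> p a' b"
  using pi_linear[of a p b a' 1] by simp

lemma pi_sum:
  assumes "b \<in> cotangent_space A p"
  shows "(\<And>i. i \<in> I \<Longrightarrow> a i \<in> cotangent_space A p) \<Longrightarrow>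
    \<pi> p (\<Sum>i\<in>I. t i *\<^sub>R a i) b = (\<Sum>i\<in>I. t i * \<pi> p (a i) b)"
  by (induction I rule: infinite_finite_induct)
    (auto simp: pi_0[OF assms] pi_linear assms alt_space_sum alt_space_scaleR)

lemma smooth_pi:
  "open V \<Longrightarrow> smooth_form_on A V 1 \<alpha> \<Longrightarrow> smooth_form_on A V 1 \<beta> \<Longrightarrow>
    smooth_fun_on A V (\<lambda>q. \<pi> q (\<alpha> q) (\<beta> q))"
  using bivector unfolding smooth_bivector_def by blast

lemma smooth_pb: "smooth_fun_on A UNIV f \<Longrightarrow> smooth_fun_on A UNIV g \<Longrightarrow> smooth_fun_on A UNIV (pb f g)"
  unfolding poisson_bracket_def by (intro smooth_pi smooth_form_diff_fun) auto

lemma br_Omega: "\<sigma> \<in> Omega A k \<Longrightarrow> \<tau> \<in> Omega A l \<Longrightarrow> br \<sigma> \<tau> \<in> Omega A (k + l)"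
  using bracket unfolding hawkins_bracket_def by blast

lemma br_sym:
  "\<sigma> \<in> Omega A k \<Longrightarrow> \<tau> \<in> Omega A l \<Longrightarrow> br \<sigma> \<tau> = - ((- 1) ^ (k * l) *\<^sub>R br \<tau> \<sigma>)"
  using bracket unfolding hawkins_bracket_def by blast

lemma ext_d_br:
  "\<sigma> \<in> Omega A k \<Longrightarrow> \<tau> \<in> Omega A l \<Longrightarrow>
    ext_d A (br \<sigma> \<tau>) = br (ext_d A \<sigma>) \<tau> + (- 1) ^ k *\<^sub>R br \<sigma> (ext_d A \<tau>)"
  using bracket unfolding hawkins_bracket_def by blast

lemma br_wedge:
  "\<sigma> \<in> Omega A k \<Longrightarrow> \<tau> \<in> Omega A l \<Longrightarrow> \<rho> \<in> Omega A m \<Longrightarrow>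
    br \<sigma> (wedge \<tau> \<rho>) = wedge (br \<sigma> \<tau>) \<rho> + (- 1) ^ (k * l) *\<^sub>R wedge \<tau> (br \<sigma> \<rho>)"
  using bracket unfolding hawkins_bracket_def by blast

lemma br_fun_fun:
  assumes "smooth_fun_on A UNIV f" "smooth_fun_on A UNIV h"
  shows "br (fun_form f) (fun_form h) = fun_form (pb f h)"
proof -
  have "\<forall>f h. smooth_fun_on A UNIV f \<longrightarrow> smooth_fun_on A UNIV h \<longrightarrow>
      br (fun_form f) (fun_form h) = fun_form (\<lambda>p. \<pi> p (diff_fun A f p) (diff_fun A h p))"
    using bracket unfolding hawkins_bracket_def by (elim conjE) assumption
  then show ?thesis unfolding poisson_bracket_def using assms by simp
qed

lemma br_linear:
  assumes "\<tau> \<in> Omega A k" "\<sigma> \<in> Omega A l" "\<sigma>' \<in> Omega A l"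
  shows "br \<tau> (t *\<^sub>R \<sigma> + \<sigma>') = t *\<^sub>R br \<tau> \<sigma> + br \<tau> \<sigma>'"
  using conjunct1[OF bracket[unfolded hawkins_bracket_def], rule_format,
      OF assms(2,3,1)[THEN Omega_imp_Omega_all], THEN conjunct2] .

lemma br_fun_1form:
  assumes f: "smooth_fun_on A UNIV f" and b: "\<beta> \<in> Omega A 1"
  shows "br (fun_form f) \<beta> = D (diff_fun A f) \<beta>"
proof -
  have "\<exists>E. extends_to_forms A \<pi> D E \<and> (\<forall>f k. smooth_fun_on A UNIV f \<longrightarrow>
      (\<forall>\<sigma>\<in>Omega A k. br (fun_form f) \<sigma> = E (diff_fun A f) \<sigma>))"
    using bracket unfolding hawkins_bracket_def by (elim conjE) assumption
  then obtain E where E: "extends_to_forms A \<pi> D E"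
    "\<And>f k \<sigma>. smooth_fun_on A UNIV f \<Longrightarrow> \<sigma> \<in> Omega A k \<Longrightarrow> br (fun_form f) \<sigma> = E (diff_fun A f) \<sigma>"
    by blast
  have "E (diff_fun A f) \<beta> = D (diff_fun A f) \<beta>"
    using E(1) Omega_diff_fun[OF f] b unfolding extends_to_forms_def by blast
  then show ?thesis using E(2)[OF f b] by simp
qed

lemma br_add:
  "\<tau> \<in> Omega A k \<Longrightarrow> \<sigma> \<in> Omega A l \<Longrightarrow> \<sigma>' \<in> Omega A l \<Longrightarrow> br \<tau> (\<sigma> + \<sigma>') = br \<tau> \<sigma> + br \<tau> \<sigma>'"
  using br_linear[of \<tau> k \<sigma> l \<sigma>' 1] by simp

lemma br_0: "\<tau> \<in> Omega A k \<Longrightarrow> br \<tau> 0 = 0"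
  using br_add[of \<tau> k 0 0 0] by (simp add: Omega_0)

lemma br_sum:
  assumes "\<tau> \<in> Omega A k"
  shows "(\<And>i. i \<in> I \<Longrightarrow> \<sigma> i \<in> Omega A l) \<Longrightarrow> br \<tau> (\<Sum>i\<in>I. \<sigma> i) = (\<Sum>i\<in>I. br \<tau> (\<sigma> i))"
proof (induction I rule: infinite_finite_induct)
  case (insert i I)
  then have "br \<tau> (\<sigma> i + (\<Sum>i\<in>I. \<sigma> i)) = br \<tau> (\<sigma> i) + br \<tau> (\<Sum>i\<in>I. \<sigma> i)"
    by (intro br_add[OF assms] Omega_sum) auto
  then show ?case using insert by simp
qed (simp_all add: br_0[OF assms])

lemma br_fmul:
  assumes "\<sigma> \<in> Omega A k" "smooth_fun_on A UNIV g" "\<tau> \<in> Omega A l"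
  shows "br \<sigma> (fmul g \<tau>) = wedge (br \<sigma> (fun_form g)) \<tau> + fmul g (br \<sigma> \<tau>)"
  using br_wedge[OF assms(1) Omega_fun_form[OF assms(2)] assms(3)] by (simp add: wedge_fun_form)

lemma br_fun_fmul:
  assumes "smooth_fun_on A UNIV f" "smooth_fun_on A UNIV g" "\<tau> \<in> Omega A l"
  shows "br (fun_form f) (fmul g \<tau>) = fmul (pb f g) \<tau> + fmul g (br (fun_form f) \<tau>)"
  using br_fmul[OF Omega_fun_form[OF assms(1)] assms(2,3)] by (simp add: br_fun_fun assms wedge_fun_form)

text \<open>\<tau> = (1 - \<eta>) \<tau> everywhere, for a bump \<eta> supported where \<tau>
  vanishes. In the Leibniz rule for this product one term contains \<tau>(p) = 0 and the other 1 -
  \<eta>(p) = 0.\<close>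

lemma br_local_0:
  assumes s: "\<sigma> \<in> Omega A k" and t: "\<tau> \<in> Omega A l" and z: "\<forall>\<^sub>F q in nhds p. \<tau> q = 0"
  shows "br \<sigma> \<tau> p = 0"
proof -
  obtain W where W: "open W" "p \<in> W" "\<And>q. q \<in> W \<Longrightarrow> \<tau> q = 0"
    using z unfolding eventually_nhds by blast
  obtain \<eta> K where K: "closed K" "K \<subseteq> W" "smooth_fun_on A UNIV \<eta>" "\<And>q. q \<notin> K \<Longrightarrow> \<eta> q = 0"
    "\<forall>\<^sub>F q in nhds p. \<eta> q = 1" using bump_function[OF W(1,2)] by metis
  have "\<eta> p = 1" using eventually_nhds_x_imp_x[OF K(5)] .
  have s': "smooth_fun_on A UNIV (\<lambda>q. 1 - \<eta> q)"
    by (intro smooth_fun_on_diff smooth_fun_on_const K(3))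
  have "fmul (\<lambda>q. 1 - \<eta> q) \<tau> = \<tau>"
  proof
    fix q show "fmul (\<lambda>q. 1 - \<eta> q) \<tau> q = \<tau> q"
    proof (cases "q \<in> W")
      case False
      then have "q \<notin> K" using K(2) by blast
      then show ?thesis by (simp add: K(4) fmul_apply)
    qed (simp add: W(3) fmul_apply)
  qed
  then have "br \<sigma> \<tau> p = (wedge (br \<sigma> (fun_form (\<lambda>q. 1 - \<eta> q))) \<tau> + fmul (\<lambda>q. 1 - \<eta> q) (br \<sigma> \<tau>)) p"
    using br_fmul[OF s s' t] by simp
  then show ?thesis using W(2,3) \<open>\<eta> p = 1\<close>
    by (simp add: form_apply fmul_apply wedge_apply alt_wedge_0_right)
qed

lemma br_local:
  assumes s: "\<sigma> \<in> Omega A k" and t: "\<tau> \<in> Omega A l" "\<tau>' \<in> Omega A l"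
    and eq: "\<forall>\<^sub>F q in nhds p. \<tau> q = \<tau>' q"
  shows "br \<sigma> \<tau> p = br \<sigma> \<tau>' p"
proof -
  have "br \<sigma> ((- 1) *\<^sub>R \<tau>' + \<tau>) p = 0"
    by (rule br_local_0[OF s Omega_add[OF Omega_scaleR[OF t(2)] t(1)]])
      (use eq in eventually_elim, simp add: form_apply)
  then have "((- 1) *\<^sub>R br \<sigma> \<tau>' + br \<sigma> \<tau>) p = 0" by (simp only: br_linear[OF s t(2,1)])
  then show ?thesis by (simp add: form_apply)
qed

lemma br_local_0_left:
  assumes "\<sigma> \<in> Omega A k" "\<tau> \<in> Omega A l" "\<forall>\<^sub>F q in nhds p. \<sigma> q = 0"
  shows "br \<sigma> \<tau> p = 0"
  using br_local_0[OF assms(2,1,3)] by (subst br_sym[OF assms(1,2)]) (simp add: form_apply)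

text \<open>The definite description in \<open>anchor\<close> is legitimate: the vector with
  components \<pi>(\<xi>, dz_e) in a chart satisfies the equation by the expansion of \<beta>, and a
  tangent vector is determined by its pairings with differentials.\<close>

lemma anchor_properties:
  assumes \<xi>: "\<xi> \<in> cotangent_space A p"
  shows anchor_tangent: "anchor A \<pi> p \<xi> \<in> tangent_space A p"
    and anchor_pair: "\<And>\<beta>. \<beta> \<in> cotangent_space A p \<Longrightarrow> \<beta> [anchor A \<pi> p \<xi>] = \<pi> p \<xi> \<beta>"
    and anchor_eqI: "\<And>v. v \<in> tangent_space A p \<Longrightarrow> (\<And>\<beta>. \<beta> \<in> cotangent_space A p \<Longrightarrow> \<beta> [v] = \<pi> p \<xi> \<beta>) \<Longrightarrow>
      anchor A \<pi> p \<xi> = v"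
proof -
  obtain c where c: "c \<in> A" "p \<in> fst c" "smooth_chart A c" by (rule atlas_cover)
  let ?dz = "\<lambda>e. diff_fun A (\<lambda>q. snd c q \<bullet> e) p"
  define w where "w = (\<Sum>e\<in>Basis. \<pi> p \<xi> (?dz e) *\<^sub>R chart_vec A c e p)"
  have w: "w \<in> tangent_space A p"
    unfolding w_def by (intro tangent_space_sum tangent_space_scaleR chart_vec_tangent c)
  have pw: "\<beta> [w] = \<pi> p \<xi> \<beta>" if \<beta>: "\<beta> \<in> cotangent_space A p" for \<beta>
  proof -
    have "\<pi> p \<xi> \<beta> = - \<pi> p \<beta> \<xi>" by (rule pi_antisym[OF \<xi> \<beta>])
    also have "\<pi> p \<beta> \<xi> = (\<Sum>e\<in>Basis. \<beta> [chart_vec A c e p] * \<pi> p (?dz e) \<xi>)"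
      by (subst covector_expansion[OF c(3,2) \<beta>]) (rule pi_sum[OF \<xi> diff_fun_cotangent])
    also have "- \<dots> = (\<Sum>e\<in>Basis. \<pi> p \<xi> (?dz e) * \<beta> [chart_vec A c e p])"
      unfolding sum_negf[symmetric]
      by (intro sum.cong refl) (simp add: pi_antisym[OF \<xi> diff_fun_cotangent])
    also have "\<dots> = \<beta> [w]"
      unfolding w_def by (rule covector_vec_sum[OF \<beta> chart_vec_tangent[OF c(3)], symmetric])
    finally show ?thesis by simp
  qed
  have unique: "v = v'" if v: "v \<in> tangent_space A p" "v' \<in> tangent_space A p"
    and eq: "\<And>\<beta>. \<beta> \<in> cotangent_space A p \<Longrightarrow> \<beta> [v] = \<beta> [v']" for v v'
    using eq[OF diff_fun_cotangent] by (intro ext) (simp add: diff_fun_apply v)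
  have ex1: "\<exists>!v. v \<in> tangent_space A p \<and> (\<forall>\<beta>\<in>cotangent_space A p. \<beta> [v] = \<pi> p \<xi> \<beta>)"
    using w pw unique by (metis (no_types, lifting))
  from theI'[OF ex1] show "anchor A \<pi> p \<xi> \<in> tangent_space A p"
    "\<And>\<beta>. \<beta> \<in> cotangent_space A p \<Longrightarrow> \<beta> [anchor A \<pi> p \<xi>] = \<pi> p \<xi> \<beta>"
    unfolding anchor_def by blast+
  show "anchor A \<pi> p \<xi> = v" if "v \<in> tangent_space A p" "\<And>\<beta>. \<beta> \<in> cotangent_space A p \<Longrightarrow> \<beta> [v] = \<pi> p \<xi> \<beta>" for v
    unfolding anchor_def by (rule the1_equality[OF ex1]) (use that in blast)
qed

lemma anchor_linear:
  assumes "\<xi> \<in> cotangent_space A p" "\<xi>' \<in> cotangent_space A p"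
  shows "anchor A \<pi> p (t *\<^sub>R \<xi> + \<xi>') = t *\<^sub>R anchor A \<pi> p \<xi> + anchor A \<pi> p \<xi>'"
  by (rule anchor_eqI)
    (use assms in \<open>simp_all add: alt_space_add alt_space_scaleR tangent_space_add tangent_space_scaleR anchor_tangent
      covector_linear anchor_pair pi_linear\<close>)

lemma anchor_ker_pair:
  "\<xi> \<in> anchor_ker A \<pi> p \<Longrightarrow> \<beta> \<in> cotangent_space A p \<Longrightarrow> \<pi> p \<xi> \<beta> = 0"
  using anchor_pair[of \<xi> p \<beta>] by (simp add: anchor_ker_def covector_vec_0)

text \<open>Changing a covector by an element of the kernel does not change its anchor, so every
  vector in the image is already attained on \<open>H p\<close>, where \<open>inv_into\<close> then
  behaves as an inverse.\<close>

lemma varpi: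
  assumes "{a + b | a b. a \<in> anchor_ker A \<pi> p \<and> b \<in> H p} = cotangent_space A p" "H p \<subseteq> cotangent_space A p"
    and v: "v \<in> TS A \<pi> p"
  shows "varpi A \<pi> H p v \<in> H p" "anchor A \<pi> p (varpi A \<pi> H p v) = v"
proof -
  obtain \<xi> where \<xi>: "\<xi> \<in> cotangent_space A p" "v = anchor A \<pi> p \<xi>" using v by (auto simp: TS_def)
  then obtain a b where ab: "\<xi> = a + b" "a \<in> anchor_ker A \<pi> p" "b \<in> H p" using assms(1) by blast
  have "v = anchor A \<pi> p b"
    using anchor_linear[of a p b 1] ab assms(2) \<xi> by (auto simp: anchor_ker_def)
  then have "v \<in> anchor A \<pi> p ` H p" using ab(3) by blast
  then show "varpi A \<pi> H p v \<in> H p" "anchor A \<pi> p (varpi A \<pi> H p v) = v"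
    by (auto simp: varpi_def inv_into_into f_inv_into_f)
qed

text \<open>Linearity over functions in the first argument, applied to the difference of the two
  forms multiplied by 1 - \<eta>. Locality in the second argument is obtained through the bracket
  instead.\<close>

lemma connection_local_left:
  assumes conn: "contravariant_connection A \<pi> D"
    and O: "\<alpha> \<in> Omega A 1" "\<alpha>' \<in> Omega A 1" "\<beta> \<in> Omega A 1"
    and eq: "\<forall>\<^sub>F q in nhds p. \<alpha> q = \<alpha>' q"
  shows "D \<alpha> \<beta> p = D \<alpha>' \<beta> p"
proof -
  have lin: "D ((- 1) *\<^sub>R \<alpha>' + \<alpha>) \<beta> = (- 1) *\<^sub>R D \<alpha>' \<beta> + D \<alpha> \<beta>"
    using conn O unfolding contravariant_connection_def by blast
  obtain W where W: "open W" "p \<in> W" "\<And>q. q \<in> W \<Longrightarrow> \<alpha> q = \<alpha>' q"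
    using eq unfolding eventually_nhds by blast
  obtain \<eta> K where K: "closed K" "K \<subseteq> W" "smooth_fun_on A UNIV \<eta>" "\<And>q. q \<notin> K \<Longrightarrow> \<eta> q = 0"
    "\<forall>\<^sub>F q in nhds p. \<eta> q = 1" using bump_function[OF W(1,2)] by metis
  have \<eta>: "\<eta> p = 1" using eventually_nhds_x_imp_x[OF K(5)] .
  let ?\<gamma> = "(- 1) *\<^sub>R \<alpha>' + \<alpha>"
  have "fmul (\<lambda>q. 1 - \<eta> q) ?\<gamma> = ?\<gamma>"
  proof
    fix q show "fmul (\<lambda>q. 1 - \<eta> q) ?\<gamma> q = ?\<gamma> q"
    proof (cases "q \<in> W")
      case True
      then show ?thesis by (simp add: W(3) fmul_apply form_apply)
    next
      case False
      then have "q \<notin> K" using K(2) by blast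
      then show ?thesis by (simp add: K(4) fmul_apply)
    qed
  qed
  moreover have "D (fmul (\<lambda>q. 1 - \<eta> q) ?\<gamma>) \<beta> = fmul (\<lambda>q. 1 - \<eta> q) (D ?\<gamma> \<beta>)"
  proof -
    have "smooth_fun_on A UNIV (\<lambda>q. 1 - \<eta> q)" by (intro smooth_fun_on_diff smooth_fun_on_const K(3))
    moreover have "?\<gamma> \<in> Omega A 1" by (intro Omega_add Omega_scaleR O)
    ultimately show ?thesis using conn O(3) unfolding contravariant_connection_def by blast
  qed
  ultimately have "D ?\<gamma> \<beta> p = fmul (\<lambda>q. 1 - \<eta> q) (D ?\<gamma> \<beta>) p" by (simp only:)
  then have "D ?\<gamma> \<beta> p = 0" by (simp add: fmul_apply \<eta>)
  then show ?thesis unfolding lin by (simp add: form_apply)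
qed

lemma global_ext:
  assumes "\<alpha>' \<in> Omega A 1" "\<forall>\<^sub>F q in nhds p. \<alpha>' q = \<alpha> q"
  shows "global_ext A p \<alpha> \<in> Omega A 1" "\<forall>\<^sub>F q in nhds p. global_ext A p \<alpha> q = \<alpha> q"
proof -
  have "\<exists>\<alpha>'. \<alpha>' \<in> Omega A 1 \<and> (\<forall>\<^sub>F q in nhds p. \<alpha>' q = \<alpha> q)" using assms by blast
  from someI_ex[OF this] show "global_ext A p \<alpha> \<in> Omega A 1" "\<forall>\<^sub>F q in nhds p. global_ext A p \<alpha> q = \<alpha> q"
    unfolding global_ext_def by blast+
qed

text \<open>\<open>parallel_on\<close> speaks of extensions picked by choice in
  \<open>global_ext\<close>. The one of \<psi> is exchanged for \<psi>' inside the bracket, the one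
  of df inside \<open>D\<close>; in between, the bracket with f is \<open>D\<close> along
  df.\<close>

lemma br_parallel:
  assumes conn: "contravariant_connection A \<pi> D" and par: "parallel_on A D V \<psi>" and p: "p \<in> V"
    and f: "smooth_fun_on A UNIV f" and \<psi>': "\<psi>' \<in> Omega A 1" "\<forall>\<^sub>F q in nhds p. \<psi>' q = \<psi> q"
  shows "br (fun_form f) \<psi>' p = 0"
proof -
  note a = global_ext[OF Omega_diff_fun[OF f] always_eventually[OF allI[OF refl]], of p]
  note b = global_ext[OF \<psi>']
  have "smooth_form_on A V 1 (diff_fun A f)"
    by (rule smooth_form_diff_fun[OF smooth_fun_on_subset[OF f]]) simp
  then have 0: "D (global_ext A p (diff_fun A f)) (global_ext A p \<psi>) p = 0"
    using par p unfolding parallel_on_def local_conn_def by blast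
  have "br (fun_form f) \<psi>' p = br (fun_form f) (global_ext A p \<psi>) p"
    by (rule br_local[OF Omega_fun_form[OF f] \<psi>'(1) b(1)]) (use \<psi>'(2) b(2) in eventually_elim, simp)
  also have "\<dots> = D (diff_fun A f) (global_ext A p \<psi>) p" by (simp add: br_fun_1form[OF f b(1)])
  also have "\<dots> = D (global_ext A p (diff_fun A f)) (global_ext A p \<psi>) p"
    by (rule connection_local_left[OF conn Omega_diff_fun[OF f] a(1) b(1)]) (use a(2) in eventually_elim, simp)
  finally show ?thesis using 0 by simp
qed

end

section \<open>Parallel coframes and metacurvature\<close>

text \<open>All functions are global, but only their restrictions to \<open>U\<close> matter: there \<open>X\<close>, \<open>Y\<close>, \<open>P\<close>, \<open>Q\<close>, \<open>a\<close>
  are \<open>x\<^sub>l\<close>, \<open>y\<^sub>u\<close>, \<open>\<pi>\<^sub>l\<^sub>m\<close>, \<open>\<pi>\<^sup>k\<^sup>l\<close>, \<open>A\<^sub>l\<^sup>u\<close>, the vectors \<open>vx\<close>, \<open>vy\<close> are \<open>\<partial>/\<partial>x\<^sub>l\<close>, \<open>\<partial>/\<partial>y\<^sub>u\<close>, and \<open>C\<close>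
  consists of the \<open>dy\<close>-components of the \<open>\<phi>\<^sub>k\<close>.\<close>

locale flat_frame = hawkins_manifold A \<pi> D br
  for A :: "('a::t2_space, 'e::euclidean_space) atlas" and \<pi> D br +
  fixes mc :: "'a \<Rightarrow> 'a alt \<Rightarrow> 'a alt \<Rightarrow> 'a alt \<Rightarrow> 'a alt"
    and U :: "'a set" and n m :: nat and X Y :: "nat \<Rightarrow> 'a \<Rightarrow> real"
    and vx vy :: "nat \<Rightarrow> 'a \<Rightarrow> 'a tvec"
    and P Q a C :: "nat \<Rightarrow> nat \<Rightarrow> 'a \<Rightarrow> real" and \<phi> :: "nat \<Rightarrow> 'a form"
  assumes mc: "metacurvature A br mc"
    and U: "open U"
    and smooth_X: "\<And>l. smooth_fun_on A UNIV (X l)" and smooth_Y: "\<And>u. smooth_fun_on A UNIV (Y u)"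
    and smooth_P: "\<And>l i. smooth_fun_on A UNIV (P l i)" and smooth_Q: "\<And>k l. smooth_fun_on A UNIV (Q k l)"
    and smooth_a: "\<And>l u. smooth_fun_on A UNIV (a l u)" and smooth_C: "\<And>k u. smooth_fun_on A UNIV (C k u)"
    and vx: "\<And>q l. q \<in> U \<Longrightarrow> vx l q \<in> tangent_space A q"
    and vy: "\<And>q u. q \<in> U \<Longrightarrow> vy u q \<in> tangent_space A q"
    and expansion: "\<And>q \<alpha>. q \<in> U \<Longrightarrow> \<alpha> \<in> cotangent_space A q \<Longrightarrow>
      \<alpha> = (\<Sum>l=1..n. \<alpha> [vx l q] *\<^sub>R diff_fun A (X l) q) + (\<Sum>u=1..m. \<alpha> [vy u q] *\<^sub>R diff_fun A (Y u) q)"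
    and vx_X: "\<And>q i l. q \<in> U \<Longrightarrow> i \<in> {1..n} \<Longrightarrow> l \<in> {1..n} \<Longrightarrow> vx i q (X l) = (if i = l then 1 else 0)"
    and vy_Y: "\<And>q u v. q \<in> U \<Longrightarrow> u \<in> {1..m} \<Longrightarrow> v \<in> {1..m} \<Longrightarrow> vy u q (Y v) = (if u = v then 1 else 0)"
    and phi: "\<And>k. \<phi> k = (\<Sum>l=1..n. fmul (Q k l) (diff_fun A (X l))) + (\<Sum>u=1..m. fmul (C k u) (diff_fun A (Y u)))"
    and pair_phi: "\<And>q k \<beta>. q \<in> U \<Longrightarrow> k \<in> {1..n} \<Longrightarrow> \<beta> \<in> cotangent_space A q \<Longrightarrow> \<pi> q (\<phi> k q) \<beta> = \<beta> [vx k q]"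
    and pair_dY: "\<And>q u \<beta>. q \<in> U \<Longrightarrow> u \<in> {1..m} \<Longrightarrow> \<beta> \<in> cotangent_space A q \<Longrightarrow> \<pi> q (diff_fun A (Y u) q) \<beta> = 0"
    and flat_phi: "\<And>q f k. q \<in> U \<Longrightarrow> smooth_fun_on A UNIV f \<Longrightarrow> k \<in> {1..n} \<Longrightarrow> br (fun_form f) (\<phi> k) q = 0"
    and flat_dY: "\<And>q f u. q \<in> U \<Longrightarrow> smooth_fun_on A UNIV f \<Longrightarrow> u \<in> {1..m} \<Longrightarrow> br (fun_form f) (diff_fun A (Y u)) q = 0"
    and theta: "\<And>q l. q \<in> U \<Longrightarrow> l \<in> {1..n} \<Longrightarrow>
      (\<Sum>i=1..n. P l i q *\<^sub>R \<phi> i q) = diff_fun A (X l) q + (\<Sum>u=1..m. a l u q *\<^sub>R diff_fun A (Y u) q)"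
    and P_eq: "\<And>q l i. q \<in> U \<Longrightarrow> l \<in> {1..n} \<Longrightarrow> i \<in> {1..n} \<Longrightarrow> P l i q = poisson_bracket A \<pi> (X l) (X i) q"
    and QP: "\<And>q k i. q \<in> U \<Longrightarrow> k \<in> {1..n} \<Longrightarrow> i \<in> {1..n} \<Longrightarrow>
      (\<Sum>l=1..n. Q k l q * P l i q) = (if k = i then 1 else 0)"
begin

section \<open>Expansions in the parallel coframe\<close>

lemma near_U: "q \<in> U \<Longrightarrow> (\<And>p. p \<in> U \<Longrightarrow> R p) \<Longrightarrow> \<forall>\<^sub>F p in nhds q. R p"
  by (rule eventually_mono[OF eventually_nhds_in_open[OF U]])

lemma Omega_X: "d0 (X l) \<in> Omega A 1" and Omega_Y: "d0 (Y u) \<in> Omega A 1"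
  by (rule Omega_diff_fun smooth_X smooth_Y)+

lemma Omega_phi: "\<phi> k \<in> Omega A 1"
  unfolding phi by (intro Omega_add Omega_sum Omega_fmul Omega_X Omega_Y smooth_Q smooth_C)

lemma phi_apply: "\<phi> k q = (\<Sum>l=1..n. Q k l q *\<^sub>R d0 (X l) q) + (\<Sum>u=1..m. C k u q *\<^sub>R d0 (Y u) q)"
  unfolding phi by (simp add: form_apply fmul_apply)

text \<open>The coefficients of \<open>df\<close> in the coframe \<open>(\<phi>\<^sub>i, dy\<^sub>u)\<close>.\<close>

definition Xv :: "nat \<Rightarrow> ('a \<Rightarrow> real) \<Rightarrow> 'a \<Rightarrow> real" where
  "Xv i f q = (\<Sum>l=1..n. P l i q * vx l q f)"

definition Yv :: "nat \<Rightarrow> ('a \<Rightarrow> real) \<Rightarrow> 'a \<Rightarrow> real" where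
  "Yv u f q = vy u q f - (\<Sum>l=1..n. a l u q * vx l q f)"

lemma dX: "q \<in> U \<Longrightarrow> l \<in> {1..n} \<Longrightarrow>
    d0 (X l) q = (\<Sum>i=1..n. P l i q *\<^sub>R \<phi> i q) - (\<Sum>u=1..m. a l u q *\<^sub>R d0 (Y u) q)"
  using theta by simp

lemma diff_fun_frame:
  assumes q: "q \<in> U"
  shows "d0 f q = (\<Sum>i=1..n. Xv i f q *\<^sub>R \<phi> i q) + (\<Sum>u=1..m. Yv u f q *\<^sub>R d0 (Y u) q)"
proof -
  have "d0 f q = (\<Sum>l=1..n. vx l q f *\<^sub>R d0 (X l) q) + (\<Sum>u=1..m. vy u q f *\<^sub>R d0 (Y u) q)"
    using expansion[OF q diff_fun_cotangent, of f] by (simp add: diff_fun_apply vx vy q)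
  also have "(\<Sum>l=1..n. vx l q f *\<^sub>R d0 (X l) q) =
      (\<Sum>l=1..n. \<Sum>i=1..n. (P l i q * vx l q f) *\<^sub>R \<phi> i q) - (\<Sum>l=1..n. \<Sum>u=1..m. (a l u q * vx l q f) *\<^sub>R d0 (Y u) q)"
    unfolding sum_subtractf[symmetric]
    by (intro sum.cong refl) (simp add: dX[OF q] scaleR_right_diff_distrib scaleR_sum_right mult.commute)
  also have "(\<Sum>l=1..n. \<Sum>i=1..n. (P l i q * vx l q f) *\<^sub>R \<phi> i q) = (\<Sum>i=1..n. Xv i f q *\<^sub>R \<phi> i q)"
    by (subst sum.swap) (simp add: Xv_def scaleR_sum_left)
  also have "(\<Sum>l=1..n. \<Sum>u=1..m. (a l u q * vx l q f) *\<^sub>R d0 (Y u) q) =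
      (\<Sum>u=1..m. (\<Sum>l=1..n. a l u q * vx l q f) *\<^sub>R d0 (Y u) q)"
    by (subst sum.swap) (simp add: scaleR_sum_left)
  finally show ?thesis
    by (simp add: Yv_def scaleR_left_diff_distrib sum_subtractf)
qed

lemma cot_phi: "\<phi> k q \<in> cotangent_space A q"
  by (rule Omega_cotangent[OF Omega_phi])

text \<open>The dy_u lie in the kernel of the anchor, and \<phi>_i is mapped to \<open>vx i\<close>.
  With \<beta> = dx_i this extracts the coefficient of \<phi>_i.\<close>

lemma pi_frame:
  assumes q: "q \<in> U" and b: "\<beta> \<in> cotangent_space A q"
  shows "\<pi> q ((\<Sum>i=1..n. s i *\<^sub>R \<phi> i q) + (\<Sum>u=1..m. t u *\<^sub>R d0 (Y u) q)) \<beta> = (\<Sum>i=1..n. s i * \<beta> [vx i q])"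
  by (simp add: pi_add pi_sum alt_space_sum alt_space_scaleR cot_phi diff_fun_cotangent b
      pair_phi[OF q _ b] pair_dY[OF q _ b])

text \<open>Pairing the coframe expansion of dg with dx_l leaves the coefficient of \<phi>_l, so
  \<open>Xv l\<close> is minus the Hamiltonian derivation of x_l.\<close>

lemma pb_X:
  assumes q: "q \<in> U" and l: "l \<in> {1..n}" shows "pb (X l) g q = - Xv l g q"
proof -
  have "pb (X l) g q = - \<pi> q (d0 g q) (d0 (X l) q)"
    unfolding poisson_bracket_def by (rule pi_antisym[OF diff_fun_cotangent diff_fun_cotangent])
  also have "\<pi> q (d0 g q) (d0 (X l) q) = (\<Sum>i=1..n. Xv i g q * (if i = l then 1 else 0))"
    using l by (subst diff_fun_frame[OF q, of g]) (simp add: pi_frame[OF q diff_fun_cotangent] diff_fun_apply vx q vx_X)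
  also have "\<dots> = Xv l g q" using l by (simp add: if_distrib[of "\<lambda>x. _ * x"] cong: if_cong)
  finally show ?thesis .
qed

lemma pb_Y: "q \<in> U \<Longrightarrow> u \<in> {1..m} \<Longrightarrow> pb (Y u) g q = 0"
  unfolding poisson_bracket_def by (rule pair_dY[OF _ _ diff_fun_cotangent])

text \<open>Pairing with dx_i through \<pi> isolates the coefficients of the \<phi>_i. Once these
  cancel, evaluation at \<open>vy v\<close> isolates the others; in the opposite order the
  dy-components of the \<phi>_i would interfere.\<close>

lemma frame_unique:
  assumes q: "q \<in> U"
    and eq: "(\<Sum>i=1..n. s i *\<^sub>R \<phi> i q) + (\<Sum>u=1..m. t u *\<^sub>R d0 (Y u) q) =
      (\<Sum>i=1..n. s' i *\<^sub>R \<phi> i q) + (\<Sum>u=1..m. t' u *\<^sub>R d0 (Y u) q)"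
  shows "i \<in> {1..n} \<Longrightarrow> s i = s' i" "v \<in> {1..m} \<Longrightarrow> t v = t' v"
proof -
  have s: "s i = s' i" if i: "i \<in> {1..n}" for i
    using arg_cong[OF eq, of "\<lambda>\<alpha>. \<pi> q \<alpha> (d0 (X i) q)"] i
    by (simp add: pi_frame[OF q diff_fun_cotangent] diff_fun_apply vx q vx_X if_distrib[of "\<lambda>x. _ * x"] cong: if_cong)
  then show "i \<in> {1..n} \<Longrightarrow> s i = s' i" .
  have "(\<Sum>i=1..n. s i *\<^sub>R \<phi> i q) = (\<Sum>i=1..n. s' i *\<^sub>R \<phi> i q)"
    by (rule sum.cong) (simp_all add: s)
  with eq have eq: "(\<Sum>u=1..m. t u *\<^sub>R d0 (Y u) q) = (\<Sum>u=1..m. t' u *\<^sub>R d0 (Y u) q)" by simp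
  have "(\<Sum>u=1..m. t u *\<^sub>R d0 (Y u) q) [vy v q] = t v" if "v \<in> {1..m}" for t v
    using that by (simp add: sum_fun_apply scaleR_fun_def diff_fun_apply vy q vy_Y if_distrib[of "\<lambda>x. _ * x"] cong: if_cong)
  from this[of v t] this[of v t'] show "v \<in> {1..m} \<Longrightarrow> t v = t' v" using eq by simp
qed

text \<open>The bracket with \<open>f\<close> kills \<phi>_i and dy_u, so applied to
  \<open>theta\<close> it differentiates coefficients only. This determines {f, dx_j} in the
  parallel coframe.\<close>

lemma br_fun_dX:
  assumes q: "q \<in> U" and f: "smooth_fun_on A UNIV f" and j: "j \<in> {1..n}"
  shows "(\<Sum>i=1..n. pb f (P j i) q *\<^sub>R \<phi> i q) = br (fun_form f) (d0 (X j)) q + (\<Sum>u=1..m. pb f (a j u) q *\<^sub>R d0 (Y u) q)"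
proof -
  have O: "(\<Sum>i=1..n. fmul (P j i) (\<phi> i)) \<in> Omega A 1" "(\<Sum>u=1..m. fmul (a j u) (d0 (Y u))) \<in> Omega A 1"
    by (intro Omega_sum Omega_fmul Omega_phi Omega_Y smooth_P smooth_a)+
  have "br (fun_form f) (\<Sum>i=1..n. fmul (P j i) (\<phi> i)) q = br (fun_form f) (d0 (X j) + (\<Sum>u=1..m. fmul (a j u) (d0 (Y u)))) q"
    by (rule br_local[OF Omega_fun_form[OF f] O(1) Omega_add[OF Omega_X O(2)]], rule near_U[OF q])
      (use j in \<open>simp add: form_apply fmul_apply theta\<close>)
  then show ?thesis
    by (simp add: br_add[OF Omega_fun_form[OF f] Omega_X O(2)] br_sum[OF Omega_fun_form[OF f], where l = 1] br_fun_fmul[OF f, where l = 1]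
        Omega_fmul Omega_phi Omega_Y smooth_P smooth_a form_apply fmul_apply flat_phi[OF q f] flat_dY[OF q f])
qed

text \<open>The \<phi>-coefficients give the Jacobi identity for the coordinates x_i, as
  \<open>Xv\<close> is minus a Hamiltonian derivation. The dy-coefficients tie the transverse
  derivatives of \<pi>_lj to the Hamiltonian derivatives of the A.\<close>

lemma torsion:
  assumes q: "q \<in> U" and l: "l \<in> {1..n}" and j: "j \<in> {1..n}"
  shows "i \<in> {1..n} \<Longrightarrow> Xv i (P l j) q = Xv j (P l i) q - Xv l (P j i) q"
    "u \<in> {1..m} \<Longrightarrow> Yv u (P l j) q = Xv l (a j u) q - Xv j (a l u) q"
proof -
  have br: "br (fun_form (X l)) (d0 (X j)) q =
      (\<Sum>i=1..n. - Xv l (P j i) q *\<^sub>R \<phi> i q) + (\<Sum>u=1..m. Xv l (a j u) q *\<^sub>R d0 (Y u) q)"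
    if "l \<in> {1..n}" "j \<in> {1..n}" for l j
    using br_fun_dX[OF q smooth_X that(2), of l] that(1) by (simp add: pb_X q sum_negf algebra_simps)
  have "d0 (P l j) q = d0 (pb (X l) (X j)) q"
    by (rule diff_fun_cong, rule near_U[OF q]) (use l j in \<open>simp add: P_eq\<close>)
  also have "d0 (pb (X l) (X j)) = br (d0 (X l)) (fun_form (X j)) + br (fun_form (X l)) (d0 (X j))"
    using ext_d_br[OF Omega_fun_form[OF smooth_X] Omega_fun_form[OF smooth_X], of l j]
    by (simp add: br_fun_fun smooth_X)
  also have "br (d0 (X l)) (fun_form (X j)) = - br (fun_form (X j)) (d0 (X l))"
    by (subst br_sym[OF Omega_X Omega_fun_form[OF smooth_X]]) simp
  finally have "d0 (P l j) q = br (fun_form (X l)) (d0 (X j)) q - br (fun_form (X j)) (d0 (X l)) q"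
    by (simp add: form_apply)
  also have "\<dots> = (\<Sum>i=1..n. (Xv j (P l i) q - Xv l (P j i) q) *\<^sub>R \<phi> i q) +
      (\<Sum>u=1..m. (Xv l (a j u) q - Xv j (a l u) q) *\<^sub>R d0 (Y u) q)"
    unfolding br[OF l j] br[OF j l] by (simp add: scaleR_left_diff_distrib sum_subtractf sum_negf)
  finally have "(\<Sum>i=1..n. Xv i (P l j) q *\<^sub>R \<phi> i q) + (\<Sum>u=1..m. Yv u (P l j) q *\<^sub>R d0 (Y u) q) =
      (\<Sum>i=1..n. (Xv j (P l i) q - Xv l (P j i) q) *\<^sub>R \<phi> i q) +
      (\<Sum>u=1..m. (Xv l (a j u) q - Xv j (a l u) q) *\<^sub>R d0 (Y u) q)"
    unfolding diff_fun_frame[OF q, of "P l j"] .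
  from frame_unique[OF q this]
  show "i \<in> {1..n} \<Longrightarrow> Xv i (P l j) q = Xv j (P l i) q - Xv l (P j i) q"
    "u \<in> {1..m} \<Longrightarrow> Yv u (P l j) q = Xv l (a j u) q - Xv j (a l u) q" by auto
qed

section \<open>The exterior derivative of \<phi>_k\<close>

lemma ext_d_phi_sum:
  assumes q: "q \<in> U" and l: "l \<in> {1..n}"
  shows "(\<Sum>i=1..n. P l i q *\<^sub>R ext_d A (\<phi> i) q) =
    (\<Sum>u=1..m. alt_wedge (d0 (a l u) q) (d0 (Y u) q)) - (\<Sum>i=1..n. alt_wedge (d0 (P l i) q) (\<phi> i q))"
proof -
  have "ext_d A (\<Sum>i=1..n. fmul (P l i) (\<phi> i)) q = ext_d A (d0 (X l) + (\<Sum>u=1..m. fmul (a l u) (d0 (Y u)))) q"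
    by (rule ext_d_cong, rule near_U[OF q]) (use l in \<open>simp add: form_apply fmul_apply theta\<close>)
  then show ?thesis
    by (simp add: ext_d_add ext_d_sum Omega_sum Omega_fmul Omega_phi Omega_X Omega_Y smooth_P smooth_a ext_d_fmul
        ext_d_diff_fun smooth_X smooth_Y form_apply fmul_apply wedge_apply sum.distrib algebra_simps)
qed

text \<open>\<open>Q\<close> is a left inverse of \<open>P\<close> on \<open>U\<close>, so
  contraction with it solves \<open>ext_d_phi_sum\<close> for a single d\<phi>_k.\<close>

lemma ext_d_phi:
  assumes q: "q \<in> U" and k: "k \<in> {1..n}"
  shows "ext_d A (\<phi> k) q = (\<Sum>l=1..n. Q k l q *\<^sub>R
    ((\<Sum>u=1..m. alt_wedge (d0 (a l u) q) (d0 (Y u) q)) - (\<Sum>i=1..n. alt_wedge (d0 (P l i) q) (\<phi> i q))))"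
proof -
  have "(\<Sum>l=1..n. Q k l q *\<^sub>R (\<Sum>i=1..n. P l i q *\<^sub>R ext_d A (\<phi> i) q)) =
      (\<Sum>l=1..n. \<Sum>i=1..n. (Q k l q * P l i q) *\<^sub>R ext_d A (\<phi> i) q)"
    by (simp add: scaleR_sum_right)
  also have "\<dots> = (\<Sum>i=1..n. \<Sum>l=1..n. (Q k l q * P l i q) *\<^sub>R ext_d A (\<phi> i) q)"
    by (rule sum.swap)
  also have "\<dots> = (\<Sum>i=1..n. (\<Sum>l=1..n. Q k l q * P l i q) *\<^sub>R ext_d A (\<phi> i) q)"
    by (simp add: scaleR_sum_left)
  also have "\<dots> = ext_d A (\<phi> k) q"
    using k by (simp add: QP[OF q k] if_distrib[of "\<lambda>x. x *\<^sub>R _"] cong: if_cong)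
  finally show ?thesis by (simp add: ext_d_phi_sum[OF q])
qed

text \<open>A globally defined extension of \<open>\<partial>/\<partial>x\<^sub>k\<close>: the derivative along the anchor of \<open>\<phi>\<^sub>k\<close>.\<close>

definition delta :: "nat \<Rightarrow> ('a \<Rightarrow> real) \<Rightarrow> 'a \<Rightarrow> real" where
  "delta k f q = (\<Sum>l=1..n. Q k l q * pb (X l) f q) + (\<Sum>u=1..m. C k u q * pb (Y u) f q)"

lemma smooth_delta: "smooth_fun_on A UNIV f \<Longrightarrow> smooth_fun_on A UNIV (delta k f)"
  unfolding delta_def
  by (intro smooth_fun_on_add smooth_fun_on_sum smooth_fun_on_mult smooth_pb smooth_Q smooth_C smooth_X smooth_Y)

lemma delta_eq_vx:
  assumes q: "q \<in> U" and k: "k \<in> {1..n}" shows "delta k f q = vx k q f"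
proof -
  have "delta k f q = \<pi> q (\<phi> k q) (d0 f q)"
    unfolding phi_apply delta_def poisson_bracket_def
    by (simp add: pi_add pi_sum alt_space_sum alt_space_scaleR diff_fun_cotangent)
  then show ?thesis using pair_phi[OF q k diff_fun_cotangent] by (simp add: diff_fun_apply vx q)
qed

text \<open>Contracted with a row of the inverse matrix, the Hamiltonian derivations of the x_l give
  the derivation along the anchor of \<phi>_k, up to the sign in \<open>pb_X\<close>; the y_u
  contribute nothing on \<open>U\<close>.\<close>

lemma delta_Xv: "q \<in> U \<Longrightarrow> (\<Sum>l=1..n. Q k l q * Xv l f q) = - delta k f q"
  by (simp add: delta_def pb_X pb_Y sum_negf)

text \<open>The global formula for \<phi>_k in terms of the exact forms \<open>d0 (X l)\<close> and
  \<open>d0 (Y u)\<close> exhibits its derivative as a sum of wedges of smooth 1-forms.\<close>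

lemma Omega_ext_d_phi: "ext_d A (\<phi> k) \<in> Omega A 2"
proof -
  have "ext_d A (\<phi> k) = (\<Sum>l=1..n. wedge (d0 (Q k l)) (d0 (X l))) + (\<Sum>u=1..m. wedge (d0 (C k u)) (d0 (Y u)))"
    unfolding phi
    by (simp add: ext_d_add ext_d_sum Omega_sum Omega_fmul Omega_X Omega_Y smooth_Q smooth_C ext_d_fmul
        ext_d_diff_fun smooth_X smooth_Y fmul_0)
  then show ?thesis
    by (simp add: Omega_add Omega_sum Omega_wedge Omega_X Omega_Y Omega_diff_fun smooth_Q smooth_C)
qed

text \<open>In the l-th equation the coefficients of \<phi>\<and>\<phi> and \<phi>\<and>dy turn out,
  by \<open>torsion\<close>, to be derivatives along x_l itself. This is what lets contraction with
  \<open>Q\<close> turn them into \<open>delta k\<close>.\<close>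

lemma ext_d_phi_frame:
  assumes q: "q \<in> U" and k: "k \<in> {1..n}"
  shows "ext_d A (\<phi> k) q + (\<Sum>i=1..n. \<Sum>u=1..m. delta k (a i u) q *\<^sub>R alt_wedge (\<phi> i q) (d0 (Y u) q)) =
    (\<Sum>i=1..n. \<Sum>j\<in>{i<..n}. delta k (P i j) q *\<^sub>R alt_wedge (\<phi> i q) (\<phi> j q)) +
    (\<Sum>u=1..m. \<Sum>v\<in>{u<..m}. (\<Sum>l=1..n. Q k l q * (Yv u (a l v) q - Yv v (a l u) q)) *\<^sub>R
      alt_wedge (d0 (Y u) q) (d0 (Y v) q))"
proof -
  let ?p = "\<lambda>i j. alt_wedge (\<phi> i q) (\<phi> j q)" and ?m = "\<lambda>i u. alt_wedge (\<phi> i q) (d0 (Y u) q)"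
    and ?y = "\<lambda>u v. alt_wedge (d0 (Y u) q) (d0 (Y v) q)"
  have anti: "?p j i = - ?p i j" "?y v u = - ?y u v" "alt_wedge (d0 (Y u) q) (\<phi> i q) = - ?m i u" for i j u v
    by (rule alt_wedge_antisym[of _ A q]; rule cot_phi diff_fun_cotangent)+
  have T: "(\<Sum>u=1..m. alt_wedge (d0 (a l u) q) (d0 (Y u) q)) - (\<Sum>j=1..n. alt_wedge (d0 (P l j) q) (\<phi> j q)) =
      (\<Sum>i=1..n. \<Sum>j\<in>{i<..n}. - Xv l (P i j) q *\<^sub>R ?p i j) +
      (\<Sum>i=1..n. \<Sum>u=1..m. Xv l (a i u) q *\<^sub>R ?m i u) +
      (\<Sum>u=1..m. \<Sum>v\<in>{u<..m}. (Yv u (a l v) q - Yv v (a l u) q) *\<^sub>R ?y u v)"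
    if l: "l \<in> {1..n}" for l
  proof -
    have "(\<Sum>u=1..m. alt_wedge (d0 (a l u) q) (d0 (Y u) q)) =
        (\<Sum>u=1..m. (\<Sum>i=1..n. Xv i (a l u) q *\<^sub>R ?m i u) + (\<Sum>v=1..m. Yv v (a l u) q *\<^sub>R ?y v u))"
      by (intro sum.cong refl, subst diff_fun_frame[OF q])
        (simp add: alt_wedge_add_left alt_wedge_sum_left alt_wedge_scaleR_left)
    also have "\<dots> = (\<Sum>i=1..n. \<Sum>u=1..m. Xv i (a l u) q *\<^sub>R ?m i u) + (\<Sum>v=1..m. \<Sum>u=1..m. Yv v (a l u) q *\<^sub>R ?y v u)"
      unfolding sum.distrib by (intro arg_cong2[where f = "(+)"] sum.swap)
    also have "(\<Sum>v=1..m. \<Sum>u=1..m. Yv v (a l u) q *\<^sub>R ?y v u) =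
        (\<Sum>u=1..m. \<Sum>v\<in>{u<..m}. (Yv u (a l v) q - Yv v (a l u) q) *\<^sub>R ?y u v)"
      by (rule sum_antisymmetric) (rule anti)
    finally have 1: "(\<Sum>u=1..m. alt_wedge (d0 (a l u) q) (d0 (Y u) q)) =
        (\<Sum>i=1..n. \<Sum>u=1..m. Xv i (a l u) q *\<^sub>R ?m i u) +
        (\<Sum>u=1..m. \<Sum>v\<in>{u<..m}. (Yv u (a l v) q - Yv v (a l u) q) *\<^sub>R ?y u v)" .
    have "(\<Sum>j=1..n. alt_wedge (d0 (P l j) q) (\<phi> j q)) =
        (\<Sum>j=1..n. (\<Sum>i=1..n. Xv i (P l j) q *\<^sub>R ?p i j) + (\<Sum>u=1..m. - Yv u (P l j) q *\<^sub>R ?m j u))"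
      by (intro sum.cong refl, subst diff_fun_frame[OF q])
        (simp add: alt_wedge_add_left alt_wedge_sum_left alt_wedge_scaleR_left anti(3))
    also have "\<dots> = (\<Sum>i=1..n. \<Sum>j=1..n. Xv i (P l j) q *\<^sub>R ?p i j) + (\<Sum>i=1..n. \<Sum>u=1..m. - Yv u (P l i) q *\<^sub>R ?m i u)"
      unfolding sum.distrib by (intro arg_cong2[where f = "(+)"] sum.swap refl)
    also have "(\<Sum>i=1..n. \<Sum>j=1..n. Xv i (P l j) q *\<^sub>R ?p i j) =
        (\<Sum>i=1..n. \<Sum>j\<in>{i<..n}. (Xv i (P l j) q - Xv j (P l i) q) *\<^sub>R ?p i j)"
      by (rule sum_antisymmetric) (rule anti)
    \<comment> \<open>The Jacobi identity merges the derivatives along x_i and x_j into one along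
      x_l.\<close>
    also have "\<dots> = (\<Sum>i=1..n. \<Sum>j\<in>{i<..n}. - Xv l (P j i) q *\<^sub>R ?p i j)"
    proof (intro sum.cong refl)
      fix i j assume "i \<in> {1..n}" "j \<in> {i<..n}"
      then have ij: "i \<in> {1..n}" "j \<in> {1..n}" by auto
      show "(Xv i (P l j) q - Xv j (P l i) q) *\<^sub>R ?p i j = - Xv l (P j i) q *\<^sub>R ?p i j"
        unfolding torsion(1)[OF q l ij(2,1)] by simp
    qed
    finally have 2: "(\<Sum>j=1..n. alt_wedge (d0 (P l j) q) (\<phi> j q)) =
        (\<Sum>i=1..n. \<Sum>j\<in>{i<..n}. - Xv l (P j i) q *\<^sub>R ?p i j) +
        (\<Sum>i=1..n. \<Sum>u=1..m. - Yv u (P l i) q *\<^sub>R ?m i u)" .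
    \<comment> \<open>Antisymmetry of the matrix \<open>P\<close> under \<open>Xv l\<close>,
      recovered by adding \<open>torsion\<close> to its instance with i and j exchanged.\<close>
    have 3: "Xv l (P j i) q = - Xv l (P i j) q" if ij: "i \<in> {1..n}" "j \<in> {1..n}" for i j
      using torsion(1)[OF q l ij(2,1)] torsion(1)[OF q l ij] by simp
    \<comment> \<open>Mixed terms arise twice, from dA\<and>dy and, after swapping the factors, from
      d\<pi>\<and>\<phi>; \<open>torsion\<close> combines them into one.\<close>
    have 4: "Xv i (a l u) q + Yv u (P l i) q = Xv l (a i u) q" if "i \<in> {1..n}" "u \<in> {1..m}" for i u
      using torsion(2)[OF q l that] by simp
    have "(\<Sum>i=1..n. \<Sum>u=1..m. Xv i (a l u) q *\<^sub>R ?m i u) - (\<Sum>i=1..n. \<Sum>u=1..m. - Yv u (P l i) q *\<^sub>R ?m i u) =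
        (\<Sum>i=1..n. \<Sum>u=1..m. (Xv i (a l u) q + Yv u (P l i) q) *\<^sub>R ?m i u)"
      by (simp add: sum_subtractf[symmetric] scaleR_left_distrib)
    also have "\<dots> = (\<Sum>i=1..n. \<Sum>u=1..m. Xv l (a i u) q *\<^sub>R ?m i u)"
      by (intro sum.cong refl) (simp add: 4)
    finally have 5: "(\<Sum>i=1..n. \<Sum>u=1..m. Xv i (a l u) q *\<^sub>R ?m i u) - (\<Sum>i=1..n. \<Sum>u=1..m. - Yv u (P l i) q *\<^sub>R ?m i u) =
        (\<Sum>i=1..n. \<Sum>u=1..m. Xv l (a i u) q *\<^sub>R ?m i u)" .
    have 6: "- (\<Sum>i=1..n. \<Sum>j\<in>{i<..n}. - Xv l (P j i) q *\<^sub>R ?p i j) =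
        (\<Sum>i=1..n. \<Sum>j\<in>{i<..n}. - Xv l (P i j) q *\<^sub>R ?p i j)"
      unfolding sum_negf[symmetric]
    proof (intro sum.cong refl)
      fix i j assume "i \<in> {1..n}" "j \<in> {i<..n}"
      then have ij: "i \<in> {1..n}" "j \<in> {1..n}" by auto
      show "- (- Xv l (P j i) q *\<^sub>R ?p i j) = - Xv l (P i j) q *\<^sub>R ?p i j"
        unfolding 3[OF ij] by simp
    qed
    show ?thesis unfolding 1 2 6[symmetric] 5[symmetric] by simp
  qed
  have *: "(\<Sum>l=1..n. Q k l q *\<^sub>R (\<Sum>i\<in>I. \<Sum>j\<in>J i. s l i j *\<^sub>R w i j)) =
      (\<Sum>i\<in>I. \<Sum>j\<in>J i. (\<Sum>l=1..n. Q k l q * s l i j) *\<^sub>R w i j)"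
    for I :: "nat set" and J :: "nat \<Rightarrow> nat set" and s and w :: "nat \<Rightarrow> nat \<Rightarrow> 'a alt"
  proof -
    have "(\<Sum>l=1..n. Q k l q *\<^sub>R (\<Sum>i\<in>I. \<Sum>j\<in>J i. s l i j *\<^sub>R w i j)) =
        (\<Sum>i\<in>I. \<Sum>l=1..n. \<Sum>j\<in>J i. (Q k l q * s l i j) *\<^sub>R w i j)"
      unfolding scaleR_sum_right scaleR_scaleR by (rule sum.swap)
    also have "\<dots> = (\<Sum>i\<in>I. \<Sum>j\<in>J i. \<Sum>l=1..n. (Q k l q * s l i j) *\<^sub>R w i j)"
      by (intro sum.cong refl sum.swap)
    finally show ?thesis by (simp only: scaleR_sum_left)
  qed
  have "ext_d A (\<phi> k) q = (\<Sum>l=1..n. Q k l q *\<^sub>R (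
      (\<Sum>i=1..n. \<Sum>j\<in>{i<..n}. - Xv l (P i j) q *\<^sub>R ?p i j) +
      (\<Sum>i=1..n. \<Sum>u=1..m. Xv l (a i u) q *\<^sub>R ?m i u) +
      (\<Sum>u=1..m. \<Sum>v\<in>{u<..m}. (Yv u (a l v) q - Yv v (a l u) q) *\<^sub>R ?y u v)))"
    unfolding ext_d_phi[OF q k] by (intro sum.cong refl) (simp only: T)
  also have "\<dots> = (\<Sum>i=1..n. \<Sum>j\<in>{i<..n}. (\<Sum>l=1..n. Q k l q * - Xv l (P i j) q) *\<^sub>R ?p i j) +
      (\<Sum>i=1..n. \<Sum>u=1..m. (\<Sum>l=1..n. Q k l q * Xv l (a i u) q) *\<^sub>R ?m i u) +
      (\<Sum>u=1..m. \<Sum>v\<in>{u<..m}. (\<Sum>l=1..n. Q k l q * (Yv u (a l v) q - Yv v (a l u) q)) *\<^sub>R ?y u v)"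
    unfolding scaleR_right_distrib sum.distrib * ..
  also have "\<dots> = (\<Sum>i=1..n. \<Sum>j\<in>{i<..n}. delta k (P i j) q *\<^sub>R ?p i j) -
      (\<Sum>i=1..n. \<Sum>u=1..m. delta k (a i u) q *\<^sub>R ?m i u) +
      (\<Sum>u=1..m. \<Sum>v\<in>{u<..m}. (\<Sum>l=1..n. Q k l q * (Yv u (a l v) q - Yv v (a l u) q)) *\<^sub>R ?y u v)"
    by (simp add: sum_negf delta_Xv[OF q])
  finally show ?thesis by simp
qed

text \<open>\<open>D\<close> along \<open>\<phi>\<^sub>k\<close>, expressed by the bracket so that it applies to 2-forms.\<close>

definition nabla :: "nat \<Rightarrow> 'a form \<Rightarrow> 'a form" where
  "nabla k \<tau> = (\<Sum>l=1..n. fmul (Q k l) (br (fun_form (X l)) \<tau>)) + (\<Sum>u=1..m. fmul (C k u) (br (fun_form (Y u)) \<tau>))"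

lemma nabla_apply:
  "nabla k \<tau> q = (\<Sum>l=1..n. Q k l q *\<^sub>R br (fun_form (X l)) \<tau> q) + (\<Sum>u=1..m. C k u q *\<^sub>R br (fun_form (Y u)) \<tau> q)"
  by (simp add: nabla_def form_apply fmul_apply)

lemma br_fun_Omega: "smooth_fun_on A UNIV f \<Longrightarrow> \<tau> \<in> Omega A k \<Longrightarrow> br (fun_form f) \<tau> \<in> Omega A k"
  using br_Omega[OF Omega_fun_form, of f \<tau> k] by simp

lemma Omega_nabla: "\<tau> \<in> Omega A 2 \<Longrightarrow> nabla k \<tau> \<in> Omega A 2"
  unfolding nabla_def
  by (intro Omega_add Omega_sum Omega_fmul smooth_Q smooth_C br_fun_Omega smooth_X smooth_Y)

lemma nabla_add:
  assumes "\<tau> \<in> Omega A 2" "\<tau>' \<in> Omega A 2" shows "nabla k (\<tau> + \<tau>') = nabla k \<tau> + nabla k \<tau>'"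
  by (rule ext) (simp add: nabla_apply form_apply br_add[OF Omega_fun_form[OF smooth_X] assms]
      br_add[OF Omega_fun_form[OF smooth_Y] assms] scaleR_right_distrib sum.distrib)

lemma nabla_local:
  assumes "\<tau> \<in> Omega A 2" "\<tau>' \<in> Omega A 2" "\<And>p. p \<in> U \<Longrightarrow> \<tau> p = \<tau>' p" "q \<in> U"
  shows "nabla k \<tau> q = nabla k \<tau>' q"
proof -
  have ev: "\<forall>\<^sub>F p in nhds q. \<tau> p = \<tau>' p" by (rule near_U[OF assms(4,3)])
  show ?thesis
    by (simp add: nabla_apply br_local[OF Omega_fun_form[OF smooth_X] assms(1,2) ev]
        br_local[OF Omega_fun_form[OF smooth_Y] assms(1,2) ev])
qed

definition parallel_2form :: "'a form \<Rightarrow> bool" where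
  "parallel_2form w \<longleftrightarrow> w \<in> Omega A 2 \<and> (\<forall>q\<in>U. \<forall>f. smooth_fun_on A UNIV f \<longrightarrow> br (fun_form f) w q = 0)"

lemma parallel_wedge:
  assumes "\<alpha> \<in> Omega A 1" "\<beta> \<in> Omega A 1"
    "\<And>q f. q \<in> U \<Longrightarrow> smooth_fun_on A UNIV f \<Longrightarrow> br (fun_form f) \<alpha> q = 0"
    "\<And>q f. q \<in> U \<Longrightarrow> smooth_fun_on A UNIV f \<Longrightarrow> br (fun_form f) \<beta> q = 0"
  shows "parallel_2form (wedge \<alpha> \<beta>)"
  unfolding parallel_2form_def
proof (intro conjI ballI allI impI Omega_wedge assms(1,2))
  fix q f assume q: "q \<in> U" and f: "smooth_fun_on A UNIV f"
  show "br (fun_form f) (wedge \<alpha> \<beta>) q = 0"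
    by (simp add: br_wedge[OF Omega_fun_form[OF f] assms(1,2)] form_apply wedge_apply assms(3,4)[OF q f]
        alt_wedge_0_left alt_wedge_0_right)
qed

text \<open>The bracket with x_l or y_u vanishes on each parallel \<open>w s\<close>, so the Leibniz
  rule differentiates coefficients only. A general index set lets the three double sums in d\<phi>_k
  share one lemma.\<close>

lemma nabla_sum:
  assumes w: "\<And>s. s \<in> S \<Longrightarrow> parallel_2form (w s)"
    and G: "\<And>s. s \<in> S \<Longrightarrow> smooth_fun_on A UNIV (G s)" and q: "q \<in> U"
  shows "nabla k (\<Sum>s\<in>S. fmul (G s) (w s)) q = (\<Sum>s\<in>S. delta k (G s) q *\<^sub>R w s q)"
proof -
  have O: "fmul (G s) (w s) \<in> Omega A 2" if "s \<in> S" for s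
    using w[OF that] G[OF that] by (simp add: parallel_2form_def Omega_fmul)
  have br: "br (fun_form f) (\<Sum>s\<in>S. fmul (G s) (w s)) q = (\<Sum>s\<in>S. pb f (G s) q *\<^sub>R w s q)"
    if f: "smooth_fun_on A UNIV f" for f
  proof -
    have "br (fun_form f) (\<Sum>s\<in>S. fmul (G s) (w s)) q = (\<Sum>s\<in>S. br (fun_form f) (fmul (G s) (w s)) q)"
      by (simp add: br_sum[OF Omega_fun_form[OF f] O] form_apply)
    also have "\<dots> = (\<Sum>s\<in>S. pb f (G s) q *\<^sub>R w s q)"
    proof (rule sum.cong[OF refl])
      fix s assume s: "s \<in> S"
      then have "w s \<in> Omega A 2" "br (fun_form f) (w s) q = 0"
        using w[OF s] q f by (auto simp: parallel_2form_def)
      then show "br (fun_form f) (fmul (G s) (w s)) q = pb f (G s) q *\<^sub>R w s q"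
        by (simp add: br_fun_fmul[OF f G[OF s]] form_apply fmul_apply)
    qed
    finally show ?thesis .
  qed
  have "(\<Sum>l\<in>L. t l *\<^sub>R (\<Sum>s\<in>S. g l s *\<^sub>R w s q)) = (\<Sum>s\<in>S. (\<Sum>l\<in>L. t l * g l s) *\<^sub>R w s q)"
    for L :: "nat set" and t g
    unfolding scaleR_sum_right scaleR_scaleR scaleR_sum_left by (rule sum.swap)
  then show ?thesis
    by (simp add: nabla_apply br smooth_X smooth_Y delta_def scaleR_left_distrib sum.distrib)
qed

text \<open>The result of the first \<open>nabla\<close> is known at all points of \<open>U\<close>,
  hence as a germ, and \<open>delta j (G s)\<close> is again globally smooth. Coefficients written
  with \<open>vx j\<close> would not do, since they are controlled on \<open>U\<close> only.\<close>

lemma nabla_nabla_sum: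
  assumes w: "\<And>s. s \<in> S \<Longrightarrow> parallel_2form (w s)"
    and G: "\<And>s. s \<in> S \<Longrightarrow> smooth_fun_on A UNIV (G s)" and q: "q \<in> U"
  shows "nabla i (nabla j (\<Sum>s\<in>S. fmul (G s) (w s))) q = (\<Sum>s\<in>S. delta i (delta j (G s)) q *\<^sub>R w s q)"
proof -
  have w': "w s \<in> Omega A 2" if "s \<in> S" for s using w[OF that] by (simp add: parallel_2form_def)
  have "nabla i (nabla j (\<Sum>s\<in>S. fmul (G s) (w s))) q = nabla i (\<Sum>s\<in>S. fmul (delta j (G s)) (w s)) q"
    by (rule nabla_local[OF Omega_nabla _ _ q]; (intro Omega_sum Omega_fmul G w' smooth_delta)?)
      (simp_all add: nabla_sum[OF w G] form_apply fmul_apply)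
  also have "\<dots> = (\<Sum>s\<in>S. delta i (delta j (G s)) q *\<^sub>R w s q)"
    by (rule nabla_sum[OF w smooth_delta[OF G] q])
  finally show ?thesis .
qed

text \<open>The passage from cut-off functions back to the original ones: only the germ counts, so
  \<open>g\<close> may be arbitrary outside \<open>U\<close>.\<close>

lemma delta_cong:
  assumes "q \<in> U" "k \<in> {1..n}" "\<And>p. p \<in> U \<Longrightarrow> f p = g p"
  shows "delta k f q = vx k q g"
  unfolding delta_eq_vx[OF assms(1,2)]
  by (rule tangent_cong[OF vx[OF assms(1)]], rule near_U[OF assms(1)]) (rule assms(3))

lemma delta_minus_sum:
  assumes q: "q \<in> U" and k: "k \<in> {1..n}" and g: "\<And>l. l \<in> I \<Longrightarrow> smooth_fun_on A UNIV (g l)"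
    and f: "\<And>p. p \<in> U \<Longrightarrow> f p = - (\<Sum>l\<in>I. g l p)"
  shows "delta k f q = - (\<Sum>l\<in>I. delta k (g l) q)"
proof -
  have s: "smooth_at A q (g l)" if "l \<in> I" for l
    using smooth_atI[OF open_UNIV UNIV_I g[OF that]] .
  have "delta k f q = vx k q (\<lambda>p. (- 1) * (\<Sum>l\<in>I. g l p))"
    by (rule delta_cong[OF q k]) (simp add: f)
  also have "\<dots> = - (\<Sum>l\<in>I. vx k q (g l))"
    using tangent_cmult[OF vx[OF q], of "\<lambda>p. \<Sum>l\<in>I. g l p" k "- 1"] tangent_sum[OF vx[OF q], of I g k]
    by (simp add: s smooth_at_sum)
  finally show ?thesis by (simp add: delta_eq_vx[OF q k])
qed

section \<open>Metacurvature on the parallel coframe\<close>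

lemma mc_diff_fun:
  assumes f: "smooth_fun_on A UNIV f" and "\<alpha> \<in> Omega A 1" "\<beta> \<in> Omega A 1"
  shows "mc p (d0 f p) (\<alpha> p) (\<beta> p) =
    br (fun_form f) (br \<alpha> \<beta>) p - br (br (fun_form f) \<alpha>) \<beta> p - br \<alpha> (br (fun_form f) \<beta>) p"
proof -
  have "\<forall>f. smooth_fun_on A UNIV f \<longrightarrow> (\<forall>\<alpha>\<in>Omega A 1. \<forall>\<beta>\<in>Omega A 1.
        (\<lambda>p. mc p (diff_fun A f p) (\<alpha> p) (\<beta> p)) =
          br (fun_form f) (br \<alpha> \<beta>) - br (br (fun_form f) \<alpha>) \<beta> - br \<alpha> (br (fun_form f) \<beta>))"
    using mc unfolding metacurvature_def by (elim conjE) assumption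
  then have "(\<lambda>p. mc p (diff_fun A f p) (\<alpha> p) (\<beta> p)) =
      br (fun_form f) (br \<alpha> \<beta>) - br (br (fun_form f) \<alpha>) \<beta> - br \<alpha> (br (fun_form f) \<beta>)"
    using assms by blast
  from fun_cong[OF this, of p] show ?thesis by (simp add: form_apply)
qed

lemma mc_linear:
  assumes "\<xi> \<in> cotangent_space A p" "\<xi>' \<in> cotangent_space A p" "b \<in> cotangent_space A p" "c \<in> cotangent_space A p"
  shows "mc p (t *\<^sub>R \<xi> + \<xi>') b c = t *\<^sub>R mc p \<xi> b c + mc p \<xi>' b c"
  using conjunct1[OF mc[unfolded metacurvature_def], rule_format, OF assms, THEN conjunct1] .

lemma mc_sym:
  assumes "\<xi> \<in> cotangent_space A p" "b \<in> cotangent_space A p" "c \<in> cotangent_space A p"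
  shows "mc p \<xi> b c = mc p b \<xi> c" "mc p \<xi> b c = mc p \<xi> c b"
  using conjunct1[OF mc[unfolded metacurvature_def], rule_format, OF assms(1,1,2,3), THEN conjunct2] by auto

lemma mc_0: "b \<in> cotangent_space A p \<Longrightarrow> c \<in> cotangent_space A p \<Longrightarrow> mc p 0 b c = 0"
  using mc_linear[of 0 p 0 b c 1] by (simp add: alt_space_0)

lemma mc_sum:
  assumes "b \<in> cotangent_space A p" "c \<in> cotangent_space A p"
  shows "(\<And>i. i \<in> I \<Longrightarrow> \<xi> i \<in> cotangent_space A p) \<Longrightarrow>
    mc p (\<Sum>i\<in>I. t i *\<^sub>R \<xi> i) b c = (\<Sum>i\<in>I. t i *\<^sub>R mc p (\<xi> i) b c)"
proof (induction I rule: infinite_finite_induct)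
  case (insert i I)
  then have "mc p (t i *\<^sub>R \<xi> i + (\<Sum>i\<in>I. t i *\<^sub>R \<xi> i)) b c = t i *\<^sub>R mc p (\<xi> i) b c + mc p (\<Sum>i\<in>I. t i *\<^sub>R \<xi> i) b c"
    by (intro mc_linear alt_space_sum alt_space_scaleR assms) auto
  then show ?case using insert by simp
qed (simp_all add: mc_0[OF assms])

lemma mc_frame_sum:
  assumes "b \<in> cotangent_space A q" "c \<in> cotangent_space A q"
  shows "mc q ((\<Sum>l=1..n. s l *\<^sub>R d0 (X l) q) + (\<Sum>u=1..m. t u *\<^sub>R d0 (Y u) q)) b c =
    (\<Sum>l=1..n. s l *\<^sub>R mc q (d0 (X l) q) b c) + (\<Sum>u=1..m. t u *\<^sub>R mc q (d0 (Y u) q) b c)"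
proof -
  have c: "(\<Sum>l=1..n. s l *\<^sub>R d0 (X l) q) \<in> cotangent_space A q" "(\<Sum>u=1..m. t u *\<^sub>R d0 (Y u) q) \<in> cotangent_space A q"
    by (intro alt_space_sum alt_space_scaleR diff_fun_cotangent)+
  have "mc q (\<Sum>l=1..n. s l *\<^sub>R d0 (X l) q) b c = (\<Sum>l=1..n. s l *\<^sub>R mc q (d0 (X l) q) b c)"
    "mc q (\<Sum>u=1..m. t u *\<^sub>R d0 (Y u) q) b c = (\<Sum>u=1..m. t u *\<^sub>R mc q (d0 (Y u) q) b c)"
    by (rule mc_sum[OF assms diff_fun_cotangent])+
  then show ?thesis using mc_linear[OF c assms, of 1] by simp
qed

text \<open>The correction terms contain {f, \<phi>_j} and {f, \<phi>_k}, which vanish on a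
  neighbourhood of \<open>q\<close> and not just at \<open>q\<close>, so locality of the bracket
  removes them.\<close>

lemma mc_diff_fun_phi:
  assumes q: "q \<in> U" and f: "smooth_fun_on A UNIV f" and j: "j \<in> {1..n}" and k: "k \<in> {1..n}"
  shows "mc q (d0 f q) (\<phi> j q) (\<phi> k q) = br (fun_form f) (br (\<phi> j) (\<phi> k)) q"
proof -
  have "br (br (fun_form f) (\<phi> j)) (\<phi> k) q = 0"
    by (rule br_local_0_left[OF br_fun_Omega[OF f Omega_phi] Omega_phi], rule near_U[OF q]) (rule flat_phi[OF _ f j])
  moreover have "br (\<phi> j) (br (fun_form f) (\<phi> k)) q = 0"
    by (rule br_local_0[OF Omega_phi br_fun_Omega[OF f Omega_phi]], rule near_U[OF q]) (rule flat_phi[OF _ f k])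
  ultimately show ?thesis by (simp add: mc_diff_fun[OF f Omega_phi Omega_phi])
qed

text \<open>The defining formula covers exact first arguments only. Expanding \<phi>_i in dx_l and
  dy_u and using linearity at the point assembles the values into \<open>nabla i\<close>.\<close>

lemma mc_phi:
  assumes "q \<in> U" "j \<in> {1..n}" "k \<in> {1..n}"
  shows "mc q (\<phi> i q) (\<phi> j q) (\<phi> k q) = nabla i (br (\<phi> j) (\<phi> k)) q"
  by (subst (1) phi_apply)
    (simp add: mc_frame_sum cot_phi mc_diff_fun_phi[OF assms(1) smooth_X assms(2,3)]
      mc_diff_fun_phi[OF assms(1) smooth_Y assms(2,3)] nabla_apply)

lemma br_phi_diff_fun:
  assumes q: "q \<in> U" and k: "k \<in> {1..n}" and h: "smooth_fun_on A UNIV h"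
  shows "br (\<phi> k) (d0 h) q = - br (fun_form h) (ext_d A (\<phi> k)) q"
proof -
  \<comment> \<open>For two 1-forms the sign in the graded antisymmetry is positive.\<close>
  have "br (\<phi> k) (d0 h) = br (d0 h) (\<phi> k)"
    by (subst br_sym[OF Omega_phi Omega_diff_fun[OF h]]) simp
  moreover have "ext_d A (br (fun_form h) (\<phi> k)) = br (d0 h) (\<phi> k) + br (fun_form h) (ext_d A (\<phi> k))"
    using ext_d_br[OF Omega_fun_form[OF h] Omega_phi] by simp
  moreover have "ext_d A (br (fun_form h) (\<phi> k)) q = ext_d A 0 q"
    by (rule ext_d_cong, rule near_U[OF q]) (simp only: flat_phi[OF _ h k] form_zero)
  ultimately have "br (\<phi> k) (d0 h) q + br (fun_form h) (ext_d A (\<phi> k)) q = 0"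
    by (simp add: ext_d_0 form_apply)
  then show ?thesis by (simp add: eq_neg_iff_add_eq_0)
qed

text \<open>The derivative term of the Leibniz rule contains {\<phi>_k, g}, which vanishes on
  \<open>U\<close>; hence the bracket with \<phi>_k is linear over functions there.\<close>

lemma br_phi_fmul:
  assumes q: "q \<in> U" and k: "k \<in> {1..n}" and g: "smooth_fun_on A UNIV g" and t: "\<tau> \<in> Omega A 1"
  shows "br (\<phi> k) (fmul g \<tau>) q = g q *\<^sub>R br (\<phi> k) \<tau> q"
proof -
  have "br (\<phi> k) (fun_form g) q = 0"
    using flat_phi[OF q g k] by (subst br_sym[OF Omega_phi Omega_fun_form[OF g]]) (simp add: form_apply)
  then show ?thesis
    by (simp add: br_fmul[OF Omega_phi g t] form_apply fmul_apply wedge_apply alt_wedge_0_left)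
qed

text \<open>By \<open>br_phi_fmul\<close> the coefficients of \<phi>_j come out undifferentiated,
  and \<open>br_phi_diff_fun\<close> leaves exactly the combination that defines
  \<open>nabla j\<close>.\<close>

lemma br_phi_phi:
  assumes q: "q \<in> U" and k: "k \<in> {1..n}"
  shows "br (\<phi> j) (\<phi> k) q + nabla j (ext_d A (\<phi> k)) q = 0"
proof -
  have O: "(\<Sum>l=1..n. fmul (Q j l) (d0 (X l))) \<in> Omega A 1" "(\<Sum>u=1..m. fmul (C j u) (d0 (Y u))) \<in> Omega A 1"
    by (intro Omega_sum Omega_fmul smooth_Q smooth_C Omega_X Omega_Y)+
  have "br (\<phi> j) (\<phi> k) = br (\<phi> k) (\<phi> j)"
    by (subst br_sym[OF Omega_phi Omega_phi]) simp
  also have "br (\<phi> k) (\<phi> j) = (\<Sum>l=1..n. br (\<phi> k) (fmul (Q j l) (d0 (X l)))) + (\<Sum>u=1..m. br (\<phi> k) (fmul (C j u) (d0 (Y u))))"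
    unfolding phi[of j] br_add[OF Omega_phi O]
    by (intro arg_cong2[where f = "(+)"] br_sum[OF Omega_phi, where l = 1] Omega_fmul smooth_Q smooth_C Omega_X Omega_Y)
  finally have "br (\<phi> j) (\<phi> k) q = - nabla j (ext_d A (\<phi> k)) q"
    by (simp add: form_apply br_phi_fmul[OF q k] smooth_Q smooth_C Omega_X Omega_Y br_phi_diff_fun[OF q k]
        smooth_X smooth_Y nabla_apply sum_negf)
  then show ?thesis by simp
qed

lemma nabla_0: "nabla k 0 = 0"
  by (rule ext) (simp add: nabla_apply br_0[OF Omega_fun_form] smooth_X smooth_Y form_zero)

text \<open>\<open>Yv\<close> is meaningful on \<open>U\<close> only, whereas \<open>nabla\<close>
  acts on global forms; the parameter \<open>R\<close> is a globally smooth function that agrees on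
  \<open>U\<close> with the dy\<and>dy coefficient.\<close>

lemma mc_phi_formula:
  assumes q: "q \<in> U" and j: "j \<in> {1..n}" and k: "k \<in> {1..n}"
    and R: "\<And>u v. smooth_fun_on A UNIV (R u v)"
      "\<And>p u v. p \<in> U \<Longrightarrow> u \<in> {1..m} \<Longrightarrow> v \<in> {1..m} \<Longrightarrow>
        R u v p = (\<Sum>l=1..n. Q k l p * (Yv u (a l v) p - Yv v (a l u) p))"
  shows "mc q (\<phi> i q) (\<phi> j q) (\<phi> k q) =
    - (\<Sum>l=1..n. \<Sum>l'\<in>{l<..n}. delta i (delta j (delta k (P l l'))) q *\<^sub>R alt_wedge (\<phi> l q) (\<phi> l' q))
    + (\<Sum>l=1..n. \<Sum>u=1..m. delta i (delta j (delta k (a l u))) q *\<^sub>R alt_wedge (\<phi> l q) (d0 (Y u) q))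
    - (\<Sum>u=1..m. \<Sum>v\<in>{u<..m}. delta i (delta j (R u v)) q *\<^sub>R alt_wedge (d0 (Y u) q) (d0 (Y v) q))"
proof -
  let ?S1 = "SIGMA l:{1..n}. {l<..n}" and ?S2 = "{1..n} \<times> {1..m}" and ?S3 = "SIGMA u:{1..m}. {u<..m}"
  let ?G1 = "\<lambda>s. delta k (P (fst s) (snd s))" and ?w1 = "\<lambda>s. wedge (\<phi> (fst s)) (\<phi> (snd s))"
  let ?G2 = "\<lambda>s. delta k (a (fst s) (snd s))" and ?w2 = "\<lambda>s. wedge (\<phi> (fst s)) (d0 (Y (snd s)))"
  let ?G3 = "\<lambda>s. R (fst s) (snd s)" and ?w3 = "\<lambda>s. wedge (d0 (Y (fst s))) (d0 (Y (snd s)))"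
  define \<tau>1 where "\<tau>1 = (\<Sum>s\<in>?S1. fmul (?G1 s) (?w1 s))"
  define \<tau>2 where "\<tau>2 = (\<Sum>s\<in>?S2. fmul (?G2 s) (?w2 s))"
  define \<tau>3 where "\<tau>3 = (\<Sum>s\<in>?S3. fmul (?G3 s) (?w3 s))"
  have G: "smooth_fun_on A UNIV (?G1 s)" "smooth_fun_on A UNIV (?G2 s)" "smooth_fun_on A UNIV (?G3 s)" for s
    by (intro smooth_delta smooth_P smooth_a R(1))+
  have w1: "parallel_2form (?w1 s)" if "s \<in> ?S1" for s
    by (rule parallel_wedge[OF Omega_phi Omega_phi flat_phi flat_phi]) (use that in auto)
  have w2: "parallel_2form (?w2 s)" if "s \<in> ?S2" for s
    by (rule parallel_wedge[OF Omega_phi Omega_Y flat_phi flat_dY]) (use that in auto)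
  have w3: "parallel_2form (?w3 s)" if "s \<in> ?S3" for s
    by (rule parallel_wedge[OF Omega_Y Omega_Y flat_dY flat_dY]) (use that in auto)
  have O: "\<tau>1 \<in> Omega A 2" "\<tau>2 \<in> Omega A 2" "\<tau>3 \<in> Omega A 2"
    unfolding \<tau>1_def \<tau>2_def \<tau>3_def
    by (intro Omega_sum Omega_fmul G Omega_wedge Omega_phi Omega_Y)+
  \<comment> \<open>With the mixed part on the left, additivity of \<open>nabla\<close> suffices.
    The equality holds on all of \<open>U\<close>, so \<open>nabla j\<close> and then
    \<open>nabla i\<close> may be applied.\<close>
  have "(ext_d A (\<phi> k) + \<tau>2) p = (\<tau>1 + \<tau>3) p" if p: "p \<in> U" for p
  proof -
    have "\<tau>1 p = (\<Sum>l=1..n. \<Sum>l'\<in>{l<..n}. delta k (P l l') p *\<^sub>R alt_wedge (\<phi> l p) (\<phi> l' p))"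
      by (simp add: \<tau>1_def form_apply fmul_apply wedge_apply sum.Sigma case_prod_unfold)
    moreover have "\<tau>2 p = (\<Sum>l=1..n. \<Sum>u=1..m. delta k (a l u) p *\<^sub>R alt_wedge (\<phi> l p) (d0 (Y u) p))"
      by (simp add: \<tau>2_def form_apply fmul_apply wedge_apply sum.Sigma case_prod_unfold)
    moreover have "\<tau>3 p = (\<Sum>u=1..m. \<Sum>v\<in>{u<..m}. R u v p *\<^sub>R alt_wedge (d0 (Y u) p) (d0 (Y v) p))"
      by (simp add: \<tau>3_def form_apply fmul_apply wedge_apply sum.Sigma case_prod_unfold)
    moreover have "\<dots> = (\<Sum>u=1..m. \<Sum>v\<in>{u<..m}. (\<Sum>l=1..n. Q k l p * (Yv u (a l v) p - Yv v (a l u) p)) *\<^sub>R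
        alt_wedge (d0 (Y u) p) (d0 (Y v) p))"
      by (intro sum.cong refl) (simp add: R(2)[OF p])
    ultimately show ?thesis using ext_d_phi_frame[OF p k] by (simp only: form_plus)
  qed
  note nabla_local[OF Omega_add[OF Omega_ext_d_phi O(2)] Omega_add[OF O(1,3)] this, of _ j]
  then have "(nabla j (ext_d A (\<phi> k)) + nabla j \<tau>2) p = (nabla j \<tau>1 + nabla j \<tau>3) p" if "p \<in> U" for p
    using that by (simp add: nabla_add Omega_ext_d_phi O)
  note nabla_local[OF Omega_add[OF Omega_nabla[OF Omega_ext_d_phi] Omega_nabla[OF O(2)]]
      Omega_add[OF Omega_nabla[OF O(1)] Omega_nabla[OF O(3)]] this q, of i]
  then have 1: "nabla i (nabla j (ext_d A (\<phi> k))) q + nabla i (nabla j \<tau>2) q =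
      nabla i (nabla j \<tau>1) q + nabla i (nabla j \<tau>3) q"
    unfolding nabla_add[OF Omega_nabla[OF Omega_ext_d_phi] Omega_nabla[OF O(2)]]
      nabla_add[OF Omega_nabla[OF O(1)] Omega_nabla[OF O(3)]]
    by (simp only: form_plus)
  have Obr: "br (\<phi> j) (\<phi> k) \<in> Omega A 2"
    using br_Omega[OF Omega_phi Omega_phi, of j k] by simp
  have "nabla i (br (\<phi> j) (\<phi> k) + nabla j (ext_d A (\<phi> k))) q = nabla i 0 q"
    by (rule nabla_local[OF Omega_add[OF Obr Omega_nabla[OF Omega_ext_d_phi]] Omega_0 _ q])
      (simp add: form_apply br_phi_phi[OF _ k])
  then have 2: "nabla i (br (\<phi> j) (\<phi> k)) q + nabla i (nabla j (ext_d A (\<phi> k))) q = 0"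
    unfolding nabla_add[OF Obr Omega_nabla[OF Omega_ext_d_phi]] nabla_0
    by (simp only: form_apply)
  have N: "nabla i (nabla j \<tau>1) q = (\<Sum>s\<in>?S1. delta i (delta j (?G1 s)) q *\<^sub>R ?w1 s q)"
    "nabla i (nabla j \<tau>2) q = (\<Sum>s\<in>?S2. delta i (delta j (?G2 s)) q *\<^sub>R ?w2 s q)"
    "nabla i (nabla j \<tau>3) q = (\<Sum>s\<in>?S3. delta i (delta j (?G3 s)) q *\<^sub>R ?w3 s q)"
    unfolding \<tau>1_def \<tau>2_def \<tau>3_def
    by (rule nabla_nabla_sum[OF w1 G(1) q] nabla_nabla_sum[OF w2 G(2) q] nabla_nabla_sum[OF w3 G(3) q]; assumption)+
  have "mc q (\<phi> i q) (\<phi> j q) (\<phi> k q) = - nabla i (nabla j (ext_d A (\<phi> k))) q"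
    using 2 by (simp add: mc_phi[OF q j k] eq_neg_iff_add_eq_0)
  also have "\<dots> = - nabla i (nabla j \<tau>1) q + nabla i (nabla j \<tau>2) q - nabla i (nabla j \<tau>3) q"
    using 1 by (simp add: algebra_simps eq_diff_eq)
  also have "nabla i (nabla j \<tau>1) q =
      (\<Sum>l=1..n. \<Sum>l'\<in>{l<..n}. delta i (delta j (delta k (P l l'))) q *\<^sub>R alt_wedge (\<phi> l q) (\<phi> l' q))"
    by (simp add: N(1) wedge_apply sum.Sigma case_prod_unfold)
  also have "nabla i (nabla j \<tau>2) q =
      (\<Sum>l=1..n. \<Sum>u=1..m. delta i (delta j (delta k (a l u))) q *\<^sub>R alt_wedge (\<phi> l q) (d0 (Y u) q))"
    by (simp add: N(2) wedge_apply sum.Sigma case_prod_unfold)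
  also have "nabla i (nabla j \<tau>3) q =
      (\<Sum>u=1..m. \<Sum>v\<in>{u<..m}. delta i (delta j (R u v)) q *\<^sub>R alt_wedge (d0 (Y u) q) (d0 (Y v) q))"
    by (simp add: N(3) wedge_apply sum.Sigma case_prod_unfold)
  finally show ?thesis .
qed

section \<open>Vanishing of the metacurvature on dy_u\<close>

lemma br_dY_fun:
  assumes q: "q \<in> U" and u: "u \<in> {1..m}" and g: "smooth_fun_on A UNIV g"
  shows "br (d0 (Y u)) (fun_form g) q = 0"
  using flat_dY[OF q g u] by (subst br_sym[OF Omega_Y Omega_fun_form[OF g]]) (simp add: form_apply)

text \<open>{y_u, h} vanishes on \<open>U\<close> because dy_u is in the kernel of the anchor.
  Applying d leaves {dy_u, h}, already known to vanish, and the bracket in question.\<close>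

lemma br_Y_diff_fun:
  assumes q: "q \<in> U" and u: "u \<in> {1..m}" and h: "smooth_fun_on A UNIV h"
  shows "br (fun_form (Y u)) (d0 h) q = 0"
proof -
  have "ext_d A (br (fun_form (Y u)) (fun_form h)) q = ext_d A 0 q"
  proof (rule ext_d_cong, rule near_U[OF q])
    fix p assume "p \<in> U"
    then show "br (fun_form (Y u)) (fun_form h) p = 0 p"
      using u unfolding br_fun_fun[OF smooth_Y h]
      by (intro ext) (simp add: pb_Y fun_form_def form_zero zero_fun_apply)
  qed
  moreover have "ext_d A (br (fun_form (Y u)) (fun_form h)) = br (d0 (Y u)) (fun_form h) + br (fun_form (Y u)) (d0 h)"
    using ext_d_br[OF Omega_fun_form[OF smooth_Y] Omega_fun_form[OF h]] by simp
  ultimately show ?thesis by (simp add: ext_d_0 form_apply br_dY_fun[OF q u h])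
qed

text \<open>Apply d to the vanishing of {y_u, dh} on \<open>U\<close>; the second term of the
  derivation rule contains d d h = 0.\<close>

lemma br_dY_diff_fun:
  assumes q: "q \<in> U" and u: "u \<in> {1..m}" and h: "smooth_fun_on A UNIV h"
  shows "br (d0 (Y u)) (d0 h) q = 0"
proof -
  have "ext_d A (br (fun_form (Y u)) (d0 h)) q = ext_d A 0 q"
    by (rule ext_d_cong, rule near_U[OF q]) (simp add: br_Y_diff_fun[OF _ u h] form_zero)
  moreover have "ext_d A (br (fun_form (Y u)) (d0 h)) = br (d0 (Y u)) (d0 h)"
    using ext_d_br[OF Omega_fun_form[OF smooth_Y] Omega_diff_fun[OF h], of u]
    by (simp add: ext_d_diff_fun[OF h] br_0[OF Omega_fun_form[OF smooth_Y]])
  ultimately show ?thesis by (simp add: ext_d_0 form_apply)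
qed

text \<open>Linearity over functions, since {dy_u, g} = 0 on \<open>U\<close>; with
  \<open>br_dY_diff_fun\<close> it makes {dy_u, .} vanish on every combination of dx_l and dy_v, in
  particular on \<phi>_k.\<close>

lemma br_dY_fmul:
  assumes q: "q \<in> U" and u: "u \<in> {1..m}" and g: "smooth_fun_on A UNIV g" and t: "\<tau> \<in> Omega A 1"
  shows "br (d0 (Y u)) (fmul g \<tau>) q = g q *\<^sub>R br (d0 (Y u)) \<tau> q"
  by (simp add: br_fmul[OF Omega_Y g t] form_apply fmul_apply wedge_apply br_dY_fun[OF q u g] alt_wedge_0_left)

lemma br_Y_fmul:
  assumes q: "q \<in> U" and u: "u \<in> {1..m}" and g: "smooth_fun_on A UNIV g" and t: "\<tau> \<in> Omega A 1"
  shows "br (fun_form (Y u)) (fmul g \<tau>) q = g q *\<^sub>R br (fun_form (Y u)) \<tau> q"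
  using pb_Y[OF q u, of g] by (simp add: br_fun_fmul[OF smooth_Y g t] form_apply fmul_apply)

lemma br_dY_phi:
  assumes q: "q \<in> U" and u: "u \<in> {1..m}"
  shows "br (d0 (Y u)) (\<phi> k) q = 0"
proof -
  have O: "(\<Sum>l=1..n. fmul (Q k l) (d0 (X l))) \<in> Omega A 1" "(\<Sum>u=1..m. fmul (C k u) (d0 (Y u))) \<in> Omega A 1"
    by (intro Omega_sum Omega_fmul smooth_Q smooth_C Omega_X Omega_Y)+
  have "br (d0 (Y u)) (\<phi> k) = (\<Sum>l=1..n. br (d0 (Y u)) (fmul (Q k l) (d0 (X l)))) + (\<Sum>v=1..m. br (d0 (Y u)) (fmul (C k v) (d0 (Y v))))"
    unfolding phi[of k] br_add[OF Omega_Y O]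
    by (intro arg_cong2[where f = "(+)"] br_sum[OF Omega_Y, where l = 1] Omega_fmul smooth_Q smooth_C Omega_X Omega_Y)
  then show ?thesis
    by (simp add: form_apply br_dY_fmul[OF q u] smooth_Q smooth_C Omega_X Omega_Y br_dY_diff_fun[OF q u] smooth_X smooth_Y)
qed

text \<open>By \<open>br_fun_dX\<close> the inner bracket is on \<open>U\<close> a combination of
  the parallel coframe, and the bracket with \<sigma> is linear over functions there and kills the
  coframe.\<close>

lemma br_Y_annihilates:
  assumes q: "q \<in> U" and u: "u \<in> {1..m}" and h: "smooth_fun_on A UNIV h" and l: "l \<in> {1..n}"
    and \<sigma>: "\<sigma> = fun_form (Y u) \<or> \<sigma> = d0 (Y u)"
  shows "br \<sigma> (br (fun_form h) (d0 (X l))) q = 0"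
proof -
  obtain k where O\<sigma>: "\<sigma> \<in> Omega A k" using \<sigma> Omega_fun_form[OF smooth_Y] Omega_Y by blast
  have O: "(\<Sum>i=1..n. fmul (pb h (P l i)) (\<phi> i)) \<in> Omega A 1" "(\<Sum>u=1..m. fmul (pb h (a l u)) (d0 (Y u))) \<in> Omega A 1"
    "br (fun_form h) (d0 (X l)) \<in> Omega A 1"
    by (intro Omega_sum Omega_fmul Omega_phi Omega_Y smooth_pb smooth_P smooth_a h br_fun_Omega Omega_X)+
  have fm: "br \<sigma> (fmul g \<tau>) q = g q *\<^sub>R br \<sigma> \<tau> q" if "smooth_fun_on A UNIV g" "\<tau> \<in> Omega A 1" for g \<tau>
    using \<sigma> br_dY_fmul[OF q u that] br_Y_fmul[OF q u that] by blast
  have z: "br \<sigma> (\<phi> i) q = 0" if "i \<in> {1..n}" for i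
    using \<sigma> br_dY_phi[OF q u] flat_phi[OF q smooth_Y that] by blast
  have z': "br \<sigma> (d0 (Y v)) q = 0" if "v \<in> {1..m}" for v
    using \<sigma> br_dY_diff_fun[OF q u smooth_Y] flat_dY[OF q smooth_Y that] by blast
  have "br \<sigma> (\<Sum>i=1..n. fmul (pb h (P l i)) (\<phi> i)) q =
      br \<sigma> (br (fun_form h) (d0 (X l)) + (\<Sum>u=1..m. fmul (pb h (a l u)) (d0 (Y u)))) q"
    by (rule br_local[OF O\<sigma> O(1) Omega_add[OF O(3,2)]], rule near_U[OF q])
      (simp only: form_apply fmul_apply br_fun_dX[OF _ h l])
  moreover have "br \<sigma> (\<Sum>i=1..n. fmul (pb h (P l i)) (\<phi> i)) q = 0"
    by (simp add: br_sum[OF O\<sigma>, where l = 1] Omega_fmul Omega_phi smooth_pb smooth_P h form_apply fm z)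
  moreover have "br \<sigma> (\<Sum>u=1..m. fmul (pb h (a l u)) (d0 (Y u))) q = 0"
    by (simp add: br_sum[OF O\<sigma>, where l = 1] Omega_fmul Omega_Y smooth_pb smooth_a h form_apply fm z')
  ultimately show ?thesis by (simp add: br_add[OF O\<sigma> O(3,2)] form_apply)
qed

text \<open>With w = {h, dh'} one has {dh, dh'} = dw, and {y_u, dw} = d{y_u, w} - {dy_u, w}, where
  both brackets with w vanish on \<open>U\<close>. The two correction terms contain {y_u, dh} and
  {y_u, dh'}.\<close>

lemma mc_dY_generators:
  assumes q: "q \<in> U" and u: "u \<in> {1..m}" and h: "smooth_fun_on A UNIV h"
    and h': "(\<exists>l\<in>{1..n}. h' = X l) \<or> (\<exists>v\<in>{1..m}. h' = Y v)"
  shows "mc q (d0 (Y u) q) (d0 h q) (d0 h' q) = 0"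
proof -
  have sh': "smooth_fun_on A UNIV h'" using h' smooth_X smooth_Y by blast
  note O = Omega_diff_fun[OF h] Omega_diff_fun[OF sh']
  let ?Y = "fun_form (Y u)" and ?w = "br (fun_form h) (d0 h')"
  note OY = Omega_fun_form[OF smooth_Y, of u]
  have Ow: "?w \<in> Omega A 1" by (rule br_fun_Omega[OF h O(2)])
  have zero: "br \<sigma> ?w p = 0" if p: "p \<in> U" and \<sigma>: "\<sigma> = ?Y \<or> \<sigma> = d0 (Y u)" for p \<sigma>
  proof (cases "\<exists>l\<in>{1..n}. h' = X l")
    case True
    then show ?thesis using br_Y_annihilates[OF p u h _ \<sigma>] by blast
  next
    case False
    then obtain v where v: "v \<in> {1..m}" "h' = Y v" using h' by blast
    have "\<forall>\<^sub>F p' in nhds p. ?w p' = 0"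
      by (rule near_U[OF p]) (use v flat_dY[OF _ h] in auto)
    then show ?thesis using \<sigma> br_local_0[OF OY Ow] br_local_0[OF Omega_Y Ow] by blast
  qed
  have "br (d0 h) (d0 h') = ext_d A ?w"
    using ext_d_br[OF Omega_fun_form[OF h] O(2)] by (simp add: ext_d_diff_fun[OF sh'] br_0[OF Omega_fun_form[OF h]])
  moreover have "br ?Y (ext_d A ?w) q = 0"
  proof -
    have "ext_d A (br ?Y ?w) q = ext_d A 0 q"
      by (rule ext_d_cong, rule near_U[OF q]) (simp add: zero form_zero)
    moreover have "ext_d A (br ?Y ?w) = br (d0 (Y u)) ?w + br ?Y (ext_d A ?w)"
      using ext_d_br[OF OY Ow] by simp
    ultimately show ?thesis using zero[OF q] by (simp add: ext_d_0 form_apply)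
  qed
  moreover have "br (br ?Y (d0 h)) (d0 h') q = 0"
    by (rule br_local_0_left[OF br_fun_Omega[OF smooth_Y O(1)] O(2)], rule near_U[OF q]) (rule br_Y_diff_fun[OF _ u h])
  moreover have "br (d0 h) (br ?Y (d0 h')) q = 0"
    by (rule br_local_0[OF O(1) br_fun_Omega[OF smooth_Y O(2)]], rule near_U[OF q]) (rule br_Y_diff_fun[OF _ u sh'])
  ultimately show ?thesis by (simp add: mc_diff_fun[OF smooth_Y O])
qed

lemma mc_frame_0:
  assumes q: "q \<in> U" and c: "\<beta> \<in> cotangent_space A q" "b \<in> cotangent_space A q" "c \<in> cotangent_space A q"
    and z: "\<And>h. (\<exists>l\<in>{1..n}. h = X l) \<or> (\<exists>v\<in>{1..m}. h = Y v) \<Longrightarrow> mc q (d0 h q) b c = 0"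
  shows "mc q \<beta> b c = 0"
proof -
  have "mc q (d0 (X l) q) b c = 0" if "l \<in> {1..n}" for l using z that by blast
  moreover have "mc q (d0 (Y v) q) b c = 0" if "v \<in> {1..m}" for v using z that by blast
  ultimately show ?thesis
    by (subst expansion[OF q c(1)]) (simp add: mc_frame_sum[OF c(2,3)])
qed

text \<open>Linearity is available in the first argument only; symmetry brings \<beta> and \<gamma>
  there in turn, so frame differentials suffice.\<close>

lemma mc_dY:
  assumes q: "q \<in> U" and u: "u \<in> {1..m}" and b: "\<beta> \<in> cotangent_space A q" and c: "\<gamma> \<in> cotangent_space A q"
  shows "mc q (d0 (Y u) q) \<beta> \<gamma> = 0"
proof -
  let ?y = "d0 (Y u) q"
  have y: "?y \<in> cotangent_space A q" by (rule diff_fun_cotangent)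
  have "mc q \<beta> ?y \<gamma> = 0"
  proof (rule mc_frame_0[OF q b y c])
    fix h assume h: "(\<exists>l\<in>{1..n}. h = X l) \<or> (\<exists>v\<in>{1..m}. h = Y v)"
    have ch: "d0 h q \<in> cotangent_space A q" by (rule diff_fun_cotangent)
    have "mc q \<gamma> ?y (d0 h q) = 0"
    proof (rule mc_frame_0[OF q c y ch])
      fix h' assume "(\<exists>l\<in>{1..n}. h' = X l) \<or> (\<exists>v\<in>{1..m}. h' = Y v)"
      then have "smooth_fun_on A UNIV h'" using smooth_X smooth_Y by blast
      from mc_dY_generators[OF q u this h]
      show "mc q (d0 h' q) ?y (d0 h q) = 0" using mc_sym(1)[OF y diff_fun_cotangent ch, of h'] by simp
    qed
    then show "mc q (d0 h q) ?y \<gamma> = 0"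
      using mc_sym(1)[OF c y ch] mc_sym(2)[OF y c ch] mc_sym(1)[OF ch y c] by simp
  qed
  then show ?thesis using mc_sym(1)[OF b y c] by simp
qed

end

theorem theorem3p8:
  fixes A :: "('a::{t2_space, second_countable_topology}, 'e::euclidean_space) atlas"
    and \<pi> :: "'a bivector" and D br :: "'a form_op"
    and mc :: "'a \<Rightarrow> 'a alt \<Rightarrow> 'a alt \<Rightarrow> 'a alt \<Rightarrow> 'a alt"
    and x :: 'a and r d :: nat
    and W N :: "'a set" and H :: "'a \<Rightarrow> 'a alt set"
    and c :: "('a, 'e) chart" and b :: "nat \<Rightarrow> 'e"
    and dx dy \<phi> :: "nat \<Rightarrow> 'a form"
    and Dx Dy :: "nat \<Rightarrow> ('a \<Rightarrow> real) \<Rightarrow> 'a \<Rightarrow> real"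
    and a pl pu :: "nat \<Rightarrow> nat \<Rightarrow> 'a \<Rightarrow> real"
  assumes manifold: "smooth_atlas A"
    and d: "d = DIM('e)"
    and poisson: "poisson A \<pi>"
    and connection: "contravariant_connection A \<pi> D"
    and flat: "flat A \<pi> D"
    and torsion_free: "torsion_free A \<pi> D"
    and F_reg: "F_reg_connection A \<pi> D"
    and bracket: "hawkins_bracket A \<pi> D br"
    and metacurvature: "metacurvature A br mc"
    and x_regular: "x \<in> regular_set A \<pi>"
    and x_rank: "poisson_rank A \<pi> x = 2 * r"
    and W: "open W" "x \<in> W"
    and H: "invariant_complement A \<pi> D W H"
    and coords: "flat_coords A \<pi> D r x c b"
    and dx: "\<And>i. dx i = coord_d A c b i"
    and dy: "\<And>u. dy u = coord_d A c b (2 * r + u)"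
    and Dx: "\<And>i. Dx i = partial_deriv A c b i"
    and Dy: "\<And>u. Dy u = partial_deriv A c b (2 * r + u)"
    and \<phi>: "\<And>i. \<phi> i = phi_form A \<pi> H c b i"
    and N: "open N" "x \<in> N" "N \<subseteq> W \<inter> fst c"
    and a: "\<And>i. i \<in> {1..2*r} \<Longrightarrow>
      bundle_section_on A N H (dx i + (\<Sum>u=1..d-2*r. fmul (a i u) (dy u)))"
    and pl: "\<And>i j. pl i j = (\<lambda>q. \<pi> q (dx i q) (dx j q))"
    and pu: "\<And>q. q \<in> N \<Longrightarrow> inverse_matrix (2*r) (\<lambda>i j. pl i j q) (\<lambda>i j. pu i j q)"
  shows "\<forall>\<^sub>F q in nhds x.
    (\<forall>u\<in>{1..d-2*r}. \<forall>\<beta>\<in>cotangent_space A q. \<forall>\<gamma>\<in>cotangent_space A q. mc q (dy u q) \<beta> \<gamma> = 0) \<and>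
    (\<forall>i\<in>{1..2*r}. \<forall>j\<in>{1..2*r}. \<forall>k\<in>{1..2*r}.
       mc q (\<phi> i q) (\<phi> j q) (\<phi> k q) =
         - (\<Sum>l=1..2*r. \<Sum>m\<in>{l<..2*r}.
              Dx i (Dx j (Dx k (pl l m))) q *\<^sub>R alt_wedge (\<phi> l q) (\<phi> m q))
         + (\<Sum>l=1..2*r. \<Sum>u=1..d-2*r.
              Dx i (Dx j (Dx k (a l u))) q *\<^sub>R alt_wedge (\<phi> l q) (dy u q))
         + (\<Sum>u=1..d-2*r. \<Sum>v\<in>{u<..d-2*r}. \<Sum>l=1..2*r.
              Dx i (Dx j (\<lambda>p. pu k l p *
                (Dy v (a l u) p - Dy u (a l v) p +
                 (\<Sum>m=1..2*r. a m u p * Dx m (a l v) p - a m v p * Dx m (a l u) p)))) q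
              *\<^sub>R alt_wedge (dy u q) (dy v q)))"
proof -

  \<comment> \<open>Neighbourhoods, bump function and coordinate vectors\<close>
  let ?n = "2 * r" and ?m = "d - 2 * r"
  interpret hawkins_manifold A \<pi> D br
    by unfold_locales (use manifold poisson bracket in \<open>auto simp: poisson_def\<close>)
  have c: "smooth_chart A c" and b: "bij_betw b {1..DIM('e)} Basis" and rd: "?n \<le> DIM('e)"
    and leaf: "\<And>q. q \<in> fst c \<Longrightarrow> TS A \<pi> q = span ((\<lambda>i. coord_vec A c b i q) ` {1..?n})"
    and ker: "\<And>q. q \<in> fst c \<Longrightarrow> anchor_ker A \<pi> q = span ((\<lambda>u. coord_d A c b (?n + u) q) ` {1..?m})"
    using coords by (simp_all add: flat_coords_def foliated_coords_def d)
  have dim: "DIM('e) = ?n + ?m" using rd d by simp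
  note b' = b[unfolded dim]
  obtain V where V: "open V" "x \<in> V" "V \<subseteq> W \<inter> fst c"
    and par_phi: "\<And>i. i \<in> {1..?n} \<Longrightarrow> parallel_on A D V (\<phi> i)"
    and par_dy: "\<And>u. u \<in> {1..?m} \<Longrightarrow> parallel_on A D V (dy u)"
    using conjunct2[OF conjunct2[OF coords[unfolded flat_coords_def]], rule_format, OF W H]
    unfolding \<phi> dy d by (elim exE conjE) blast
  \<comment> \<open>On \<open>S\<close> both the parallel coframe, given on \<open>V\<close>, and
    the functions \<open>a\<close>, given on \<open>N\<close>, are available.\<close>
  define S where "S = V \<inter> N"
  have S: "open S" "x \<in> S" "S \<subseteq> fst c" "S \<subseteq> W" "S \<subseteq> V" "S \<subseteq> N" using V N by (auto simp: S_def)
  obtain \<eta> K where K: "closed K" "K \<subseteq> S" "smooth_fun_on A UNIV \<eta>" "\<And>q. q \<notin> K \<Longrightarrow> \<eta> q = 0"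
    "\<forall>\<^sub>F q in nhds x. \<eta> q = 1" using bump_function[OF S(1,2)] by metis
  obtain U where U: "open U" "x \<in> U" "\<And>q. q \<in> U \<Longrightarrow> \<eta> q = 1"
    using K(5) unfolding eventually_nhds by blast
  \<comment> \<open>\<eta> vanishes off \<open>K\<close>, so a point where it equals 1 lies in
    \<open>K\<close> and hence in \<open>S\<close>.\<close>
  have US: "q \<in> S" if "q \<in> U" for q using U(3)[OF that] K(2,4) by force
  have near: "\<forall>\<^sub>F p in nhds q. R p" if "q \<in> U" "\<And>p. p \<in> U \<Longrightarrow> R p" for q R
    by (rule eventually_mono[OF eventually_nhds_in_open[OF U(1) that(1)]]) (rule that(2))
  have cut: "smooth_fun_on A UNIV (\<lambda>q. \<eta> q * f q)" if "smooth_fun_on A S f" for f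
    by (rule smooth_fun_on_cut_off[OF K(1,2) S(1) K(3,4) that])
  define vx where "vx = (\<lambda>l. coord_vec A c b l)"
  define vy where "vy = (\<lambda>u. coord_vec A c b (?n + u))"
  have vt: "vx l q \<in> tangent_space A q" "vy l q \<in> tangent_space A q" for l q
    unfolding vx_def vy_def by (rule chart_vec_tangent[OF c])+
  have v_field: "smooth_vfield_on A S (vx l)" "smooth_vfield_on A S (vy l)" for l
    unfolding vx_def vy_def by (rule smooth_vfield_on_chart_vec[OF c S(3)])+
  have v_smooth: "smooth_fun_on A S (\<lambda>q. vx l q f)" "smooth_fun_on A S (\<lambda>q. vy l q f)"
    if "smooth_fun_on A S f" for f l
    using smooth_fun_on_chart_vec[OF c S(1,3) that] by (simp_all add: vx_def vy_def)
  have D_eq: "Dx l f q = vx l q f" "Dy l f q = vy l q f" for l f q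
    by (simp_all add: Dx Dy vx_def vy_def partial_deriv_def)

  \<comment> \<open>The complement, its sections \<phi>_k, and dual coordinate frames\<close>
  have "\<forall>q\<in>W. subspace (H q) \<and> H q \<subseteq> cotangent_space A q"
    using H unfolding invariant_complement_def smooth_subbundle_def by (elim conjE) assumption
  moreover have "\<forall>q\<in>W. anchor_ker A \<pi> q \<inter> H q = {0} \<and>
      {\<xi> + \<xi>' | \<xi> \<xi>'. \<xi> \<in> anchor_ker A \<pi> q \<and> \<xi>' \<in> H q} = cotangent_space A q"
    using H unfolding invariant_complement_def by (elim conjE) assumption
  ultimately have Hsub: "subspace (H q)" "H q \<subseteq> cotangent_space A q" "anchor_ker A \<pi> q \<inter> H q = {0}"
    "{\<xi> + \<xi>' | \<xi> \<xi>'. \<xi> \<in> anchor_ker A \<pi> q \<and> \<xi>' \<in> H q} = cotangent_space A q" if "q \<in> W" for q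
    using that by simp_all
  have vxTS: "vx k q \<in> TS A \<pi> q" if "q \<in> S" "k \<in> {1..?n}" for q k
    using that S(3) unfolding vx_def leaf[OF subsetD[OF S(3) that(1)]] by (intro span_base) blast
  have phiH: "\<phi> k q \<in> H q" "anchor A \<pi> q (\<phi> k q) = vx k q" if q: "q \<in> S" and k: "k \<in> {1..?n}" for q k
    using varpi[of q H, OF Hsub(4,2) vxTS[OF q k]] q S(4) by (auto simp: \<phi> phi_form_def vx_def)
  have cot_phi: "\<phi> k q \<in> cotangent_space A q" if "q \<in> S" "k \<in> {1..?n}" for q k
    using phiH(1)[OF that] Hsub(2) that(1) S(4) by blast
  have pair_phi: "\<pi> q (\<phi> k q) \<beta> = \<beta> [vx k q]"
    if "q \<in> S" "k \<in> {1..?n}" "\<beta> \<in> cotangent_space A q" for q k \<beta>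
    using anchor_pair[OF cot_phi[OF that(1,2)] that(3)] phiH(2)[OF that(1,2)] by simp
  have dyker: "dy u q \<in> anchor_ker A \<pi> q" if "q \<in> S" "u \<in> {1..?m}" for q u
    using that unfolding dy ker[OF subsetD[OF S(3) that(1)]] by (intro span_base) blast
  have pair_dy: "\<pi> q (dy u q) \<beta> = 0" if "q \<in> S" "u \<in> {1..?m}" "\<beta> \<in> cotangent_space A q" for q u \<beta>
    by (rule anchor_ker_pair[OF dyker[OF that(1,2)] that(3)])
  have cot_d: "dx l q \<in> cotangent_space A q" "dy u q \<in> cotangent_space A q" for l u q
    unfolding dx dy by (rule diff_fun_cotangent)+

  have cexp: "\<alpha> = (\<Sum>l=1..?n. \<alpha> [vx l q] *\<^sub>R dx l q) + (\<Sum>u=1..?m. \<alpha> [vy u q] *\<^sub>R dy u q)"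
    if "q \<in> S" "\<alpha> \<in> cotangent_space A q" for q \<alpha>
    using chart_frame_expansion[OF c b' _ that(2)] that(1) S(3) unfolding dx dy vx_def vy_def by blast
  have dual: "l \<in> {1..?n} \<Longrightarrow> dx l q [vx i q] = (if i = l then 1 else 0)"
    "u \<in> {1..?m} \<Longrightarrow> dy u q [vx i q] = 0"
    if "q \<in> S" "i \<in> {1..?n}" for q i l u
    using coord_vec_coord[OF c b' subsetD[OF S(3) that(1)]] that(2) vt(1)[of i q]
    by (simp_all add: dx dy diff_fun_apply vx_def)
  have dual': "l \<in> {1..?n} \<Longrightarrow> dx l q [vy v q] = 0"
    "u \<in> {1..?m} \<Longrightarrow> dy u q [vy v q] = (if v = u then 1 else 0)"
    if "q \<in> S" "v \<in> {1..?m}" for q v l u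
    using coord_vec_coord[OF c b' subsetD[OF S(3) that(1)]] that(2) vt(2)[of v q]
    by (simp_all add: dx dy diff_fun_apply vy_def)

  \<comment> \<open>Globally smooth replacements of the local data\<close>
  define X where "X = (\<lambda>l q. \<eta> q * coord c b l q)"
  define Y where "Y = (\<lambda>u q. \<eta> q * coord c b (?n + u) q)"
  have smooth_X: "smooth_fun_on A UNIV (X l)" and smooth_Y: "smooth_fun_on A UNIV (Y l)" for l
    unfolding X_def Y_def by (rule cut[OF smooth_fun_on_subset[OF smooth_coord[OF c] S(3)]])+
  have dX: "diff_fun A (X l) q = dx l q" and dY: "diff_fun A (Y l) q = dy l q" if q: "q \<in> U" for q l
    unfolding dx dy by (rule diff_fun_cong, rule near[OF q], simp add: X_def Y_def U(3))+
  \<comment> \<open>Smoothness of \<open>pu\<close> is not given, so the inverse matrix enters as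
    the dx-components of \<phi>_k, which are smooth; \<open>Q_pu\<close> identifies the two on
    \<open>U\<close>. The value 0 at other indices serves because the locale demands smoothness for
    every index.\<close>
  define Q where "Q = (\<lambda>k l. if k \<in> {1..?n} then (\<lambda>q. \<eta> q * \<phi> k q [vx l q]) else (\<lambda>q. 0))"
  define C where "C = (\<lambda>k u. if k \<in> {1..?n} then (\<lambda>q. \<eta> q * \<phi> k q [vy u q]) else (\<lambda>q. 0))"
  define \<psi> where "\<psi> = (\<lambda>k. (\<Sum>l=1..?n. fmul (Q k l) (diff_fun A (X l))) + (\<Sum>u=1..?m. fmul (C k u) (diff_fun A (Y u))))"
  have form_phi: "smooth_form_on A S 1 (\<phi> k)" if "k \<in> {1..?n}" for k
    using par_phi[OF that] smooth_form_subset[OF _ S(5)] unfolding parallel_on_def by blast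
  have phi_v: "smooth_fun_on A S (\<lambda>q. \<phi> k q [vx l q])" "smooth_fun_on A S (\<lambda>q. \<phi> k q [vy l q])"
    if "k \<in> {1..?n}" for k l
    by (rule smooth_form_eval[OF form_phi[OF that] S(1) order_refl] v_field)+
  have smooth_Q: "smooth_fun_on A UNIV (Q k l)" and smooth_C: "smooth_fun_on A UNIV (C k l)" for k l
    unfolding Q_def C_def using cut phi_v by (simp_all add: smooth_fun_on_const)
  have psi_U: "\<psi> k q = \<phi> k q" if q: "q \<in> U" and k: "k \<in> {1..?n}" for q k
    using cexp[OF US[OF q] cot_phi[OF US[OF q] k]] k
    by (simp add: \<psi>_def form_apply fmul_apply dX dY q Q_def C_def U(3))
  define P where "P = (\<lambda>l i. pb (X l) (X i))"
  have smooth_P: "smooth_fun_on A UNIV (P l i)" for l i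
    unfolding P_def by (rule smooth_pb[OF smooth_X smooth_X])
  have P_pl: "P l i q = pl l i q" if "q \<in> U" for l i q
    by (simp add: P_def poisson_bracket_def pl dX that)
  define \<theta> where "\<theta> = (\<lambda>l. dx l + (\<Sum>u=1..?m. fmul (a l u) (dy u)))"
  have theta_H: "smooth_form_on A S 1 (\<theta> l)" "\<And>q. q \<in> S \<Longrightarrow> \<theta> l q \<in> H q" if "l \<in> {1..?n}" for l
    using a[OF that] S(6) smooth_form_subset unfolding bundle_section_on_def \<theta>_def by blast+
  have theta_apply: "\<theta> l q = dx l q + (\<Sum>u=1..?m. a l u q *\<^sub>R dy u q)" for l q
    by (simp add: \<theta>_def form_apply fmul_apply)
  \<comment> \<open>\<open>a l u\<close> is the component of a smooth section along the coordinate
    vector of y_u; this is where its smoothness comes from.\<close>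
  have a_theta: "\<theta> l q [vy u q] = a l u q" if "q \<in> S" "l \<in> {1..?n}" "u \<in> {1..?m}" for q l u
    using that by (simp add: theta_apply plus_fun_apply sum_fun_apply scaleR_fun_def dual'
        if_distrib[of "\<lambda>x. _ * x"] cong: if_cong)
  have smooth_aS: "smooth_fun_on A S (a l u)" if "l \<in> {1..?n}" "u \<in> {1..?m}" for l u
    by (rule smooth_fun_on_cong[OF S(1) smooth_form_eval[OF theta_H(1)[OF that(1)] S(1) order_refl v_field(2)]])
      (rule a_theta[OF _ that])
  define a' where "a' = (\<lambda>l u. if l \<in> {1..?n} \<and> u \<in> {1..?m} then (\<lambda>q. \<eta> q * a l u q) else (\<lambda>q. 0))"
  have smooth_a': "smooth_fun_on A UNIV (a' l u)" for l u
    unfolding a'_def using cut smooth_aS by (simp add: smooth_fun_on_const)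
  have a'_U: "a' l u q = a l u q" if "q \<in> U" "l \<in> {1..?n}" "u \<in> {1..?m}" for l u q
    using that by (simp add: a'_def U(3))
  have theta_phi: "(\<Sum>i=1..?n. pl l i q *\<^sub>R \<phi> i q) = \<theta> l q" if q: "q \<in> S" and l: "l \<in> {1..?n}" for q l
  proof -
    let ?\<xi> = "\<Sum>i=1..?n. pl l i q *\<^sub>R \<phi> i q"
    have qW: "q \<in> W" using q S(4) by blast
    have cth: "\<theta> l q \<in> cotangent_space A q" using theta_H(2)[OF l q] Hsub(2)[OF qW] by blast
    have c\<xi>: "?\<xi> \<in> cotangent_space A q" by (intro alt_space_sum alt_space_scaleR cot_phi q) auto
    have pth: "\<pi> q (\<theta> l q) \<beta> = \<pi> q (dx l q) \<beta>" if \<beta>: "\<beta> \<in> cotangent_space A q" for \<beta>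
      unfolding theta_apply
      by (simp add: pi_add pi_sum alt_space_sum alt_space_scaleR cot_d \<beta> pair_dy[OF q _ \<beta>])
    have p\<xi>: "\<pi> q ?\<xi> \<beta> = (\<Sum>i=1..?n. pl l i q * \<beta> [vx i q])" if \<beta>: "\<beta> \<in> cotangent_space A q" for \<beta>
      by (subst pi_sum[OF \<beta> cot_phi[OF q]]) (simp_all add: pair_phi[OF q _ \<beta>])
    \<comment> \<open>Both sides equal \<pi>(dx_l, \<beta>): the left one after expanding \<beta> in
      dx and dy, the right one because the dy_u pair to 0.\<close>
    have eq: "\<pi> q ?\<xi> \<beta> = \<pi> q (\<theta> l q) \<beta>" if \<beta>: "\<beta> \<in> cotangent_space A q" for \<beta>
    proof -
      have cs: "(\<Sum>l=1..?n. \<beta> [vx l q] *\<^sub>R dx l q) \<in> cotangent_space A q" "(\<Sum>u=1..?m. \<beta> [vy u q] *\<^sub>R dy u q) \<in> cotangent_space A q"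
        by (intro alt_space_sum alt_space_scaleR cot_d)+
      have "\<pi> q (dx l q) \<beta> = - \<pi> q \<beta> (dx l q)" by (rule pi_antisym[OF cot_d(1) \<beta>])
      also have "\<pi> q \<beta> (dx l q) = (\<Sum>i=1..?n. \<beta> [vx i q] * \<pi> q (dx i q) (dx l q)) + (\<Sum>u=1..?m. \<beta> [vy u q] * \<pi> q (dy u q) (dx l q))"
        by (subst cexp[OF q \<beta>]) (simp add: pi_add[OF cs(1) cot_d(1) cs(2)] pi_sum[OF cot_d(1)] cot_d)
      also have "\<dots> = (\<Sum>i=1..?n. \<beta> [vx i q] * \<pi> q (dx i q) (dx l q))"
        by (simp add: pair_dy[OF q _ cot_d(1)])
      also have "- \<dots> = (\<Sum>i=1..?n. pl l i q * \<beta> [vx i q])"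
        unfolding sum_negf[symmetric] pl by (intro sum.cong refl) (simp add: pi_antisym[OF cot_d(1) cot_d(1), of q l])
      finally show ?thesis using pth[OF \<beta>] p\<xi>[OF \<beta>] by simp
    qed
    \<comment> \<open>The difference is in the kernel of the anchor by \<open>eq\<close> and in
      \<open>H q\<close> as a combination of sections; these subspaces meet in 0 only.\<close>
    let ?\<delta> = "(- 1) *\<^sub>R \<theta> l q + ?\<xi>"
    have c\<delta>: "?\<delta> \<in> cotangent_space A q" by (intro alt_space_add alt_space_scaleR cth c\<xi>)
    have "anchor A \<pi> q ?\<delta> = 0"
    proof (rule anchor_eqI[OF c\<delta> tangent_space_0])
      fix \<beta> assume \<beta>: "\<beta> \<in> cotangent_space A q"
      show "\<beta> [0] = \<pi> q ?\<delta> \<beta>"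
        using pi_linear[OF cth \<beta> c\<xi>, of "- 1"] eq[OF \<beta>] covector_vec_0[OF \<beta>] by simp
    qed
    then have "?\<delta> \<in> anchor_ker A \<pi> q" using c\<delta> by (simp add: anchor_ker_def)
    moreover have "?\<delta> \<in> H q"
      using Hsub(1)[OF qW] theta_H(2)[OF l q] phiH(1)[OF q]
      by (intro subspace_add subspace_scale subspace_sum) auto
    ultimately have "?\<delta> = 0" using Hsub(3)[OF qW] by blast
    then show ?thesis by simp
  qed
  \<comment> \<open>\<pi>(\<phi>_k, dx_i) computed twice: through the anchor of \<phi>_k, which is
    the k-th coordinate vector, and through the components of \<phi>_k.\<close>
  have Q_P: "(\<Sum>l=1..?n. Q k l q * pl l i q) = (if k = i then 1 else 0)"
    if q: "q \<in> U" and k: "k \<in> {1..?n}" and i: "i \<in> {1..?n}" for q k i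
  proof -
    note qS = US[OF q]
    have cs: "(\<Sum>l=1..?n. \<phi> k q [vx l q] *\<^sub>R dx l q) \<in> cotangent_space A q" "(\<Sum>u=1..?m. \<phi> k q [vy u q] *\<^sub>R dy u q) \<in> cotangent_space A q"
      by (intro alt_space_sum alt_space_scaleR cot_d)+
    have "(if k = i then 1 else 0) = \<pi> q (\<phi> k q) (dx i q)"
      using pair_phi[OF qS k cot_d(1), of i] dual(1)[OF qS k i] by simp
    also have "\<dots> = (\<Sum>l=1..?n. \<phi> k q [vx l q] * \<pi> q (dx l q) (dx i q))"
      by (subst cexp[OF qS cot_phi[OF qS k]])
        (simp add: pi_add[OF cs(1) cot_d(1) cs(2)] pi_sum[OF cot_d(1)] cot_d pair_dy[OF qS _ cot_d(1)])
    also have "\<dots> = (\<Sum>l=1..?n. Q k l q * pl l i q)" using k by (simp add: Q_def U(3)[OF q] pl)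
    finally show ?thesis by simp
  qed
  \<comment> \<open>A left inverse of a matrix coincides with a right inverse.\<close>
  have Q_pu: "Q k l q = pu k l q" if q: "q \<in> U" and k: "k \<in> {1..?n}" and l: "l \<in> {1..?n}" for q k l
  proof -
    have inv: "(\<Sum>i=1..?n. pl j i q * pu i l q) = (if j = l then 1 else 0)" if "j \<in> {1..?n}" for j
      using pu[of q] US[OF q] S(6) that l unfolding inverse_matrix_def by blast
    have "Q k l q = (\<Sum>j=1..?n. Q k j q * (\<Sum>i=1..?n. pl j i q * pu i l q))"
      using l by (simp add: inv if_distrib[of "\<lambda>x. _ * x"] cong: if_cong)
    also have "\<dots> = (\<Sum>i=1..?n. (\<Sum>j=1..?n. Q k j q * pl j i q) * pu i l q)"
      by (simp add: sum_distrib_left sum_distrib_right mult.assoc) (rule sum.swap)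
    also have "\<dots> = pu k l q"
      using k by (simp add: Q_P[OF q k] if_distrib[of "\<lambda>x. x * _"] cong: if_cong)
    finally show ?thesis .
  qed

  \<comment> \<open>Parallelism in terms of the bracket, and the flat frame\<close>
  have form_psi: "\<psi> k \<in> Omega A 1" for k
    unfolding \<psi>_def by (intro Omega_add Omega_sum Omega_fmul Omega_diff_fun smooth_X smooth_Y smooth_Q smooth_C)
  have flat_psi: "br (fun_form f) (\<psi> k) q = 0" if q: "q \<in> U" and f: "smooth_fun_on A UNIV f" and k: "k \<in> {1..?n}" for q f k
    by (rule br_parallel[OF connection par_phi[OF k] _ f form_psi near[OF q]])
      (use US[OF q] S(5) k psi_U in auto)
  have flat_dY: "br (fun_form f) (diff_fun A (Y u)) q = 0" if q: "q \<in> U" and f: "smooth_fun_on A UNIV f" and u: "u \<in> {1..?m}" for q f u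
    by (rule br_parallel[OF connection par_dy[OF u] _ f Omega_diff_fun[OF smooth_Y] near[OF q]])
      (use US[OF q] S(5) dY in auto)
  interpret F: flat_frame A \<pi> D br mc U ?n ?m X Y vx vy P Q a' C \<psi>
  proof
    fix q \<alpha> assume q: "q \<in> U" and \<alpha>: "\<alpha> \<in> cotangent_space A q"
    show "\<alpha> = (\<Sum>l=1..?n. \<alpha> [vx l q] *\<^sub>R diff_fun A (X l) q) + (\<Sum>u=1..?m. \<alpha> [vy u q] *\<^sub>R diff_fun A (Y u) q)"
      unfolding dX[OF q] dY[OF q] by (rule cexp[OF US[OF q] \<alpha>])
  next
    fix q i l assume q: "q \<in> U" and i: "i \<in> {1..?n}" and l: "l \<in> {1..?n}"
    show "vx i q (X l) = (if i = l then 1 else 0)"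
      using dual(1)[OF US[OF q] i l] by (simp add: dX[OF q, symmetric] diff_fun_apply vt)
    show "P i l q = pb (X i) (X l) q" by (simp add: P_def)
    show "(\<Sum>j=1..?n. Q i j q * P j l q) = (if i = l then 1 else 0)"
      using Q_P[OF q i l] by (simp add: P_pl q)
  next
    fix q u v assume q: "q \<in> U" and u: "u \<in> {1..?m}" and v: "v \<in> {1..?m}"
    show "vy u q (Y v) = (if u = v then 1 else 0)"
      using dual'(2)[OF US[OF q] u v] by (simp add: dY[OF q, symmetric] diff_fun_apply vt)
  next
    fix q k \<beta> assume q: "q \<in> U" and k: "k \<in> {1..?n}" and \<beta>: "\<beta> \<in> cotangent_space A q"
    show "\<pi> q (\<psi> k q) \<beta> = \<beta> [vx k q]"
      unfolding psi_U[OF q k] by (rule pair_phi[OF US[OF q] k \<beta>])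
  next
    fix q u \<beta> assume q: "q \<in> U" and u: "u \<in> {1..?m}" and \<beta>: "\<beta> \<in> cotangent_space A q"
    show "\<pi> q (diff_fun A (Y u) q) \<beta> = 0"
      unfolding dY[OF q] by (rule pair_dy[OF US[OF q] u \<beta>])
  next
    fix q l assume q: "q \<in> U" and l: "l \<in> {1..?n}"
    show "(\<Sum>i=1..?n. P l i q *\<^sub>R \<psi> i q) = diff_fun A (X l) q + (\<Sum>u=1..?m. a' l u q *\<^sub>R diff_fun A (Y u) q)"
      using theta_phi[OF US[OF q] l] l by (simp add: P_pl q psi_U theta_apply dX dY a'_U)
  next
    show "\<psi> k = (\<Sum>l=1..?n. fmul (Q k l) (diff_fun A (X l))) + (\<Sum>u=1..?m. fmul (C k u) (diff_fun A (Y u)))" for k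
      by (simp add: \<psi>_def)
  qed (fact metacurvature U(1) smooth_X smooth_Y smooth_P smooth_Q smooth_a' smooth_C | rule vt | erule (2) flat_psi flat_dY)+

  \<comment> \<open>Translation into coordinate derivatives\<close>
  have delta_Dx: "F.delta i f q = Dx i g q" if "q \<in> U" "i \<in> {1..?n}" "\<And>p. p \<in> U \<Longrightarrow> f p = g p" for i f g q
    unfolding D_eq by (rule F.delta_cong[OF that])
  define T where "T = (\<lambda>k u v l p. pu k l p *
                (Dy v (a l u) p - Dy u (a l v) p +
                 (\<Sum>m=1..2*r. a m u p * Dx m (a l v) p - a m v p * Dx m (a l u) p)))"
  \<comment> \<open>The cut-off version of \<open>T\<close> with the smooth components of \<phi>_k
    in place of \<open>pu\<close>: globally smooth, and equal to \<open>T\<close> on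
    \<open>U\<close>.\<close>
  define G where "G = (\<lambda>k u v l p. \<eta> p * (\<phi> k p [vx l p] *
                (vy v p (a l u) - vy u p (a l v) +
                 (\<Sum>m=1..2*r. a m u p * vx m p (a l v) - a m v p * vx m p (a l u)))))"
  have smooth_G: "smooth_fun_on A UNIV (G k u v l)"
    if "k \<in> {1..?n}" "l \<in> {1..?n}" "u \<in> {1..?m}" "v \<in> {1..?m}" for k l u v
    unfolding G_def using that
    by (intro cut smooth_fun_on_mult smooth_fun_on_add smooth_fun_on_diff smooth_fun_on_sum v_smooth smooth_aS phi_v) auto
  have G_T: "G k u v l p = T k u v l p" if "p \<in> U" "k \<in> {1..?n}" "l \<in> {1..?n}" for k u v l p
    using Q_pu[OF that] that by (simp add: G_def T_def D_eq Q_def U(3))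
  have a'_germ: "vx i p (a' l u) = vx i p (a l u)" "vy i p (a' l u) = vy i p (a l u)"
    if "p \<in> U" "l \<in> {1..?n}" "u \<in> {1..?m}" for p i l u
    by (rule tangent_cong[OF vt(1)], rule near[OF that(1)], erule a'_U[OF _ that(2,3)],
      rule tangent_cong[OF vt(2)], rule near[OF that(1)], erule a'_U[OF _ that(2,3)])
  \<comment> \<open>The sign is opposite to that of the function in (b) and of the R of the
    overview: on \<open>U\<close>, \<open>F.Yv u (a' l v) - F.Yv v (a' l u)\<close> is minus the
    parenthesis in \<open>T\<close>.\<close>
  define R where "R = (\<lambda>k u v. if u \<in> {1..?m} \<and> v \<in> {1..?m} then (\<lambda>p. - (\<Sum>l=1..?n. G k u v l p)) else (\<lambda>p. 0))"
  have smooth_R: "smooth_fun_on A UNIV (R k u v)" if "k \<in> {1..?n}" for k u v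
  proof (cases "u \<in> {1..?m} \<and> v \<in> {1..?m}")
    case True
    have "smooth_fun_on A UNIV (\<lambda>p. 0 - (\<Sum>l=1..?n. G k u v l p))"
      using True that by (intro smooth_fun_on_diff smooth_fun_on_const smooth_fun_on_sum smooth_G) auto
    then show ?thesis using True by (simp add: R_def)
  qed (auto simp: R_def smooth_fun_on_const)
  have R_eq: "R k u v p = (\<Sum>l=1..?n. Q k l p * (F.Yv u (a' l v) p - F.Yv v (a' l u) p))"
    if p: "p \<in> U" and k: "k \<in> {1..?n}" and u: "u \<in> {1..?m}" and v: "v \<in> {1..?m}" for k u v p
  proof -
    have "- G k u v l p = Q k l p * (F.Yv u (a' l v) p - F.Yv v (a' l u) p)" if l: "l \<in> {1..?n}" for l
    proof -
      have Yv: "F.Yv u (a' l v) p = vy u p (a l v) - (\<Sum>m=1..?n. a m u p * vx m p (a l v))"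
        if "u \<in> {1..?m}" "v \<in> {1..?m}" for u v
        using that l p by (simp add: F.Yv_def a'_germ a'_U)
      show ?thesis unfolding Yv[OF u v] Yv[OF v u] using k
        by (simp add: G_def Q_def U(3)[OF p] sum_subtractf algebra_simps)
    qed
    then show ?thesis using u v by (simp add: R_def sum_negf[symmetric])
  qed
  have delta_R: "F.delta i (F.delta j (R k u v)) q = - (\<Sum>l=1..?n. Dx i (Dx j (T k u v l)) q)"
    if "q \<in> U" "i \<in> {1..?n}" "j \<in> {1..?n}" "k \<in> {1..?n}" "u \<in> {1..?m}" "v \<in> {1..?m}" for i j k u v q
  proof -
    have 1: "F.delta j (R k u v) p = - (\<Sum>l=1..?n. F.delta j (G k u v l) p)" if p: "p \<in> U" for p
      by (rule F.delta_minus_sum[OF p \<open>j \<in> {1..?n}\<close>]) (use that \<open>k \<in> {1..?n}\<close> \<open>u \<in> {1..?m}\<close> \<open>v \<in> {1..?m}\<close> in \<open>auto intro: smooth_G simp: R_def\<close>)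
    have "F.delta i (F.delta j (R k u v)) q = - (\<Sum>l=1..?n. F.delta i (F.delta j (G k u v l)) q)"
      by (rule F.delta_minus_sum[OF that(1,2) F.smooth_delta[OF smooth_G[OF that(4) _ that(5,6)]] 1])
    also have "(\<Sum>l=1..?n. F.delta i (F.delta j (G k u v l)) q) = (\<Sum>l=1..?n. Dx i (Dx j (T k u v l)) q)"
      using that by (intro sum.cong refl delta_Dx G_T) auto
    finally show ?thesis .
  qed

  have main: "mc q (\<phi> i q) (\<phi> j q) (\<phi> k q) =
         - (\<Sum>l=1..2*r. \<Sum>m\<in>{l<..2*r}.
              Dx i (Dx j (Dx k (pl l m))) q *\<^sub>R alt_wedge (\<phi> l q) (\<phi> m q))
         + (\<Sum>l=1..2*r. \<Sum>u=1..d-2*r.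
              Dx i (Dx j (Dx k (a l u))) q *\<^sub>R alt_wedge (\<phi> l q) (dy u q))
         + (\<Sum>u=1..d-2*r. \<Sum>v\<in>{u<..d-2*r}. \<Sum>l=1..2*r.
              Dx i (Dx j (T k u v l)) q *\<^sub>R alt_wedge (dy u q) (dy v q))"
    if q: "q \<in> U" and i: "i \<in> {1..?n}" and j: "j \<in> {1..?n}" and k: "k \<in> {1..?n}" for q i j k
  proof -
    \<comment> \<open>\<open>delta_Dx\<close> strips the outermost derivative and leaves an equality
      of the arguments on all of \<open>U\<close>, so it can be repeated until \<open>P_pl\<close>
      applies.\<close>
    have 1: "(\<Sum>l=1..?n. \<Sum>m\<in>{l<..?n}. F.delta i (F.delta j (F.delta k (P l m))) q *\<^sub>R alt_wedge (\<psi> l q) (\<psi> m q)) =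
        (\<Sum>l=1..?n. \<Sum>m\<in>{l<..?n}. Dx i (Dx j (Dx k (pl l m))) q *\<^sub>R alt_wedge (\<phi> l q) (\<phi> m q))"
      using q i j k by (intro sum.cong refl arg_cong2[where f = scaleR] arg_cong2[where f = alt_wedge] delta_Dx P_pl psi_U) auto
    have 2: "(\<Sum>l=1..?n. \<Sum>u=1..?m. F.delta i (F.delta j (F.delta k (a' l u))) q *\<^sub>R alt_wedge (\<psi> l q) (diff_fun A (Y u) q)) =
        (\<Sum>l=1..?n. \<Sum>u=1..?m. Dx i (Dx j (Dx k (a l u))) q *\<^sub>R alt_wedge (\<phi> l q) (dy u q))"
      using q i j k by (intro sum.cong refl arg_cong2[where f = scaleR] arg_cong2[where f = alt_wedge] delta_Dx a'_U psi_U dY) auto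
    \<comment> \<open>The minus sign of \<open>R\<close> cancels the one in
      \<open>mc_phi_formula\<close>, and the sum over l inside the coefficient is drawn out to match
      the triple sum.\<close>
    have 3: "(\<Sum>u=1..?m. \<Sum>v\<in>{u<..?m}. F.delta i (F.delta j (R k u v)) q *\<^sub>R alt_wedge (diff_fun A (Y u) q) (diff_fun A (Y v) q)) =
        - (\<Sum>u=1..?m. \<Sum>v\<in>{u<..?m}. \<Sum>l=1..?n. Dx i (Dx j (T k u v l)) q *\<^sub>R alt_wedge (dy u q) (dy v q))"
      unfolding sum_negf[symmetric]
      by (intro sum.cong refl) (use q i j k in \<open>simp add: delta_R dY scaleR_sum_left sum_negf\<close>)
    show ?thesis
      using F.mc_phi_formula[OF q j k smooth_R[OF k] R_eq[OF _ k], of i]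
      unfolding 1 2 3 using q i j k by (simp add: psi_U)
  qed
  have "\<forall>q\<in>U. (\<forall>u\<in>{1..?m}. \<forall>\<beta>\<in>cotangent_space A q. \<forall>\<gamma>\<in>cotangent_space A q. mc q (dy u q) \<beta> \<gamma> = 0)"
    using F.mc_dY dY by simp
  then show ?thesis
    using main unfolding T_def by (intro near[OF U(2)]) blast
qed

end
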